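(* Let $I\subset\mathbb{R}$ be an open interval, $(F,g_F)$ a pseudo-Riemannian manifold, $f:I\to(0,\infty)$ smooth, and let $M=I\times F$ carry the metric $g=-dt^2+f(t)^2g_F$; put $\overline n=\dim M$. Let $\lambda_1,\lambda_2$ be nonzero real constants, $P\in\Gamma(TF)$, and let $\overline\nabla$ be the quarter-symmetric connection on $M$ determined by $P,\lambda_1,\lambda_2$. Suppose $(M,\overline\nabla)$ has constant scalar curvature $\overline S$. Then: (1) if $\lambda_1+\lambda_2\neq0$, $\lambda_1^2+\lambda_2^2-\overline n\lambda_1\lambda_2=0$ and $div_FP$ is a constant, then $S^F$ is a constant; (2) if $\lambda_1=-\lambda_2\neq0$ and $g_F(P,P)$ is a constant, then $S^F$ is a constant; (3) if $\lambda_1+\lambda_2\neq0$, $\lambda_1^2+\lambda_2^2-\overline n\lambda_1\lambda_2\neq0$, and $div_FP$ and $g_F(P,P)$ are constants, then $S^F$ is a constant.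
   Context: On a pseudo-Riemannian manifold $(M,g)$ with Levi-Civita connection $\nabla$, a vector field $P$, the 1-form $\pi(X)=g(X,P)$ and nonzero real constants $\lambda_1,\lambda_2$, the quarter-symmetric connection is $\overline\nabla_XY=\nabla_XY+\lambda_1\pi(Y)X-\lambda_2g(X,Y)P$. Its curvature is $\overline R(X,Y)=\overline\nabla_X\overline\nabla_Y-\overline\nabla_Y\overline\nabla_X-\overline\nabla_{[X,Y]}$, its Ricci tensor is $\overline{Ric}(X,Y)=\sum_k\varepsilon_k\,g(\overline R(X,E_k)Y,E_k)$ and its scalar curvature is $\overline S=\sum_k\varepsilon_k\overline{Ric}(E_k,E_k)$, where $(E_k)$ is a local orthonormal frame with $g(E_k,E_k)=\varepsilon_k=\pm1$ (note the sign convention). $S^F$ is the scalar curvature of the Levi-Civita connection of $(F,g_F)$, with the same convention. $P\in\Gamma(TF)$ means that $P$ is (the lift to $M$ of) a vector field on $F$; $div_FP$ is its divergence on $(F,g_F)$. *)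

theory Defs
  imports "HOL-Analysis.Analysis"
begin

section \<open>Smooth manifolds\<close>

text \<open>Smoothness is only used on open sets, where \<^term>\<open>ck_on k f S\<close> is the usual class of
  \<open>k\<close> times continuously differentiable maps.\<close>

primrec ck_on :: "nat \<Rightarrow> ('a::real_normed_vector \<Rightarrow> 'b::real_normed_vector) \<Rightarrow> 'a set \<Rightarrow> bool" where
  "ck_on 0 f S \<longleftrightarrow> continuous_on S f"
| "ck_on (Suc k) f S \<longleftrightarrow>
     f differentiable_on S \<and> (\<forall>v. ck_on k (\<lambda>x. frechet_derivative f (at x) v) S)"

definition smooth_on :: "'a::real_normed_vector set \<Rightarrow> ('a \<Rightarrow> 'b::real_normed_vector) \<Rightarrow> bool" where
  "smooth_on S f \<longleftrightarrow> (\<forall>k. ck_on k f S)"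

type_synonym ('m, 'e) chart = "'m set \<times> ('m \<Rightarrow> 'e)"

text \<open>The underlying set of a manifold is the union of the chart domains, an open subset of the
  ambient Hausdorff second countable space. The atlas need not be maximal.\<close>

definition carrier :: "('m, 'e) chart set \<Rightarrow> 'm set" where
  "carrier A = (\<Union>(U, \<phi>)\<in>A. U)"

definition smooth_manifold ::
    "('m::{t2_space, second_countable_topology}, 'e::euclidean_space) chart set \<Rightarrow> bool" where
  "smooth_manifold A \<longleftrightarrow>
     (\<forall>(U, \<phi>)\<in>A. open U \<and> open (\<phi> ` U) \<and> homeomorphism U (\<phi> ` U) \<phi> (inv_into U \<phi>)) \<and>
     (\<forall>(U, \<phi>)\<in>A. \<forall>(V, \<psi>)\<in>A. smooth_on (\<phi> ` (U \<inter> V)) (\<psi> \<circ> inv_into U \<phi>))"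

definition mdim :: "('m, 'e::euclidean_space) chart set \<Rightarrow> nat" where
  "mdim A = DIM('e)"

definition smooth_fun :: "('m, 'e::euclidean_space) chart set \<Rightarrow> 'm set \<Rightarrow> ('m \<Rightarrow> real) \<Rightarrow> bool" where
  "smooth_fun A W h \<longleftrightarrow> (\<forall>(U, \<phi>)\<in>A. smooth_on (\<phi> ` (U \<inter> W)) (h \<circ> inv_into U \<phi>))"

definition smooth_near ::
    "('m::topological_space, 'e::euclidean_space) chart set \<Rightarrow> 'm \<Rightarrow> ('m \<Rightarrow> real) \<Rightarrow> bool" where
  "smooth_near A p h \<longleftrightarrow> (\<exists>W. open W \<and> p \<in> W \<and> W \<subseteq> carrier A \<and> smooth_fun A W h)"

definition prod_atlas ::
    "('m, 'e) chart set \<Rightarrow> ('n, 'd) chart set \<Rightarrow> ('m \<times> 'n, 'e \<times> 'd) chart set" where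
  "prod_atlas A B = {(U \<times> V, map_prod \<phi> \<psi>) | U \<phi> V \<psi>. (U, \<phi>) \<in> A \<and> (V, \<psi>) \<in> B}"


section \<open>Tangent vectors and vector fields\<close>

text \<open>Tangent vectors at \<open>p\<close> are the derivations on germs at \<open>p\<close> of smooth functions. As functionals
  are total, they are required to vanish on functions that are not smooth near \<open>p\<close>; in this way
  equality of tangent vectors is equality of functionals.\<close>

type_synonym 'm tvec = "('m \<Rightarrow> real) \<Rightarrow> real"
type_synonym 'm vfield = "'m \<Rightarrow> 'm tvec"

definition tangent_space ::
    "('m::topological_space, 'e::euclidean_space) chart set \<Rightarrow> 'm \<Rightarrow> 'm tvec set" where
  "tangent_space A p = {v.
     (\<forall>h. \<not> smooth_near A p h \<longrightarrow> v h = 0) \<and>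
     (\<forall>h k W. smooth_near A p h \<and> open W \<and> p \<in> W \<and> (\<forall>q\<in>W. h q = k q) \<longrightarrow> v h = v k) \<and>
     (\<forall>h k. smooth_near A p h \<and> smooth_near A p k \<longrightarrow> v (\<lambda>q. h q + k q) = v h + v k) \<and>
     (\<forall>a h. smooth_near A p h \<longrightarrow> v (\<lambda>q. a * h q) = a * v h) \<and>
     (\<forall>h k. smooth_near A p h \<and> smooth_near A p k \<longrightarrow>
        v (\<lambda>q. h q * k q) = v h * k p + h p * v k)}"

definition vector_field_on ::
    "('m::topological_space, 'e::euclidean_space) chart set \<Rightarrow> 'm set \<Rightarrow> 'm vfield \<Rightarrow> bool" where
  "vector_field_on A W X \<longleftrightarrow> open W \<and> W \<subseteq> carrier A \<and>
     (\<forall>p\<in>W. X p \<in> tangent_space A p) \<and>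
     (\<forall>V h. open V \<and> V \<subseteq> W \<and> smooth_fun A V h \<longrightarrow> smooth_fun A V (\<lambda>p. X p h))"

definition lie_bracket ::
    "('m::topological_space, 'e::euclidean_space) chart set \<Rightarrow> 'm vfield \<Rightarrow> 'm vfield \<Rightarrow> 'm vfield" where
  "lie_bracket A X Y = (\<lambda>p h.
     if smooth_near A p h then X p (\<lambda>q. Y q h) - Y p (\<lambda>q. X q h) else 0)"


section \<open>Metrics, connections, curvature\<close>

type_synonym 'm metric = "'m \<Rightarrow> 'm tvec \<Rightarrow> 'm tvec \<Rightarrow> real"

definition pseudo_riemannian ::
    "('m::{t2_space, second_countable_topology}, 'e::euclidean_space) chart set \<Rightarrow> 'm metric \<Rightarrow> bool" where
  "pseudo_riemannian A g \<longleftrightarrow> smooth_manifold A \<and>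
     (\<forall>p\<in>carrier A.
        (\<forall>u\<in>tangent_space A p. \<forall>v\<in>tangent_space A p. g p u v = g p v u) \<and>
        (\<forall>u\<in>tangent_space A p. \<forall>v\<in>tangent_space A p. \<forall>w\<in>tangent_space A p.
           g p (\<lambda>h. u h + v h) w = g p u w + g p v w) \<and>
        (\<forall>a. \<forall>u\<in>tangent_space A p. \<forall>v\<in>tangent_space A p. g p (\<lambda>h. a * u h) v = a * g p u v) \<and>
        (\<forall>u\<in>tangent_space A p. (\<forall>v\<in>tangent_space A p. g p u v = 0) \<longrightarrow> u = (\<lambda>h. 0))) \<and>
     (\<forall>W X Y. vector_field_on A W X \<and> vector_field_on A W Y \<longrightarrow>
        smooth_fun A W (\<lambda>p. g p (X p) (Y p)))"

text \<open>A connection acts on vector fields over arbitrary open sets \<open>W\<close>. The values of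
  \<^term>\<open>D X Y\<close> on \<open>W\<close> depend only on the restrictions of \<open>X\<close> and \<open>Y\<close> to \<open>W\<close>.\<close>

definition affine_connection ::
    "('m::topological_space, 'e::euclidean_space) chart set \<Rightarrow> ('m vfield \<Rightarrow> 'm vfield \<Rightarrow> 'm vfield) \<Rightarrow> bool" where
  "affine_connection A D \<longleftrightarrow>
     (\<forall>W X Y. vector_field_on A W X \<and> vector_field_on A W Y \<longrightarrow> vector_field_on A W (D X Y)) \<and>
     (\<forall>W X X' Y Y'. vector_field_on A W X \<and> vector_field_on A W Y \<and>
        (\<forall>p\<in>W. X p = X' p \<and> Y p = Y' p) \<longrightarrow> (\<forall>p\<in>W. D X Y p = D X' Y' p)) \<and>
     (\<forall>W X Y Z. vector_field_on A W X \<and> vector_field_on A W Y \<and> vector_field_on A W Z \<longrightarrow>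
        (\<forall>p\<in>W. \<forall>h. D (\<lambda>q k. X q k + Y q k) Z p h = D X Z p h + D Y Z p h \<and>
                  D X (\<lambda>q k. Y q k + Z q k) p h = D X Y p h + D X Z p h)) \<and>
     (\<forall>W a X Y. vector_field_on A W X \<and> vector_field_on A W Y \<and> smooth_fun A W a \<longrightarrow>
        (\<forall>p\<in>W. \<forall>h. D (\<lambda>q k. a q * X q k) Y p h = a p * D X Y p h \<and>
                  D X (\<lambda>q k. a q * Y q k) p h = X p a * Y p h + a p * D X Y p h))"

definition levi_civita ::
    "('m::topological_space, 'e::euclidean_space) chart set \<Rightarrow> 'm metric \<Rightarrow>
     ('m vfield \<Rightarrow> 'm vfield \<Rightarrow> 'm vfield) \<Rightarrow> bool" where
  "levi_civita A g D \<longleftrightarrow> affine_connection A D \<and>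
     (\<forall>W X Y. vector_field_on A W X \<and> vector_field_on A W Y \<longrightarrow>
        (\<forall>p\<in>W. \<forall>h. D X Y p h - D Y X p h = lie_bracket A X Y p h)) \<and>
     (\<forall>W X Y Z. vector_field_on A W X \<and> vector_field_on A W Y \<and> vector_field_on A W Z \<longrightarrow>
        (\<forall>p\<in>W. X p (\<lambda>q. g q (Y q) (Z q)) = g p (D X Y p) (Z p) + g p (Y p) (D X Z p)))"

definition quarter_symmetric ::
    "'m metric \<Rightarrow> ('m vfield \<Rightarrow> 'm vfield \<Rightarrow> 'm vfield) \<Rightarrow> 'm vfield \<Rightarrow> real \<Rightarrow> real \<Rightarrow>
     ('m vfield \<Rightarrow> 'm vfield \<Rightarrow> 'm vfield)" where
  "quarter_symmetric g D P a b = (\<lambda>X Y p h.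
     D X Y p h + a * g p (Y p) (P p) * X p h - b * g p (X p) (Y p) * P p h)"

definition curvature ::
    "('m::topological_space, 'e::euclidean_space) chart set \<Rightarrow> ('m vfield \<Rightarrow> 'm vfield \<Rightarrow> 'm vfield) \<Rightarrow>
     'm vfield \<Rightarrow> 'm vfield \<Rightarrow> 'm vfield \<Rightarrow> 'm vfield" where
  "curvature A D X Y Z = (\<lambda>p h.
     D X (D Y Z) p h - D Y (D X Z) p h - D (lie_bracket A X Y) Z p h)"

definition orthonormal_frame ::
    "('m::topological_space, 'e::euclidean_space) chart set \<Rightarrow> 'm metric \<Rightarrow> 'm set \<Rightarrow> (nat \<Rightarrow> 'm vfield) \<Rightarrow> bool" where
  "orthonormal_frame A g W E \<longleftrightarrow>
     (\<forall>k<mdim A. vector_field_on A W (E k)) \<and>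
     (\<forall>p\<in>W. \<forall>i<mdim A. \<forall>j<mdim A.
        if i = j then g p (E i p) (E j p) \<in> {1, -1} else g p (E i p) (E j p) = 0)"

text \<open>An arbitrary choice of an orthonormal frame near each point. The contractions below do not
  depend on it. The signs \<open>\<epsilon>\<^sub>k\<close> are written as \<^term>\<open>g p (E k p) (E k p)\<close>.\<close>

definition frame_at ::
    "('m::topological_space, 'e::euclidean_space) chart set \<Rightarrow> 'm metric \<Rightarrow> 'm \<Rightarrow> (nat \<Rightarrow> 'm vfield)" where
  "frame_at A g p = (SOME E. \<exists>W. open W \<and> p \<in> W \<and> orthonormal_frame A g W E)"

text \<open>With this sign convention the Ricci tensor of the round sphere is negative definite.\<close>

definition ricci ::
    "('m::topological_space, 'e::euclidean_space) chart set \<Rightarrow> 'm metric \<Rightarrow>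
     ('m vfield \<Rightarrow> 'm vfield \<Rightarrow> 'm vfield) \<Rightarrow> 'm vfield \<Rightarrow> 'm vfield \<Rightarrow> 'm \<Rightarrow> real" where
  "ricci A g D X Y p = (let E = frame_at A g p in
     \<Sum>k<mdim A. g p (E k p) (E k p) * g p (curvature A D X (E k) Y p) (E k p))"

definition scalar_curvature ::
    "('m::topological_space, 'e::euclidean_space) chart set \<Rightarrow> 'm metric \<Rightarrow>
     ('m vfield \<Rightarrow> 'm vfield \<Rightarrow> 'm vfield) \<Rightarrow> 'm \<Rightarrow> real" where
  "scalar_curvature A g D p = (let E = frame_at A g p in
     \<Sum>k<mdim A. g p (E k p) (E k p) * ricci A g D (E k) (E k) p)"

definition divergence ::
    "('m::topological_space, 'e::euclidean_space) chart set \<Rightarrow> 'm metric \<Rightarrow>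
     ('m vfield \<Rightarrow> 'm vfield \<Rightarrow> 'm vfield) \<Rightarrow> 'm vfield \<Rightarrow> 'm \<Rightarrow> real" where
  "divergence A g D P p = (let E = frame_at A g p in
     \<Sum>k<mdim A. g p (E k p) (E k p) * g p (D (E k) P p) (E k p))"


section \<open>Warped products over an interval\<close>

definition interval_prod :: "real set \<Rightarrow> ('m, 'e) chart set \<Rightarrow> (real \<times> 'm, real \<times> 'e) chart set" where
  "interval_prod I A = prod_atlas {(I, \<lambda>t. t)} A"

text \<open>The metric \<open>-dt\<^sup>2 + f\<^sup>2 g\<^sub>F\<close>: \<^term>\<open>u fst\<close> is \<open>dt(u)\<close>, and
  \<^term>\<open>\<lambda>h. u (h \<circ> snd)\<close> is the image of \<open>u\<close> under the differential of the projection to the fibre.\<close>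

definition warped_metric :: "(real \<Rightarrow> real) \<Rightarrow> 'm metric \<Rightarrow> (real \<times> 'm) metric" where
  "warped_metric f gF = (\<lambda>(t, x) u v.
     - (u fst * v fst) + (f t)\<^sup>2 * gF x (\<lambda>h. u (h \<circ> snd)) (\<lambda>h. v (h \<circ> snd)))"

text \<open>The lift of a vector field on the fibre, i.e. its image under the inclusions of the fibres
  \<open>{t} \<times> F\<close>.\<close>

definition lift_field ::
    "real set \<Rightarrow> ('m::topological_space, 'e::euclidean_space) chart set \<Rightarrow> 'm vfield \<Rightarrow> (real \<times> 'm) vfield" where
  "lift_field I A P = (\<lambda>(t, x) h.
     if smooth_near (interval_prod I A) (t, x) h then P x (\<lambda>y. h (t, y)) else 0)"

end

theory Submission
  imports Defs
begin

text \<open>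
  Contracting the curvature of \<open>\<nabla>\<^sub>X Y + \<lambda>\<^sub>1 \<pi>(Y) X - \<lambda>\<^sub>2 g(X,Y) P\<close> twice in an orthonormal frame gives
  \<open>S + (n - 1) (\<lambda>\<^sub>1 + \<lambda>\<^sub>2) div P + (n - 1) (n \<lambda>\<^sub>1 \<lambda>\<^sub>2 - \<lambda>\<^sub>1\<^sup>2 - \<lambda>\<^sub>2\<^sup>2) g(P,P)\<close> for its scalar curvature.
  On the warped product \<open>S(t,x) = S\<^sup>F(x) / f(t)\<^sup>2 + A(t)\<close>, the divergence of the lift of \<open>P\<close> is
  \<open>div\<^sub>F P\<close>, and \<open>g(P,P) = f\<^sup>2 g\<^sub>F(P,P)\<close>. Freezing \<open>t\<close>, constancy of the scalar curvature
  expresses \<open>S\<^sup>F\<close> through \<open>div\<^sub>F P\<close> and \<open>g\<^sub>F(P,P)\<close>, and in the first two cases one of the two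
  coefficients vanishes.

  As the scalar curvature is computed in an arbitrarily chosen frame, its frame independence is
  needed: the curvature is tensorial, and in an orthogonal frame every vector field is a
  combination of the frame fields with smooth coefficients. The latter rests on the fact that the space
  of derivations at a point has the dimension of the manifold.
\<close>

section \<open>Calculus of continuously differentiable maps\<close>

text \<open>Frames are orthogonal rather than orthonormal: the lift of an orthonormal fibre frame
  has squared lengths f^2 up to sign, and rescaling it would bring derivatives of 1/f into the
  computation. Traces therefore divide by g(e,e), which for a unit vector agrees with multiplication
  by its sign. The metric is indefinite, so a vector orthogonal to the earlier frame vectors may be
  null. Polarisation is the way out: a nondegenerate form cannot have only null vectors in the
  complement of non-null orthogonal vectors that do not yet span. The connections are given by their
  axioms alone. On the warped product the Levi-Civita connection is recovered from Koszul's formula,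
  by pairing with the field of the interval coordinate and with lifted fields. The factor n - 1
  counts the partners of an index in the double trace, as diagonal entries receive no correction.
  The contribution A(t) of the warping function is never simplified; only its independence of x
  enters.\<close>

lemma frechet_derivative_cong_open:
  assumes "open S" "x \<in> S" "\<And>y. y \<in> S \<Longrightarrow> f y = g y"
  shows "frechet_derivative f (at x) = frechet_derivative g (at x)"
proof -
  have "(f has_derivative D) (at x) \<longleftrightarrow> (g has_derivative D) (at x)" for D
    using assms by (metis has_derivative_transform_within_open)
  then show ?thesis unfolding frechet_derivative_def by simp
qed

lemma ck_on_subset: "ck_on k f S \<Longrightarrow> T \<subseteq> S \<Longrightarrow> ck_on k f T"
  by (induction k arbitrary: f) (auto intro: continuous_on_subset differentiable_on_subset)

lemma ck_on_cong:
  assumes "open S" "\<And>x. x \<in> S \<Longrightarrow> f x = g x" "ck_on k f S"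
  shows "ck_on k g S"
  using assms(2,3)
proof (induction k arbitrary: f g)
  case 0
  then show ?case by (metis ck_on.simps(1) continuous_on_cong)
next
  case (Suc k)
  have "g differentiable_on S"
    using Suc.prems differentiable_transform_within[of f _ S 1 g]
    by (auto simp: differentiable_on_def)
  moreover have "ck_on k (\<lambda>x. frechet_derivative g (at x) v) S" for v
  proof (rule Suc.IH)
    show "ck_on k (\<lambda>x. frechet_derivative f (at x) v) S" using Suc.prems by simp
  qed (use frechet_derivative_cong_open[OF assms(1)] Suc.prems(1) in metis)
  ultimately show ?case by simp
qed

text \<open>\<open>ck_on\<close> refers to the choice operator \<open>frechet_derivative\<close>. As
  derivatives at a point are unique, any explicit formula \<open>f'\<close> may take its place; the
  product, chain and integral rules below all enter here.\<close>

lemma ck_on_SucI: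
  assumes "open S" "\<And>x. x \<in> S \<Longrightarrow> (f has_derivative f' x) (at x)"
    "\<And>v. ck_on k (\<lambda>x. f' x v) S"
  shows "ck_on (Suc k) f S"
proof -
  have "f differentiable_on S"
    using assms(2) by (meson differentiableI differentiable_at_withinI differentiable_on_def)
  moreover have "ck_on k (\<lambda>x. frechet_derivative f (at x) v) S" for v
    by (rule ck_on_cong[OF assms(1) _ assms(3)[of v]])
      (use assms(2) frechet_derivative_at in metis)
  ultimately show ?thesis by simp
qed

lemma ck_on_SucD: "ck_on (Suc k) f S \<Longrightarrow> ck_on k f S"
  by (induction k arbitrary: f) (auto simp: differentiable_imp_continuous_on)

lemma ck_on_has_derivative:
  "ck_on (Suc k) f S \<Longrightarrow> open S \<Longrightarrow> x \<in> S \<Longrightarrow> (f has_derivative frechet_derivative f (at x)) (at x)"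
  by (metis at_within_open ck_on.simps(2) differentiable_on_def frechet_derivative_works)

lemma ck_on_local:
  assumes "\<And>x. x \<in> S \<Longrightarrow> \<exists>T. open T \<and> x \<in> T \<and> ck_on k f T"
  shows "ck_on k f S"
  using assms
proof (induction k arbitrary: f)
  case 0
  then show ?case
    by (metis ck_on.simps(1) continuous_at_imp_continuous_on continuous_on_eq_continuous_at)
next
  case (Suc k)
  have "f differentiable_on S"
    unfolding differentiable_on_def
    by (metis Suc.prems at_within_open ck_on.simps(2) differentiable_on_def
        differentiable_at_withinI)
  moreover have "ck_on k (\<lambda>x. frechet_derivative f (at x) v) S" for v
    by (rule Suc.IH) (use Suc.prems in fastforce)
  ultimately show ?case by simp
qed

lemma ck_on_const: "ck_on k (\<lambda>x. c) S"
proof (induction k arbitrary: c)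
  case (Suc k)
  have "(\<lambda>x. c) differentiable_on S" by simp
  then show ?case using Suc by (simp add: frechet_derivative_const)
qed simp

lemma ck_on_bounded_linear: "bounded_linear L \<Longrightarrow> open S \<Longrightarrow> ck_on k L S"
proof (cases k)
  case (Suc j)
  assume "bounded_linear L" "open S"
  then show ?thesis unfolding Suc
    by (intro ck_on_SucI[where f' = "\<lambda>_. L"]) (auto intro: bounded_linear_imp_has_derivative ck_on_const)
qed (simp add: bounded_linear.continuous_on[of _ _ "\<lambda>x. x"])

lemma ck_on_add:
  assumes "open S" "ck_on k f S" "ck_on k g S"
  shows "ck_on k (\<lambda>x. f x + g x) S"
  using assms(2,3)
proof (induction k arbitrary: f g)
  case (Suc k)
  show ?case
  proof (rule ck_on_SucI[OF assms(1)])
    fix x assume "x \<in> S"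
    then show "((\<lambda>x. f x + g x) has_derivative
      (\<lambda>v. frechet_derivative f (at x) v + frechet_derivative g (at x) v)) (at x)"
      by (intro has_derivative_add ck_on_has_derivative[OF Suc.prems(1) assms(1)]
          ck_on_has_derivative[OF Suc.prems(2) assms(1)])
  qed (use Suc in auto)
qed (auto intro: continuous_on_add)

text \<open>Products, scalar multiples and inner products are instances. The derivative is again a
  sum of two \<open>mul\<close> terms, so the induction closes once \<open>ck_on_SucD\<close> has
  lowered the order of the undifferentiated factors.\<close>

lemma ck_on_bounded_bilinear:
  assumes "bounded_bilinear mul" "open S" "ck_on k f S" "ck_on k g S"
  shows "ck_on k (\<lambda>x. mul (f x) (g x)) S"
  using assms(3,4)
proof (induction k arbitrary: f g)
  case 0
  then show ?case using bounded_bilinear.continuous_on[OF assms(1)] by simp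
next
  case (Suc k)
  show ?case
  proof (rule ck_on_SucI[OF assms(2)])
    fix x assume "x \<in> S"
    then show "((\<lambda>x. mul (f x) (g x)) has_derivative
      (\<lambda>v. mul (f x) (frechet_derivative g (at x) v) + mul (frechet_derivative f (at x) v) (g x))) (at x)"
      by (intro bounded_bilinear.FDERIV[OF assms(1)] ck_on_has_derivative[OF Suc.prems(1) assms(2)]
          ck_on_has_derivative[OF Suc.prems(2) assms(2)])
  next
    fix v
    show "ck_on k (\<lambda>x. mul (f x) (frechet_derivative g (at x) v)
        + mul (frechet_derivative f (at x) v) (g x)) S"
      using Suc.prems ck_on_SucD[OF Suc.prems(1)] ck_on_SucD[OF Suc.prems(2)]
      by (intro ck_on_add[OF assms(2)] Suc.IH) auto
  qed
qed

lemma ck_on_sum: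
  assumes "open S" "finite B" "\<And>b. b \<in> B \<Longrightarrow> ck_on k (f b) S"
  shows "ck_on k (\<lambda>x. \<Sum>b\<in>B. f b x) S"
  using assms(2,3) by (induction B) (auto intro: ck_on_const ck_on_add[OF assms(1)])

lemma frechet_derivative_sum_Basis:
  fixes f :: "'a::euclidean_space \<Rightarrow> 'b::real_normed_vector"
  assumes "(f has_derivative D) F"
  shows "D v = (\<Sum>b\<in>Basis. (v \<bullet> b) *\<^sub>R D b)"
proof -
  interpret bounded_linear D using assms has_derivative_bounded_linear by blast
  show ?thesis
    by (subst euclidean_representation[of v, symmetric]) (simp add: sum scaleR)
qed

text \<open>\<open>ck_on\<close> controls derivatives in fixed directions only, whereas the chain
  rule differentiates g in the direction \<open>frechet_derivative f (at x) v\<close>, which moves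
  with x. Expanding this direction in the basis leaves a finite sum of scalar coefficients times
  derivatives of g in fixed directions.\<close>

lemma ck_on_compose:
  fixes f :: "'a::real_normed_vector \<Rightarrow> 'b::euclidean_space" and g :: "'b \<Rightarrow> 'c::real_normed_vector"
  assumes "open S" "open T" "f ` S \<subseteq> T" "ck_on k f S" "ck_on k g T"
  shows "ck_on k (\<lambda>x. g (f x)) S"
  using assms(4,5)
proof (induction k arbitrary: g)
  case 0
  then show ?case using assms(3) by (auto intro: continuous_on_compose2)
next
  case (Suc k)
  show ?case
  proof (rule ck_on_SucI[OF assms(1)])
    fix x assume x: "x \<in> S"
    have g: "(g has_derivative frechet_derivative g (at (f x))) (at (f x))"
      using ck_on_has_derivative[OF Suc.prems(2) assms(2)] x assms(3) by blast
    have "((\<lambda>x. g (f x)) has_derivative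
        (\<lambda>v. frechet_derivative g (at (f x)) (frechet_derivative f (at x) v))) (at x)"
      by (rule has_derivative_compose[OF ck_on_has_derivative[OF Suc.prems(1) assms(1) x] g])
    then show "((\<lambda>x. g (f x)) has_derivative
        (\<lambda>v. \<Sum>b\<in>Basis. (frechet_derivative f (at x) v \<bullet> b) *\<^sub>R frechet_derivative g (at (f x)) b)) (at x)"
      by (simp only: frechet_derivative_sum_Basis[OF g, of "frechet_derivative f (at x) _"])
  next
    fix v
    have "ck_on k (\<lambda>x. frechet_derivative f (at x) v \<bullet> b) S" for b
      using Suc.prems by (intro ck_on_bounded_bilinear[OF bounded_bilinear_inner assms(1)] ck_on_const) auto
    moreover have "ck_on k (\<lambda>x. frechet_derivative g (at (f x)) b) S" for b
      using Suc.prems by (intro Suc.IH ck_on_SucD[OF Suc.prems(1)]) auto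
    ultimately show "ck_on k (\<lambda>x. \<Sum>b\<in>Basis.
        (frechet_derivative f (at x) v \<bullet> b) *\<^sub>R frechet_derivative g (at (f x)) b) S"
      by (intro ck_on_sum[OF assms(1)] ck_on_bounded_bilinear[OF bounded_bilinear_scaleR assms(1)]) auto
  qed
qed

section \<open>Power functions, integrals along segments and Hadamard's lemma\<close>

text \<open>Up to constants the family of all real powers is closed under differentiation, so the
  induction treats all exponents at once. Exponent -1 later gives reciprocals, and -1/4 the
  normalisation of a field.\<close>

lemma ck_on_powr: "ck_on k (\<lambda>x::real. x powr a) {0<..}"
proof (induction k arbitrary: a)
  case 0
  then show ?case by (auto intro!: continuous_intros)
next
  case (Suc k)
  show ?case
  proof (rule ck_on_SucI)
    fix x :: real assume "x \<in> {0<..}"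
    then have "((\<lambda>x. x powr a) has_field_derivative a * x powr (a - 1)) (at x)"
      by (auto intro!: derivative_eq_intros)
    then show "((\<lambda>x. x powr a) has_derivative (\<lambda>v. (a * x powr (a - 1)) * v)) (at x)"
      by (simp add: has_field_derivative_def)
  next
    fix v
    show "ck_on k (\<lambda>x. a * x powr (a - 1) * v) {0<..}"
      by (intro ck_on_bounded_bilinear[OF bounded_bilinear_mult] ck_on_const Suc) auto
  qed simp
qed

text \<open>Differentiating \<open>h (y0 + s *\<^sub>R (y - y0))\<close> in y brings out a factor s.
  The weight \<open>s ^ m\<close> absorbs it, so the induction on k runs over all m and h together.
  Convexity keeps the segment inside S.\<close>

lemma ck_on_segment_integral:
  fixes h :: "'a::euclidean_space \<Rightarrow> real"
  assumes "open S" "convex S" "y0 \<in> S" "ck_on k h S"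
  shows "ck_on k (\<lambda>y. integral {0..1} (\<lambda>s. s ^ m * h (y0 + s *\<^sub>R (y - y0)))) S"
proof -
  have seg: "y0 + s *\<^sub>R (y - y0) \<in> S" if "y \<in> S" "s \<in> {0..1}" for y s
  proof -
    have "(1 - s) *\<^sub>R y0 + s *\<^sub>R y \<in> S"
      using that assms(2,3) by (auto simp: convex_alt)
    then show ?thesis by (simp add: algebra_simps)
  qed
  have cont: "continuous_on (S \<times> cbox 0 1) (\<lambda>(y, s). s ^ m * h (y0 + s *\<^sub>R (y - y0)))"
    if "continuous_on S h" for m :: nat and h :: "'a \<Rightarrow> real"
    unfolding split_beta
    by (intro continuous_intros continuous_on_compose2[OF that]) (use seg in auto)
  show ?thesis using assms(4)
  proof (induction k arbitrary: h m)
    case 0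
    then show ?case using integral_continuous_on_param[OF cont[of h m]] by simp
  next
    case (Suc k)
    let ?D = "\<lambda>y. frechet_derivative h (at y)"
    \<comment> \<open>The rule for differentiation under the integral asks for the derivative as a
      bounded linear map that depends continuously on (y, s); \<open>Blinfun\<close> packages
      it.\<close>
    let ?B = "\<lambda>y s. Blinfun (\<lambda>v. s ^ Suc m * ?D (y0 + s *\<^sub>R (y - y0)) v)"
    have bl: "bounded_linear (\<lambda>v. s ^ Suc m * ?D (y0 + s *\<^sub>R (y - y0)) v)" if "y \<in> S" "s \<in> {0..1}" for y s
      using ck_on_has_derivative[OF Suc.prems assms(1) seg[OF that]]
      by (intro bounded_linear_mult_right[THEN bounded_linear_compose] has_derivative_bounded_linear)
    have Bapp: "blinfun_apply (?B y s) v = s ^ Suc m * ?D (y0 + s *\<^sub>R (y - y0)) v"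
      if "y \<in> S" "s \<in> {0..1}" for y s v
      using bounded_linear_Blinfun_apply[OF bl[OF that]] by simp
    have hc: "continuous_on S h" using Suc.prems differentiable_imp_continuous_on by auto
    have contD: "continuous_on S (\<lambda>y. ?D y v)" for v
      using Suc.prems by (cases k) (auto dest: differentiable_imp_continuous_on)
    \<comment> \<open>The domain is finite-dimensional, so continuity in the operator norm can be
      tested on basis vectors.\<close>
    have contB: "continuous_on (S \<times> cbox 0 1) (\<lambda>(y, s). ?B y s)"
    proof (rule continuous_on_blinfun_componentwise)
      fix i :: 'a assume "i \<in> Basis"
      have "continuous_on (S \<times> cbox 0 1) (\<lambda>(y, s). s ^ Suc m * ?D (y0 + s *\<^sub>R (y - y0)) i)"
        by (rule cont[OF contD])
      then show "continuous_on (S \<times> cbox 0 1) (\<lambda>x. blinfun_apply (case x of (y, s) \<Rightarrow> ?B y s) i)"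
        by (rule continuous_on_eq) (use Bapp in auto)
    qed
    show ?case
    proof (rule ck_on_SucI[OF assms(1)])
      fix y assume y: "y \<in> S"
      have "((\<lambda>y. integral (cbox 0 1) (\<lambda>s. s ^ m * h (y0 + s *\<^sub>R (y - y0))))
          has_derivative integral (cbox 0 1) (?B y)) (at y within S)"
      proof (rule leibniz_rule[OF _ _ contB y assms(2)])
        fix z and s :: real assume z: "z \<in> S" and s: "s \<in> cbox 0 1"
        have *: "(h has_derivative ?D (y0 + s *\<^sub>R (z - y0))) (at (y0 + s *\<^sub>R (z - y0)))"
          using ck_on_has_derivative[OF Suc.prems assms(1) seg[OF z]] s by simp
        have "((\<lambda>z. h (y0 + s *\<^sub>R (z - y0))) has_derivative (\<lambda>v. ?D (y0 + s *\<^sub>R (z - y0)) (s *\<^sub>R v))) (at z within S)"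
          by (rule has_derivative_compose[where g = h and f = "\<lambda>z. y0 + s *\<^sub>R (z - y0)", OF _ *]) (auto intro!: derivative_eq_intros)
        then have 1: "((\<lambda>z. s ^ m * h (y0 + s *\<^sub>R (z - y0))) has_derivative
            (\<lambda>v. s ^ m * ?D (y0 + s *\<^sub>R (z - y0)) (s *\<^sub>R v))) (at z within S)"
          by (rule has_derivative_mult_right)
        have 2: "(\<lambda>v. s ^ m * ?D (y0 + s *\<^sub>R (z - y0)) (s *\<^sub>R v)) = blinfun_apply (?B z s)"
          using Bapp[OF z] s linear_scale[OF has_derivative_linear[OF *]] by (intro ext) simp
        show "((\<lambda>z. s ^ m * h (y0 + s *\<^sub>R (z - y0))) has_derivative blinfun_apply (?B z s)) (at z within S)"
          using 1 unfolding 2 .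
      next
        fix z assume "z \<in> S"
        then have "continuous_on (cbox 0 1) (\<lambda>s. s ^ m * h (y0 + s *\<^sub>R (z - y0)))"
          by (intro continuous_intros continuous_on_compose2[OF hc]) (use seg in auto)
        then show "(\<lambda>s. s ^ m * h (y0 + s *\<^sub>R (z - y0))) integrable_on cbox 0 1"
          by (rule integrable_continuous)
      qed
      moreover have "blinfun_apply (integral (cbox 0 1) (?B y)) v
          = integral {0..1} (\<lambda>s. s ^ Suc m * ?D (y0 + s *\<^sub>R (y - y0)) v)" for v
      proof -
        have "continuous_on (cbox 0 1) (?B y)"
          using continuous_on_compose2[OF contB, of "cbox 0 1" "Pair y"] y
            continuous_on_Pair[OF continuous_on_const continuous_on_id, of "{0..1::real}" y]
          by auto
        then have "?B y integrable_on cbox 0 1" by (rule integrable_continuous)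
        then have "blinfun_apply (integral (cbox 0 1) (?B y)) v = integral (cbox 0 1) (\<lambda>s. blinfun_apply (?B y s) v)"
          by (rule blinfun_apply_integral)
        also have "\<dots> = integral (cbox 0 1) (\<lambda>s. s ^ Suc m * ?D (y0 + s *\<^sub>R (y - y0)) v)"
          by (rule integral_cong) (use Bapp[OF y] in auto)
        finally show ?thesis by simp
      qed
      ultimately show "((\<lambda>y. integral {0..1} (\<lambda>s. s ^ m * h (y0 + s *\<^sub>R (y - y0)))) has_derivative
         (\<lambda>v. integral {0..1} (\<lambda>s. s ^ Suc m * ?D (y0 + s *\<^sub>R (y - y0)) v))) (at y)"
        by (metis (no_types, lifting) ext at_within_open[OF y assms(1)] cbox_interval)
    next
      fix v
      show "ck_on k (\<lambda>y. integral {0..1} (\<lambda>s. s ^ Suc m * ?D (y0 + s *\<^sub>R (y - y0)) v)) S"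
        using Suc.prems by (intro Suc.IH) simp
    qed
  qed
qed

section \<open>Closure properties of smooth maps\<close>

lemma smooth_on_const: "smooth_on S (\<lambda>x. c)"
  unfolding smooth_on_def by (blast intro: ck_on_const)

lemma smooth_on_subset: "smooth_on S f \<Longrightarrow> T \<subseteq> S \<Longrightarrow> smooth_on T f"
  unfolding smooth_on_def by (blast intro: ck_on_subset)

lemma smooth_on_cong:
  "open S \<Longrightarrow> (\<And>x. x \<in> S \<Longrightarrow> f x = g x) \<Longrightarrow> smooth_on S f \<Longrightarrow> smooth_on S g"
  unfolding smooth_on_def by (blast intro: ck_on_cong)

lemma smooth_on_local:
  "(\<And>x. x \<in> S \<Longrightarrow> \<exists>T. open T \<and> x \<in> T \<and> smooth_on T f) \<Longrightarrow> smooth_on S f"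
  unfolding smooth_on_def by (meson ck_on_local)

lemma smooth_on_bounded_linear: "bounded_linear L \<Longrightarrow> open S \<Longrightarrow> smooth_on S L"
  unfolding smooth_on_def by (blast intro: ck_on_bounded_linear)

lemma smooth_on_add:
  "open S \<Longrightarrow> smooth_on S f \<Longrightarrow> smooth_on S g \<Longrightarrow> smooth_on S (\<lambda>x. f x + g x)"
  unfolding smooth_on_def by (blast intro: ck_on_add)

lemma smooth_on_bounded_bilinear:
  "bounded_bilinear mul \<Longrightarrow> open S \<Longrightarrow> smooth_on S f \<Longrightarrow> smooth_on S g \<Longrightarrow>
    smooth_on S (\<lambda>x. mul (f x) (g x))"
  unfolding smooth_on_def by (blast intro: ck_on_bounded_bilinear)

lemmas smooth_on_mult = smooth_on_bounded_bilinear[OF bounded_bilinear_mult]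

lemma smooth_on_compose:
  fixes f :: "'a::real_normed_vector \<Rightarrow> 'b::euclidean_space" and g :: "'b \<Rightarrow> 'c::real_normed_vector"
  shows "open S \<Longrightarrow> open T \<Longrightarrow> f ` S \<subseteq> T \<Longrightarrow> smooth_on S f \<Longrightarrow> smooth_on T g \<Longrightarrow>
    smooth_on S (\<lambda>x. g (f x))"
  unfolding smooth_on_def by (blast intro: ck_on_compose)

lemma smooth_on_frechet_derivative:
  "smooth_on S f \<Longrightarrow> smooth_on S (\<lambda>x. frechet_derivative f (at x) v)"
  unfolding smooth_on_def by (metis ck_on.simps(2))

lemma smooth_on_has_derivative:
  "smooth_on S f \<Longrightarrow> open S \<Longrightarrow> x \<in> S \<Longrightarrow> (f has_derivative frechet_derivative f (at x)) (at x)"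
  unfolding smooth_on_def by (blast intro: ck_on_has_derivative)

lemma smooth_on_continuous_on: "smooth_on S f \<Longrightarrow> continuous_on S f"
  unfolding smooth_on_def by (metis ck_on.simps(1))

lemma smooth_on_Pair:
  fixes f :: "'a::real_normed_vector \<Rightarrow> 'b::euclidean_space" and g :: "'a \<Rightarrow> 'c::euclidean_space"
  assumes S: "open S" and f: "smooth_on S f" and g: "smooth_on S g"
  shows "smooth_on S (\<lambda>x. (f x, g x))"
proof -
  have 1: "bounded_linear (\<lambda>u::'b. (u, 0::'c))" and 2: "bounded_linear (\<lambda>u::'c. (0::'b, u))"
    by (intro bounded_linear_Pair bounded_linear_ident bounded_linear_zero)+
  have "smooth_on S (\<lambda>x. (f x, 0) + (0, g x))"
    by (intro smooth_on_add S smooth_on_compose[OF S open_UNIV _ f smooth_on_bounded_linear[OF 1]]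
        smooth_on_compose[OF S open_UNIV _ g smooth_on_bounded_linear[OF 2]]) auto
  then show ?thesis by simp
qed

text \<open>The fundamental theorem of calculus along the segment from y0 to y writes
  \<open>h y - h y0\<close> as the integral of the derivative in direction \<open>y - y0\<close>;
  expanding this direction in the basis splits off the coordinate differences.\<close>

lemma hadamard:
  fixes h :: "'a::euclidean_space \<Rightarrow> real"
  assumes "open S" "convex S" "y0 \<in> S" "smooth_on S h"
  obtains k where "\<And>b. smooth_on S (k b)"
    "\<And>b. k b y0 = frechet_derivative h (at y0) b"
    "\<And>y. y \<in> S \<Longrightarrow> h y = h y0 + (\<Sum>b\<in>Basis. ((y - y0) \<bullet> b) * k b y)"
proof
  \<comment> \<open>The mean of the partial derivative along the segment. The trivial weight
    \<open>s ^ 0\<close> is kept so that \<open>ck_on_segment_integral\<close> applies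
    literally.\<close>
  let ?k = "\<lambda>b y. integral {0..1} (\<lambda>s::real. s ^ 0 * frechet_derivative h (at (y0 + s *\<^sub>R (y - y0))) b)"
  show "smooth_on S (?k b)" for b
    using smooth_on_frechet_derivative[OF assms(4)] ck_on_segment_integral[OF assms(1-3)]
    unfolding smooth_on_def by blast
  show "?k b y0 = frechet_derivative h (at y0) b" for b by simp
  fix y assume y: "y \<in> S"
  have seg: "y0 + s *\<^sub>R (y - y0) \<in> S" if "s \<in> {0..1}" for s
  proof -
    have "(1 - s) *\<^sub>R y0 + s *\<^sub>R y \<in> S"
      using that assms(2,3) y by (auto simp: convex_alt)
    then show ?thesis by (simp add: algebra_simps)
  qed
  let ?D = "\<lambda>s. frechet_derivative h (at (y0 + s *\<^sub>R (y - y0)))"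
  have D: "(h has_derivative ?D s) (at (y0 + s *\<^sub>R (y - y0)))" if "s \<in> {0..1}" for s
    using smooth_on_has_derivative[OF assms(4,1) seg[OF that]] .
  have int: "(\<lambda>s. ?D s b) integrable_on {0..1}" for b
  proof -
    have "continuous_on (cbox 0 1) (\<lambda>s. ?D s b)"
      by (intro continuous_on_compose2[OF smooth_on_continuous_on[OF smooth_on_frechet_derivative[OF assms(4)]]]
          continuous_intros) (use seg in auto)
    from integrable_continuous[OF this] show ?thesis by simp
  qed
  have "((\<lambda>s. ?D s (y - y0)) has_integral (h (y0 + 1 *\<^sub>R (y - y0)) - h (y0 + 0 *\<^sub>R (y - y0)))) {0..1}"
  proof (rule fundamental_theorem_of_calculus)
    fix s :: real assume s: "s \<in> {0..1}"
    have "((\<lambda>s. h (y0 + s *\<^sub>R (y - y0))) has_derivative (\<lambda>r. ?D s (r *\<^sub>R (y - y0)))) (at s within {0..1})"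
      by (rule has_derivative_compose[where g = h and f = "\<lambda>s. y0 + s *\<^sub>R (y - y0)", OF _ D[OF s]]) (auto intro!: derivative_eq_intros)
    then show "((\<lambda>s. h (y0 + s *\<^sub>R (y - y0))) has_vector_derivative ?D s (y - y0)) (at s within {0..1})"
      using linear_scale[OF has_derivative_linear[OF D[OF s]]] by (simp add: has_vector_derivative_def)
  qed simp
  then have "h y - h y0 = integral {0..1} (\<lambda>s. ?D s (y - y0))"
    by (simp add: integral_unique)
  also have "\<dots> = integral {0..1} (\<lambda>s. \<Sum>b\<in>Basis. ((y - y0) \<bullet> b) * ?D s b)"
    by (rule integral_cong) (use frechet_derivative_sum_Basis[OF D] in simp)
  also have "\<dots> = (\<Sum>b\<in>Basis. integral {0..1} (\<lambda>s. ((y - y0) \<bullet> b) * ?D s b))"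
    by (intro integral_sum integrable_on_mult_right int) simp
  finally show "h y = h y0 + (\<Sum>b\<in>Basis. ((y - y0) \<bullet> b) * ?k b y)"
    by simp
qed

section \<open>Smooth functions and tangent vectors on a manifold\<close>

locale manifold =
  fixes A :: "('m::{t2_space, second_countable_topology}, 'e::euclidean_space) chart set"
  assumes smooth_manifold: "smooth_manifold A"
begin

lemma
  assumes "(U, \<phi>) \<in> A"
  shows chart_open: "open U"
    and chart_homeomorphism: "homeomorphism U (\<phi> ` U) \<phi> (inv_into U \<phi>)"
    and chart_subset_carrier: "U \<subseteq> carrier A"
  using assms smooth_manifold unfolding smooth_manifold_def carrier_def by auto

lemma chart_inv: "(U, \<phi>) \<in> A \<Longrightarrow> q \<in> U \<Longrightarrow> inv_into U \<phi> (\<phi> q) = q"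
  using chart_homeomorphism by (simp add: homeomorphism_def)

lemma chart_image_open:
  assumes "(U, \<phi>) \<in> A" "open W"
  shows "open (\<phi> ` (U \<inter> W))"
proof -
  have "open (\<phi> ` U)" using assms(1) smooth_manifold unfolding smooth_manifold_def by auto
  moreover have "openin (top_of_set (\<phi> ` U)) (\<phi> ` (U \<inter> W))"
    by (rule homeomorphism_imp_open_map[OF chart_homeomorphism[OF assms(1)]])
      (use assms(2) in \<open>auto simp: openin_open\<close>)
  ultimately show ?thesis using openin_open_trans by blast
qed

lemma chart_transition:
  "(U, \<phi>) \<in> A \<Longrightarrow> (V, \<psi>) \<in> A \<Longrightarrow> smooth_on (\<phi> ` (U \<inter> V)) (\<lambda>y. \<psi> (inv_into U \<phi> y))"
  using smooth_manifold unfolding smooth_manifold_def comp_def by fastforce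

lemma carrierE:
  assumes "p \<in> carrier A"
  obtains U \<phi> where "(U, \<phi>) \<in> A" "p \<in> U"
  using assms unfolding carrier_def by auto

lemma open_carrier: "open (carrier A)"
  unfolding carrier_def using chart_open by auto

lemma smooth_funD:
  "smooth_fun A W h \<Longrightarrow> (U, \<phi>) \<in> A \<Longrightarrow> smooth_on (\<phi> ` (U \<inter> W)) (\<lambda>y. h (inv_into U \<phi> y))"
  unfolding smooth_fun_def comp_def by auto

lemma smooth_funI:
  "(\<And>U \<phi>. (U, \<phi>) \<in> A \<Longrightarrow> smooth_on (\<phi> ` (U \<inter> W)) (\<lambda>y. h (inv_into U \<phi> y))) \<Longrightarrow> smooth_fun A W h"
  unfolding smooth_fun_def comp_def by auto

lemma smooth_fun_subset: "smooth_fun A W h \<Longrightarrow> V \<subseteq> W \<Longrightarrow> smooth_fun A V h"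
  by (rule smooth_funI, rule smooth_on_subset[OF smooth_funD]) auto

lemma smooth_fun_cong:
  assumes "open W" "\<And>q. q \<in> W \<Longrightarrow> h q = k q" "smooth_fun A W h"
  shows "smooth_fun A W k"
proof (rule smooth_funI)
  fix U \<phi> assume c: "(U, \<phi>) \<in> A"
  show "smooth_on (\<phi> ` (U \<inter> W)) (\<lambda>y. k (inv_into U \<phi> y))"
    by (rule smooth_on_cong[OF chart_image_open[OF c assms(1)] _ smooth_funD[OF assms(3) c]])
      (use assms(2) chart_inv[OF c] in auto)
qed

lemma smooth_fun_local:
  assumes "\<And>p. p \<in> W \<Longrightarrow> \<exists>V. open V \<and> p \<in> V \<and> smooth_fun A V h"
  shows "smooth_fun A W h"
proof (intro smooth_funI smooth_on_local)
  fix U \<phi> y assume c: "(U, \<phi>) \<in> A" and "y \<in> \<phi> ` (U \<inter> W)"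
  then obtain p where p: "p \<in> U" "p \<in> W" "y = \<phi> p" by auto
  with assms obtain V where V: "open V" "p \<in> V" "smooth_fun A V h" by blast
  then show "\<exists>T. open T \<and> y \<in> T \<and> smooth_on T (\<lambda>y. h (inv_into U \<phi> y))"
    using chart_image_open[OF c V(1)] smooth_funD[OF V(3) c] p by blast
qed

text \<open>\<open>smooth_fun\<close> asks for smoothness in every chart of the atlas; on an open
  part of one chart domain the transition maps reduce this to that chart.\<close>

lemma smooth_fun_chartI:
  assumes c: "(U, \<phi>) \<in> A" and W: "open W" "W \<subseteq> U"
    and h: "smooth_on (\<phi> ` W) (\<lambda>y. h (inv_into U \<phi> y))"
  shows "smooth_fun A W h"
proof (rule smooth_funI)
  fix V \<psi> assume d: "(V, \<psi>) \<in> A"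
  have o: "open (\<psi> ` (V \<inter> W))" "open (\<phi> ` W)"
    using chart_image_open[OF d W(1)] chart_image_open[OF c W(1)] W(2) by (simp_all add: Int_absorb1)
  have "smooth_on (\<psi> ` (V \<inter> W)) (\<lambda>y. h (inv_into U \<phi> (\<phi> (inv_into V \<psi> y))))"
    by (rule smooth_on_compose[OF o _ _ h])
      (use chart_inv[OF d] W(2) in \<open>auto intro: smooth_on_subset[OF chart_transition[OF d c]]\<close>)
  then show "smooth_on (\<psi> ` (V \<inter> W)) (\<lambda>y. h (inv_into V \<psi> y))"
    by (rule smooth_on_cong[OF o(1), rotated]) (use chart_inv[OF d] chart_inv[OF c] W(2) in auto)
qed

lemma smooth_fun_const: "smooth_fun A W (\<lambda>q. c)"
  by (intro smooth_funI smooth_on_const)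

lemma smooth_fun_add:
  "open W \<Longrightarrow> smooth_fun A W h \<Longrightarrow> smooth_fun A W k \<Longrightarrow> smooth_fun A W (\<lambda>q. h q + k q)"
  by (rule smooth_funI, intro smooth_on_add chart_image_open smooth_funD) auto

lemma smooth_fun_mult:
  "open W \<Longrightarrow> smooth_fun A W h \<Longrightarrow> smooth_fun A W k \<Longrightarrow> smooth_fun A W (\<lambda>q. h q * k q)"
  by (rule smooth_funI, intro smooth_on_mult chart_image_open smooth_funD) auto

lemma smooth_fun_diff:
  assumes "open W" "smooth_fun A W h" "smooth_fun A W k"
  shows "smooth_fun A W (\<lambda>q. h q - k q)"
  using smooth_fun_add[OF assms(1,2) smooth_fun_mult[OF assms(1) smooth_fun_const[of _ "-1"] assms(3)]]
  by simp

lemma smooth_fun_sum: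
  assumes "open W" "finite B" "\<And>b. b \<in> B \<Longrightarrow> smooth_fun A W (h b)"
  shows "smooth_fun A W (\<lambda>q. \<Sum>b\<in>B. h b q)"
  using assms(2,3) by (induction B) (auto intro: smooth_fun_const smooth_fun_add[OF assms(1)])

lemma smooth_fun_compose:
  fixes k :: "real \<Rightarrow> real"
  assumes "open W" "smooth_fun A W h" "open T" "h ` W \<subseteq> T" "smooth_on T k"
  shows "smooth_fun A W (\<lambda>q. k (h q))"
proof (rule smooth_funI)
  fix U \<phi> assume c: "(U, \<phi>) \<in> A"
  show "smooth_on (\<phi> ` (U \<inter> W)) (\<lambda>y. k (h (inv_into U \<phi> y)))"
    by (rule smooth_on_compose[OF chart_image_open[OF c assms(1)] assms(3) _ smooth_funD[OF assms(2) c] assms(5)])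
      (use chart_inv[OF c] assms(4) in auto)
qed

text \<open>The square of h is positive wherever h does not vanish, so real powers apply whatever
  the sign of h; lengths in an indefinite metric have both signs.\<close>

lemma smooth_fun_powr:
  assumes "open W" "smooth_fun A W h" "\<And>q. q \<in> W \<Longrightarrow> h q \<noteq> 0"
  shows "smooth_fun A W (\<lambda>q. (h q * h q) powr a)"
proof (rule smooth_fun_compose[OF assms(1) smooth_fun_mult[OF assms(1,2,2)], of "{0<..}"])
  show "smooth_on {0<..} (\<lambda>x. x powr a)" unfolding smooth_on_def by (blast intro: ck_on_powr)
qed (use assms(3) in \<open>auto simp flip: power2_eq_square\<close>)

lemma smooth_fun_divide:
  assumes "open W" "smooth_fun A W h" "smooth_fun A W k" "\<And>q. q \<in> W \<Longrightarrow> k q \<noteq> 0"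
  shows "smooth_fun A W (\<lambda>q. h q / k q)"
proof (rule smooth_fun_cong[OF assms(1) _ smooth_fun_mult[OF assms(1) smooth_fun_mult[OF assms(1-3)]
      smooth_fun_powr[OF assms(1,3,4), of "-1"]]])
  show "h q * k q * (k q * k q) powr - 1 = h q / k q" if "q \<in> W" for q
    using assms(4)[OF that] by (simp add: powr_minus field_simps)
qed

lemma smooth_fun_continuous_on:
  assumes "open W" "W \<subseteq> carrier A" "smooth_fun A W h"
  shows "continuous_on W h"
proof -
  have "isCont h p" if p: "p \<in> W" for p
  proof -
    obtain U \<phi> where c: "(U, \<phi>) \<in> A" and pU: "p \<in> U" using carrierE p assms(2) by blast
    have "continuous_on (U \<inter> W) (\<lambda>q. h (inv_into U \<phi> (\<phi> q)))"
      by (rule continuous_on_compose2[OF smooth_on_continuous_on[OF smooth_funD[OF assms(3) c]]])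
        (use chart_homeomorphism[OF c] in \<open>auto simp: homeomorphism_def intro: continuous_on_subset\<close>)
    then have "continuous_on (U \<inter> W) h"
      by (rule continuous_on_eq) (use chart_inv[OF c] in auto)
    then show ?thesis
      using p pU assms(1) chart_open[OF c] by (simp add: continuous_on_eq_continuous_at open_Int)
  qed
  then show ?thesis by (simp add: continuous_at_imp_continuous_on)
qed

lemma smooth_fun_coordinate:
  assumes "(U, \<phi>) \<in> A" "W \<subseteq> U" "open W"
  shows "smooth_fun A W (\<lambda>q. \<phi> q \<bullet> b)"
proof (rule smooth_fun_chartI[OF assms(1,3,2)])
  have o: "open (\<phi> ` W)" using chart_image_open[OF assms(1,3)] assms(2) by (simp add: Int_absorb1)
  have "smooth_on (\<phi> ` W) (\<lambda>y. y \<bullet> b)"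
    by (rule smooth_on_bounded_linear[OF bounded_linear_inner_left o])
  then show "smooth_on (\<phi> ` W) (\<lambda>y. \<phi> (inv_into U \<phi> y) \<bullet> b)"
    by (rule smooth_on_cong[OF o, rotated]) (use chart_inv[OF assms(1)] assms(2) in auto)
qed

section \<open>Germs of smooth functions\<close>

lemma smooth_nearI: "open W \<Longrightarrow> W \<subseteq> carrier A \<Longrightarrow> smooth_fun A W h \<Longrightarrow> p \<in> W \<Longrightarrow> smooth_near A p h"
  unfolding smooth_near_def by auto

lemma smooth_nearE:
  assumes "smooth_near A p h" "open V" "p \<in> V"
  obtains W where "open W" "p \<in> W" "W \<subseteq> V" "W \<subseteq> carrier A" "smooth_fun A W h"
    "\<And>q. q \<in> W \<Longrightarrow> smooth_near A q h"
proof -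
  obtain W where W: "open W" "p \<in> W" "W \<subseteq> carrier A" "smooth_fun A W h"
    using assms(1) unfolding smooth_near_def by auto
  have *: "open (W \<inter> V)" "W \<inter> V \<subseteq> carrier A" "smooth_fun A (W \<inter> V) h"
    using W assms smooth_fun_subset by (auto intro: smooth_fun_subset)
  show thesis
    by (rule that[OF *(1) _ _ *(2,3)]) (use W(2) assms(3) smooth_nearI[OF *] in auto)
qed

lemma smooth_near_carrier: "smooth_near A p h \<Longrightarrow> p \<in> carrier A"
  unfolding smooth_near_def by auto

lemma smooth_near_const: "p \<in> carrier A \<Longrightarrow> smooth_near A p (\<lambda>q. c)"
  using smooth_nearI[OF open_carrier subset_refl smooth_fun_const] .

lemma smooth_near_cong:
  assumes "smooth_near A p h" "open V" "p \<in> V" "\<And>q. q \<in> V \<Longrightarrow> h q = k q"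
  shows "smooth_near A p k"
proof -
  obtain W where W: "open W" "p \<in> W" "W \<subseteq> V" "W \<subseteq> carrier A" "smooth_fun A W h"
    using smooth_nearE[OF assms(1-3)] by metis
  show ?thesis
    by (rule smooth_nearI[OF W(1,4) smooth_fun_cong[OF W(1) _ W(5)] W(2)]) (use assms(4) W(3) in auto)
qed

lemma smooth_near2E:
  assumes "smooth_near A p h" "smooth_near A p k" "open V" "p \<in> V"
  obtains W where "open W" "p \<in> W" "W \<subseteq> V" "W \<subseteq> carrier A" "smooth_fun A W h" "smooth_fun A W k"
    "\<And>q. q \<in> W \<Longrightarrow> smooth_near A q h" "\<And>q. q \<in> W \<Longrightarrow> smooth_near A q k"
proof -
  obtain W where W: "open W" "p \<in> W" "W \<subseteq> V" "smooth_fun A W h" "\<And>q. q \<in> W \<Longrightarrow> smooth_near A q h"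
    using smooth_nearE[OF assms(1,3,4)] by metis
  obtain W' where W': "open W'" "p \<in> W'" "W' \<subseteq> W" "W' \<subseteq> carrier A" "smooth_fun A W' k"
      "\<And>q. q \<in> W' \<Longrightarrow> smooth_near A q k"
    using smooth_nearE[OF assms(2) W(1,2)] by metis
  show thesis
    by (rule that[OF W'(1,2) _ W'(4) smooth_fun_subset[OF W(4) W'(3)] W'(5) _ W'(6)])
      (use W W' in auto)
qed

lemma smooth_near_add:
  "smooth_near A p h \<Longrightarrow> smooth_near A p k \<Longrightarrow> smooth_near A p (\<lambda>q. h q + k q)"
  by (erule (1) smooth_near2E[OF _ _ open_UNIV UNIV_I]) (rule smooth_nearI, auto intro: smooth_fun_add)

lemma smooth_near_mult:
  "smooth_near A p h \<Longrightarrow> smooth_near A p k \<Longrightarrow> smooth_near A p (\<lambda>q. h q * k q)"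
  by (erule (1) smooth_near2E[OF _ _ open_UNIV UNIV_I]) (rule smooth_nearI, auto intro: smooth_fun_mult)

lemma smooth_near_sum:
  assumes "p \<in> carrier A" "finite B" "\<And>b. b \<in> B \<Longrightarrow> smooth_near A p (h b)"
  shows "smooth_near A p (\<lambda>q. \<Sum>b\<in>B. h b q)"
  using assms(2,3) by (induction B) (auto intro: smooth_near_const[OF assms(1)] smooth_near_add)

section \<open>Derivations at a point\<close>

lemma tangent_spaceI:
  assumes "\<And>h. \<not> smooth_near A p h \<Longrightarrow> v h = 0"
    "\<And>h k W. smooth_near A p h \<Longrightarrow> open W \<Longrightarrow> p \<in> W \<Longrightarrow> (\<And>q. q \<in> W \<Longrightarrow> h q = k q) \<Longrightarrow> v h = v k"
    "\<And>h k. smooth_near A p h \<Longrightarrow> smooth_near A p k \<Longrightarrow> v (\<lambda>q. h q + k q) = v h + v k"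
    "\<And>a h. smooth_near A p h \<Longrightarrow> v (\<lambda>q. a * h q) = a * v h"
    "\<And>h k. smooth_near A p h \<Longrightarrow> smooth_near A p k \<Longrightarrow> v (\<lambda>q. h q * k q) = v h * k p + h p * v k"
  shows "v \<in> tangent_space A p"
  unfolding tangent_space_def mem_Collect_eq
proof (intro conjI allI impI)
  fix h k W assume "smooth_near A p h \<and> open W \<and> p \<in> W \<and> (\<forall>q\<in>W. h q = k q)"
  then show "v h = v k" by (elim conjE) (rule assms(2), auto)
next
  fix h k assume "smooth_near A p h \<and> smooth_near A p k"
  then show "v (\<lambda>q. h q + k q) = v h + v k" by (elim conjE) (rule assms(3))
next
  fix h k assume "smooth_near A p h \<and> smooth_near A p k"
  then show "v (\<lambda>q. h q * k q) = v h * k p + h p * v k" by (elim conjE) (rule assms(5))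
next
  fix a h assume "smooth_near A p h"
  then show "v (\<lambda>q. a * h q) = a * v h" by (rule assms(4))
qed (rule assms(1))

lemma
  assumes "v \<in> tangent_space A p"
  shows tangent_not_near: "\<not> smooth_near A p h \<Longrightarrow> v h = 0"
    and tangent_germ: "smooth_near A p h \<Longrightarrow> open W \<Longrightarrow> p \<in> W \<Longrightarrow> (\<And>q. q \<in> W \<Longrightarrow> h q = k q) \<Longrightarrow> v h = v k"
    and tangent_add: "smooth_near A p h \<Longrightarrow> smooth_near A p k \<Longrightarrow> v (\<lambda>q. h q + k q) = v h + v k"
    and tangent_cmult: "smooth_near A p h \<Longrightarrow> v (\<lambda>q. a * h q) = a * v h"
    and tangent_mult: "smooth_near A p h \<Longrightarrow> smooth_near A p k \<Longrightarrow> v (\<lambda>q. h q * k q) = v h * k p + h p * v k"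
proof -
  note * = assms[unfolded tangent_space_def mem_Collect_eq]
  show "v h = 0" if "\<not> smooth_near A p h"
    using conjunct1[OF *] that by blast
  show "v h = v k" if "smooth_near A p h" "open W" "p \<in> W" "\<And>q. q \<in> W \<Longrightarrow> h q = k q"
    using conjunct1[OF conjunct2[OF *]] that by blast
  show "v (\<lambda>q. h q + k q) = v h + v k" if "smooth_near A p h" "smooth_near A p k"
    using conjunct1[OF conjunct2[OF conjunct2[OF *]]] that by blast
  show "v (\<lambda>q. a * h q) = a * v h" if "smooth_near A p h"
    using conjunct1[OF conjunct2[OF conjunct2[OF conjunct2[OF *]]]] that by blast
  show "v (\<lambda>q. h q * k q) = v h * k p + h p * v k" if "smooth_near A p h" "smooth_near A p k"
    using conjunct2[OF conjunct2[OF conjunct2[OF conjunct2[OF *]]]] that by blast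
qed

text \<open>Leibniz' rule for 1 = 1 * 1 gives v(1) = 2 v(1). Outside the carrier no function is
  smooth near p, and v is zero by convention.\<close>

lemma tangent_const:
  assumes "v \<in> tangent_space A p"
  shows "v (\<lambda>q. c) = 0"
proof (cases "p \<in> carrier A")
  case True
  have "v (\<lambda>q. 1) = 0"
    using tangent_mult[OF assms smooth_near_const[OF True, of 1] smooth_near_const[OF True, of 1]] by simp
  then show ?thesis using tangent_cmult[OF assms smooth_near_const[OF True, of 1], of c] by simp
next
  case False
  then show ?thesis using tangent_not_near[OF assms] smooth_near_carrier by blast
qed

lemma tangent_sum:
  assumes "v \<in> tangent_space A p" "p \<in> carrier A" "finite B" "\<And>b. b \<in> B \<Longrightarrow> smooth_near A p (h b)"
  shows "v (\<lambda>q. \<Sum>b\<in>B. h b q) = (\<Sum>b\<in>B. v (h b))"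
  using assms(3,4)
  by (induction B rule: finite_induct)
    (auto simp: tangent_const[OF assms(1)] tangent_add[OF assms(1)] smooth_near_sum[OF assms(2)])

lemma tangent_space_add:
  assumes u: "u \<in> tangent_space A p" and v: "v \<in> tangent_space A p"
  shows "(\<lambda>h. u h + v h) \<in> tangent_space A p"
proof (rule tangent_spaceI)
  fix h k W assume "smooth_near A p h" "open W" "p \<in> W" "\<And>q. q \<in> W \<Longrightarrow> h q = k q"
  then show "u h + v h = u k + v k" using tangent_germ[OF u] tangent_germ[OF v] by metis
qed (simp_all add: tangent_not_near[OF u] tangent_not_near[OF v] tangent_add[OF u] tangent_add[OF v]
    tangent_cmult[OF u] tangent_cmult[OF v] tangent_mult[OF u] tangent_mult[OF v] algebra_simps)

lemma tangent_space_scale: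
  assumes u: "u \<in> tangent_space A p"
  shows "(\<lambda>h. a * u h) \<in> tangent_space A p"
proof (rule tangent_spaceI)
  fix h k W assume "smooth_near A p h" "open W" "p \<in> W" "\<And>q. q \<in> W \<Longrightarrow> h q = k q"
  then show "a * u h = a * u k" using tangent_germ[OF u] by metis
qed (simp_all add: tangent_not_near[OF u] tangent_add[OF u] tangent_cmult[OF u] tangent_mult[OF u] algebra_simps)

lemma tangent_space_zero: "(\<lambda>h. 0) \<in> tangent_space A p"
  by (rule tangent_spaceI) auto

lemma tangent_space_diff:
  assumes "u \<in> tangent_space A p" "v \<in> tangent_space A p"
  shows "(\<lambda>h. u h - v h) \<in> tangent_space A p"
  using tangent_space_add[OF assms(1) tangent_space_scale[OF assms(2), of "-1"]] by simp

lemma tangent_space_sum: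
  "finite B \<Longrightarrow> (\<And>b. b \<in> B \<Longrightarrow> u b \<in> tangent_space A p) \<Longrightarrow> (\<lambda>h. \<Sum>b\<in>B. u b h) \<in> tangent_space A p"
  by (induction B rule: finite_induct) (auto intro: tangent_space_zero tangent_space_add)

text \<open>The partial derivative of a chart, allowed in any direction b of the model space. The
  default value 0 is the convention that makes it a member of \<open>tangent_space\<close>.\<close>

definition coord_field :: "'m set \<Rightarrow> ('m \<Rightarrow> 'e) \<Rightarrow> 'e \<Rightarrow> 'm vfield" where
  "coord_field U \<phi> b = (\<lambda>p h. if smooth_near A p h
     then frechet_derivative (\<lambda>y. h (inv_into U \<phi> y)) (at (\<phi> p)) b else 0)"

lemma chart_has_derivative:
  assumes c: "(U, \<phi>) \<in> A" and p: "p \<in> U" and h: "smooth_near A p h"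
  shows "((\<lambda>y. h (inv_into U \<phi> y)) has_derivative
    frechet_derivative (\<lambda>y. h (inv_into U \<phi> y)) (at (\<phi> p))) (at (\<phi> p))"
proof -
  obtain W where W: "open W" "p \<in> W" "smooth_fun A W h" using h unfolding smooth_near_def by auto
  show ?thesis
    by (rule smooth_on_has_derivative[OF smooth_funD[OF W(3) c] chart_image_open[OF c W(1)]]) (use p W(2) in auto)
qed

lemma coord_field_tangent:
  assumes c: "(U, \<phi>) \<in> A" and p: "p \<in> U"
  shows "coord_field U \<phi> b p \<in> tangent_space A p"
proof (rule tangent_spaceI)
  note D = chart_has_derivative[OF c p]
  note at = frechet_derivative_at[symmetric]
  note [simp] = chart_inv[OF c p]
  fix h k assume h: "smooth_near A p h"
  { fix W assume W: "open W" "p \<in> W" and eq: "\<And>q. q \<in> W \<Longrightarrow> h q = k q"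
    have "smooth_near A p k" using smooth_near_cong[OF h W eq] by auto
    moreover have "frechet_derivative (\<lambda>y. h (inv_into U \<phi> y)) (at (\<phi> p))
      = frechet_derivative (\<lambda>y. k (inv_into U \<phi> y)) (at (\<phi> p))"
      by (rule frechet_derivative_cong_open[OF chart_image_open[OF c W(1)]])
        (use p W(2) eq chart_inv[OF c] in auto)
    ultimately show "coord_field U \<phi> b p h = coord_field U \<phi> b p k"
      using h by (simp add: coord_field_def) }
  { fix a
    have "smooth_near A p (\<lambda>q. a * h q)" using h smooth_near_mult smooth_near_const smooth_near_carrier by blast
    then show "coord_field U \<phi> b p (\<lambda>q. a * h q) = a * coord_field U \<phi> b p h"
      using h at[OF has_derivative_mult_right[OF D[OF h], of a]] by (simp add: coord_field_def) }
  assume k: "smooth_near A p k"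
  show "coord_field U \<phi> b p (\<lambda>q. h q + k q) = coord_field U \<phi> b p h + coord_field U \<phi> b p k"
    using h k smooth_near_add[OF h k] at[OF has_derivative_add[OF D[OF h] D[OF k]]]
    by (simp add: coord_field_def)
  show "coord_field U \<phi> b p (\<lambda>q. h q * k q) = coord_field U \<phi> b p h * k p + h p * coord_field U \<phi> b p k"
    using h k smooth_near_mult[OF h k] at[OF has_derivative_mult[OF D[OF h] D[OF k]]]
    by (simp add: coord_field_def)
qed (simp add: coord_field_def)

text \<open>Duality of coordinate fields and coordinate functions; it yields the linear independence
  of the fields, hence the exact dimension of the tangent space.\<close>

lemma coord_field_coordinate:
  assumes c: "(U, \<phi>) \<in> A" and p: "p \<in> U"
  shows "coord_field U \<phi> b p (\<lambda>q. \<phi> q \<bullet> e) = b \<bullet> e"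
proof -
  have o: "open (\<phi> ` U)" using chart_image_open[OF c open_UNIV] by simp
  have D: "((\<lambda>y. y \<bullet> e) has_derivative (\<lambda>y. y \<bullet> e)) (at (\<phi> p))"
    by (rule bounded_linear_imp_has_derivative[OF bounded_linear_inner_left])
  moreover have "frechet_derivative (\<lambda>y. \<phi> (inv_into U \<phi> y) \<bullet> e) (at (\<phi> p))
      = frechet_derivative (\<lambda>y. y \<bullet> e) (at (\<phi> p))"
    by (rule frechet_derivative_cong_open[OF o]) (use p chart_inv[OF c] in auto)
  moreover have "smooth_near A p (\<lambda>q. \<phi> q \<bullet> e)"
    by (rule smooth_nearI[OF chart_open[OF c] chart_subset_carrier[OF c]
        smooth_fun_coordinate[OF c subset_refl chart_open[OF c]] p])
  ultimately show ?thesis by (simp add: coord_field_def frechet_derivative_at[OF D, symmetric])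
qed

text \<open>Expanding \<open>h\<close> by Hadamard's lemma, only the linear terms survive under a derivation.\<close>

lemma tangent_expand:
  assumes c: "(U, \<phi>) \<in> A" and p: "p \<in> U" and v: "v \<in> tangent_space A p"
  shows "v = (\<lambda>h. \<Sum>b\<in>Basis. v (\<lambda>q. \<phi> q \<bullet> b) * coord_field U \<phi> b p h)"
proof
  fix h
  show "v h = (\<Sum>b\<in>Basis. v (\<lambda>q. \<phi> q \<bullet> b) * coord_field U \<phi> b p h)"
  proof (cases "smooth_near A p h")
    case False
    then show ?thesis using tangent_not_near[OF v] by (simp add: coord_field_def)
  next
    case True
    have pc: "p \<in> carrier A" using smooth_near_carrier True .
    obtain W where W: "open W" "p \<in> W" "W \<subseteq> U" "smooth_fun A W h"
      using smooth_nearE[OF True chart_open[OF c] p] by metis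
    have o: "open (\<phi> ` W)" using chart_image_open[OF c W(1)] W(3) by (simp add: Int_absorb1)
    \<comment> \<open>Hadamard's lemma needs a convex domain, so the chart image is cut down to a
      ball; its preimage N serves as the neighbourhood of p.\<close>
    then obtain r where r: "r > 0" "ball (\<phi> p) r \<subseteq> \<phi> ` W" using W(2) openE by blast
    let ?B = "ball (\<phi> p) r"
    have "smooth_on ?B (\<lambda>y. h (inv_into U \<phi> y))"
      by (rule smooth_on_subset[OF smooth_funD[OF W(4) c]]) (use r W(3) in auto)
    then obtain k where k: "\<And>b. smooth_on ?B (k b)"
      "\<And>b. k b (\<phi> p) = frechet_derivative (\<lambda>y. h (inv_into U \<phi> y)) (at (\<phi> p)) b"
      "\<And>y. y \<in> ?B \<Longrightarrow> h (inv_into U \<phi> y) = h (inv_into U \<phi> (\<phi> p)) + (\<Sum>b\<in>Basis. ((y - \<phi> p) \<bullet> b) * k b y)"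
      using hadamard[of ?B "\<phi> p" "\<lambda>y. h (inv_into U \<phi> y)"] r(1) by auto
    define N where "N = U \<inter> \<phi> -` ?B"
    have N: "open N" "p \<in> N" "N \<subseteq> U"
      using continuous_open_preimage[of U \<phi> ?B] chart_homeomorphism[OF c] chart_open[OF c] p r(1)
      unfolding N_def homeomorphism_def by auto
    have NI: "\<phi> ` N \<subseteq> ?B" unfolding N_def by auto
    note near = smooth_nearI[OF N(1) subset_trans[OF N(3) chart_subset_carrier[OF c]] _ N(2)]
    have oN: "open (\<phi> ` N)" using chart_image_open[OF c N(1)] N(3) by (simp add: Int_absorb1)
    have nk: "smooth_near A p (\<lambda>q. k b (\<phi> q))" for b
    proof (rule near[OF smooth_fun_chartI[OF c N(1,3)]])
      show "smooth_on (\<phi> ` N) (\<lambda>y. k b (\<phi> (inv_into U \<phi> y)))"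
        by (rule smooth_on_cong[OF oN _ smooth_on_subset[OF k(1) NI]])
          (use N(3) chart_inv[OF c] in auto)
    qed
    have nx: "smooth_near A p (\<lambda>q. \<phi> q \<bullet> b)" for b
      by (rule near[OF smooth_fun_coordinate[OF c N(3,1)]])
    have nx': "smooth_near A p (\<lambda>q. \<phi> q \<bullet> b + - (\<phi> p \<bullet> b))" for b
      by (intro smooth_near_add nx smooth_near_const pc)
    have nm: "smooth_near A p (\<lambda>q. (\<phi> q \<bullet> b + - (\<phi> p \<bullet> b)) * k b (\<phi> q))" for b
      by (intro smooth_near_mult nx' nk)
    have "v h = v (\<lambda>q. h p + (\<Sum>b\<in>Basis. (\<phi> q \<bullet> b + - (\<phi> p \<bullet> b)) * k b (\<phi> q)))"
    proof (rule tangent_germ[OF v True N(1,2)])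
      fix q assume "q \<in> N"
      then show "h q = h p + (\<Sum>b\<in>Basis. (\<phi> q \<bullet> b + - (\<phi> p \<bullet> b)) * k b (\<phi> q))"
        using k(3)[of "\<phi> q"] chart_inv[OF c] p unfolding N_def by (simp add: inner_diff_left)
    qed
    also have "\<dots> = (\<Sum>b\<in>Basis. v (\<lambda>q. (\<phi> q \<bullet> b + - (\<phi> p \<bullet> b)) * k b (\<phi> q)))"
      by (subst tangent_add[OF v smooth_near_const[OF pc] smooth_near_sum[OF pc finite_Basis nm]])
        (simp only: tangent_const[OF v] tangent_sum[OF v pc finite_Basis nm] add_0_left)
    also have "\<dots> = (\<Sum>b\<in>Basis. v (\<lambda>q. \<phi> q \<bullet> b) * coord_field U \<phi> b p h)"
      using True
      by (intro sum.cong refl, subst tangent_mult[OF v nx' nk],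
          subst tangent_add[OF v nx smooth_near_const[OF pc]])
        (simp add: tangent_const[OF v] k(2) coord_field_def)
    finally show ?thesis .
  qed
qed

section \<open>Vector fields\<close>

lemma vector_field_onI:
  assumes "open W" "W \<subseteq> carrier A" "\<And>p. p \<in> W \<Longrightarrow> X p \<in> tangent_space A p"
    "\<And>V h. open V \<Longrightarrow> V \<subseteq> W \<Longrightarrow> smooth_fun A V h \<Longrightarrow> smooth_fun A V (\<lambda>p. X p h)"
  shows "vector_field_on A W X"
  using assms unfolding vector_field_on_def by blast

lemma
  assumes "vector_field_on A W X"
  shows vector_field_open: "open W"
    and vector_field_carrier: "W \<subseteq> carrier A"
    and vector_field_tangent: "p \<in> W \<Longrightarrow> X p \<in> tangent_space A p"
    and vector_field_smooth: "open V \<Longrightarrow> V \<subseteq> W \<Longrightarrow> smooth_fun A V h \<Longrightarrow> smooth_fun A V (\<lambda>p. X p h)"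
  using assms unfolding vector_field_on_def by blast+

lemma vector_field_subset:
  "vector_field_on A W X \<Longrightarrow> open V \<Longrightarrow> V \<subseteq> W \<Longrightarrow> vector_field_on A V X"
  unfolding vector_field_on_def by (meson subset_trans subsetD)

lemma vector_field_local:
  assumes "\<And>p. p \<in> W \<Longrightarrow> \<exists>V. p \<in> V \<and> V \<subseteq> W \<and> vector_field_on A V X"
  shows "vector_field_on A W X"
proof (rule vector_field_onI)
  show "open W" by (subst open_subopen) (use assms vector_field_open in blast)
  show "W \<subseteq> carrier A" using assms vector_field_carrier by blast
  show "X p \<in> tangent_space A p" if "p \<in> W" for p using assms that vector_field_tangent by blast
  fix V h assume V: "open V" "V \<subseteq> W" "smooth_fun A V h"
  show "smooth_fun A V (\<lambda>p. X p h)"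
  proof (rule smooth_fun_local)
    fix p assume p: "p \<in> V"
    with V(2) assms obtain N where N: "p \<in> N" "N \<subseteq> W" "vector_field_on A N X" by blast
    have "smooth_fun A (V \<inter> N) (\<lambda>p. X p h)"
      by (rule vector_field_smooth[OF N(3) _ _ smooth_fun_subset[OF V(3)]])
        (use V(1) vector_field_open[OF N(3)] in auto)
    then show "\<exists>N. open N \<and> p \<in> N \<and> smooth_fun A N (\<lambda>p. X p h)"
      using p N(1) V(1) vector_field_open[OF N(3)] by blast
  qed
qed

lemma vector_field_cong:
  assumes X: "vector_field_on A W X" and eq: "\<And>p. p \<in> W \<Longrightarrow> X p = Y p"
  shows "vector_field_on A W Y"
proof (rule vector_field_onI)
  fix V h assume V: "open V" "V \<subseteq> W" "smooth_fun A V h"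
  show "smooth_fun A V (\<lambda>p. Y p h)"
    by (rule smooth_fun_cong[OF V(1) _ vector_field_smooth[OF X V]]) (use V(2) eq in auto)
qed (use vector_field_open[OF X] vector_field_carrier[OF X] vector_field_tangent[OF X] eq in auto)

lemma vector_field_add:
  assumes "vector_field_on A W X" "vector_field_on A W Y"
  shows "vector_field_on A W (\<lambda>p h. X p h + Y p h)"
proof (rule vector_field_onI[OF vector_field_open[OF assms(1)] vector_field_carrier[OF assms(1)]])
  show "(\<lambda>h. X p h + Y p h) \<in> tangent_space A p" if "p \<in> W" for p
    by (intro tangent_space_add vector_field_tangent[OF assms(1) that] vector_field_tangent[OF assms(2) that])
  show "smooth_fun A V (\<lambda>p. X p h + Y p h)" if "open V" "V \<subseteq> W" "smooth_fun A V h" for V h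
    by (intro smooth_fun_add that(1) vector_field_smooth[OF assms(1) that] vector_field_smooth[OF assms(2) that])
qed

lemma vector_field_scale:
  assumes "vector_field_on A W X" "smooth_fun A W a"
  shows "vector_field_on A W (\<lambda>p h. a p * X p h)"
proof (rule vector_field_onI[OF vector_field_open[OF assms(1)] vector_field_carrier[OF assms(1)]])
  show "(\<lambda>h. a p * X p h) \<in> tangent_space A p" if "p \<in> W" for p
    by (intro tangent_space_scale vector_field_tangent[OF assms(1) that])
  show "smooth_fun A V (\<lambda>p. a p * X p h)" if "open V" "V \<subseteq> W" "smooth_fun A V h" for V h
    by (intro smooth_fun_mult that(1) vector_field_smooth[OF assms(1) that] smooth_fun_subset[OF assms(2) that(2)])
qed

lemma vector_field_zero: "open W \<Longrightarrow> W \<subseteq> carrier A \<Longrightarrow> vector_field_on A W (\<lambda>p h. 0)"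
  by (rule vector_field_onI) (simp_all add: tangent_space_zero smooth_fun_const)

lemma vector_field_diff:
  assumes "vector_field_on A W X" "vector_field_on A W Y"
  shows "vector_field_on A W (\<lambda>p h. X p h - Y p h)"
  using vector_field_add[OF assms(1) vector_field_scale[OF assms(2) smooth_fun_const[of _ "-1"]]] by simp

lemma vector_field_sum:
  assumes "finite B" "open W" "W \<subseteq> carrier A" "\<And>b. b \<in> B \<Longrightarrow> vector_field_on A W (X b)"
  shows "vector_field_on A W (\<lambda>p h. \<Sum>b\<in>B. X b p h)"
  using assms(1,4) by (induction B) (auto intro: vector_field_zero[OF assms(2,3)] vector_field_add)

lemma vector_field_near:
  assumes "vector_field_on A W X" "p \<in> W" "smooth_near A p h"
  shows "smooth_near A p (\<lambda>q. X q h)"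
proof -
  obtain V where V: "open V" "p \<in> V" "V \<subseteq> W" "V \<subseteq> carrier A" "smooth_fun A V h"
    using smooth_nearE[OF assms(3) vector_field_open[OF assms(1)] assms(2)] by metis
  show ?thesis by (rule smooth_nearI[OF V(1,4) vector_field_smooth[OF assms(1) V(1,3,5)] V(2)])
qed

lemma vector_field_coord:
  assumes c: "(U, \<phi>) \<in> A"
  shows "vector_field_on A U (coord_field U \<phi> b)"
proof (rule vector_field_onI[OF chart_open[OF c] chart_subset_carrier[OF c] coord_field_tangent[OF c]])
  fix V h assume V: "open V" "V \<subseteq> U" "smooth_fun A V h"
  have o: "open (\<phi> ` V)" using chart_image_open[OF c V(1)] V(2) by (simp add: Int_absorb1)
  have near: "smooth_near A q h" if "q \<in> V" for q
    using smooth_nearI[OF V(1) subset_trans[OF V(2) chart_subset_carrier[OF c]] V(3) that] .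
  have "smooth_on (\<phi> ` V) (\<lambda>y. frechet_derivative (\<lambda>y. h (inv_into U \<phi> y)) (at y) b)"
    using smooth_on_frechet_derivative[OF smooth_funD[OF V(3) c]] V(2) by (simp add: Int_absorb1)
  then have "smooth_on (\<phi> ` V) (\<lambda>y. coord_field U \<phi> b (inv_into U \<phi> y) h)"
    by (rule smooth_on_cong[OF o, rotated]) (use V(2) chart_inv[OF c] near in \<open>auto simp: coord_field_def subset_iff\<close>)
  then show "smooth_fun A V (\<lambda>p. coord_field U \<phi> b p h)"
    by (rule smooth_fun_chartI[OF c V(1,2)])
qed simp

text \<open>A composition of two derivations violates Leibniz' rule only by mixed products of first
  derivatives. These are symmetric in X and Y and drop out of the commutator.\<close>

lemma vector_field_bracket:
  assumes X: "vector_field_on A W X" and Y: "vector_field_on A W Y"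
  shows "vector_field_on A W (lie_bracket A X Y)"
proof (rule vector_field_onI[OF vector_field_open[OF X] vector_field_carrier[OF X]])
  note oW = vector_field_open[OF X]
  fix p assume p: "p \<in> W"
  note Xp = vector_field_tangent[OF X p] and Yp = vector_field_tangent[OF Y p]
  note nX = vector_field_near[OF X p] and nY = vector_field_near[OF Y p]
  have pc: "p \<in> carrier A" using vector_field_carrier[OF X] p by blast
  show "lie_bracket A X Y p \<in> tangent_space A p"
  proof (rule tangent_spaceI)
    fix h k assume h: "smooth_near A p h"
    { fix N assume N: "open N" "p \<in> N" and eq: "\<And>q. q \<in> N \<Longrightarrow> h q = k q"
      have k: "smooth_near A p k" using smooth_near_cong[OF h N eq] .
      obtain V where V: "open V" "p \<in> V" "V \<subseteq> N \<inter> W" and nV: "\<And>q. q \<in> V \<Longrightarrow> smooth_near A q h"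
        using smooth_nearE[OF h, of "N \<inter> W"] N p oW by (metis IntI open_Int)
      have e: "Z q h = Z q k" if Z: "vector_field_on A W Z" and q: "q \<in> V" for Z q
        by (rule tangent_germ[OF vector_field_tangent[OF Z] nV[OF q] N(1)]) (use q V(3) eq in auto)
      have "X p (\<lambda>q. Y q h) = X p (\<lambda>q. Y q k)" by (rule tangent_germ[OF Xp nY[OF h] V(1,2) e[OF Y]])
      moreover have "Y p (\<lambda>q. X q h) = Y p (\<lambda>q. X q k)" by (rule tangent_germ[OF Yp nX[OF h] V(1,2) e[OF X]])
      ultimately show "lie_bracket A X Y p h = lie_bracket A X Y p k"
        using h k by (simp add: lie_bracket_def) }
    { fix a
      obtain V where V: "open V" "p \<in> V" "V \<subseteq> W" and nV: "\<And>q. q \<in> V \<Longrightarrow> smooth_near A q h"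
        using smooth_nearE[OF h oW p] by metis
      have n: "smooth_near A p (\<lambda>q. a * h q)" by (intro smooth_near_mult smooth_near_const pc h)
      \<comment> \<open>Stated for any field Z and any vector u, so that it serves both orders of
        composition in the bracket.\<close>
      have e: "u (\<lambda>q. Z q (\<lambda>q. a * h q)) = a * u (\<lambda>q. Z q h)"
        if Z: "vector_field_on A W Z" and u: "u \<in> tangent_space A p" for Z u
      proof -
        have "u (\<lambda>q. Z q (\<lambda>q. a * h q)) = u (\<lambda>q. a * Z q h)"
          by (rule tangent_germ[OF u vector_field_near[OF Z p n] V(1,2)])
            (use V(3) in \<open>auto intro!: tangent_cmult[OF vector_field_tangent[OF Z] nV]\<close>)
        then show ?thesis using tangent_cmult[OF u vector_field_near[OF Z p h]] by simp
      qed
      show "lie_bracket A X Y p (\<lambda>q. a * h q) = a * lie_bracket A X Y p h"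
        using h n e[OF X Yp] e[OF Y Xp] by (simp add: lie_bracket_def algebra_simps) }
    assume k: "smooth_near A p k"
    obtain V where V: "open V" "p \<in> V" "V \<subseteq> W" and nV: "\<And>q. q \<in> V \<Longrightarrow> smooth_near A q h" "\<And>q. q \<in> V \<Longrightarrow> smooth_near A q k"
      using smooth_near2E[OF h k oW p] by metis
    have n: "smooth_near A p (\<lambda>q. h q + k q)" by (rule smooth_near_add[OF h k])
    have e: "u (\<lambda>q. Z q (\<lambda>q. h q + k q)) = u (\<lambda>q. Z q h) + u (\<lambda>q. Z q k)"
      if Z: "vector_field_on A W Z" and u: "u \<in> tangent_space A p" for Z u
    proof -
      have "u (\<lambda>q. Z q (\<lambda>q. h q + k q)) = u (\<lambda>q. Z q h + Z q k)"
        by (rule tangent_germ[OF u vector_field_near[OF Z p n] V(1,2)])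
          (use V(3) in \<open>auto intro!: tangent_add[OF vector_field_tangent[OF Z] nV]\<close>)
      then show ?thesis using tangent_add[OF u vector_field_near[OF Z p h] vector_field_near[OF Z p k]] by simp
    qed
    show "lie_bracket A X Y p (\<lambda>q. h q + k q) = lie_bracket A X Y p h + lie_bracket A X Y p k"
      using h k n e[OF X Yp] e[OF Y Xp] by (simp add: lie_bracket_def algebra_simps)
    have m: "smooth_near A p (\<lambda>q. h q * k q)" by (rule smooth_near_mult[OF h k])
    \<comment> \<open>The terms \<open>Z p h * u k\<close> and \<open>u h * Z p k\<close> are the
      symmetric ones: they recur when X and Y are exchanged.\<close>
    have e: "u (\<lambda>q. Z q (\<lambda>q. h q * k q)) = u (\<lambda>q. Z q h) * k p + Z p h * u k + (u h * Z p k + h p * u (\<lambda>q. Z q k))"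
      if Z: "vector_field_on A W Z" and u: "u \<in> tangent_space A p" for Z u
    proof -
      note nh = vector_field_near[OF Z p h] and nk = vector_field_near[OF Z p k]
      have "u (\<lambda>q. Z q (\<lambda>q. h q * k q)) = u (\<lambda>q. Z q h * k q + h q * Z q k)"
        by (rule tangent_germ[OF u vector_field_near[OF Z p m] V(1,2)])
          (use V(3) in \<open>auto intro!: tangent_mult[OF vector_field_tangent[OF Z] nV]\<close>)
      also have "\<dots> = u (\<lambda>q. Z q h * k q) + u (\<lambda>q. h q * Z q k)"
        by (rule tangent_add[OF u]) (intro smooth_near_mult nh nk h k)+
      finally show ?thesis
        using tangent_mult[OF u nh k] tangent_mult[OF u h nk] by simp
    qed
    show "lie_bracket A X Y p (\<lambda>q. h q * k q) = lie_bracket A X Y p h * k p + h p * lie_bracket A X Y p k"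
      using h k m e[OF X Yp] e[OF Y Xp] by (simp add: lie_bracket_def algebra_simps)
  qed (simp add: lie_bracket_def)
next
  fix V h assume V: "open V" "V \<subseteq> W" "smooth_fun A V h"
  have near: "smooth_near A q h" if "q \<in> V" for q
    using smooth_nearI[OF V(1) subset_trans[OF V(2) vector_field_carrier[OF X]] V(3) that] .
  show "smooth_fun A V (\<lambda>p. lie_bracket A X Y p h)"
    by (rule smooth_fun_cong[OF V(1) _ smooth_fun_diff[OF V(1)
        vector_field_smooth[OF X V(1,2) vector_field_smooth[OF Y V]]
        vector_field_smooth[OF Y V(1,2) vector_field_smooth[OF X V]]]])
      (simp add: near lie_bracket_def)
qed

end

section \<open>Orthogonal frames\<close>

text \<open>The form may be indefinite. If every vector of the orthogonal complement of the
  \<open>y i\<close> were null, polarisation would make G vanish on the complement; each of its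
  vectors would then be orthogonal to the complement and to the span, hence zero by nondegeneracy.
  Both claims follow: too few vectors cannot span, and a full set leaves no non-null vector
  over.\<close>

lemma
  fixes G :: "'e::euclidean_space \<Rightarrow> 'e \<Rightarrow> real" and y :: "nat \<Rightarrow> 'e"
  assumes sym: "\<And>u v. G u v = G v u"
    and add: "\<And>u v w. G (u + v) w = G u w + G v w"
    and scale: "\<And>a u v. G (a *\<^sub>R u) v = a * G u v"
    and nondeg: "\<And>u. (\<And>v. G u v = 0) \<Longrightarrow> u = 0"
    and orth: "\<And>i j. i < k \<Longrightarrow> j < k \<Longrightarrow> i \<noteq> j \<Longrightarrow> G (y i) (y j) = 0"
    and nonnull: "\<And>i. i < k \<Longrightarrow> G (y i) (y i) \<noteq> 0"
  shows bilinear_orthogonal_expand: "k = DIM('e) \<Longrightarrow> u = (\<Sum>i<k. (G u (y i) / G (y i) (y i)) *\<^sub>R y i)"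
    and bilinear_orthogonal_extend: "k < DIM('e) \<Longrightarrow> \<exists>u. (\<forall>i<k. G u (y i) = 0) \<and> G u u \<noteq> 0"
proof -
  have zero: "G 0 v = 0" for v using scale[of 0 0 v] by simp
  have sum: "G (\<Sum>i\<in>I. c i *\<^sub>R z i) v = (\<Sum>i\<in>I. c i * G (z i) v)" if "finite I" for I :: "nat set" and c z v
    using that by (induction I) (auto simp: add scale zero)
  have diff: "G (u - v) w = G u w - G v w" for u v w
    using add[of u "(-1) *\<^sub>R v" w] scale[of "-1" v w] by simp
  \<comment> \<open>Pairing a vanishing combination with \<open>z j\<close> isolates the coefficient
    of \<open>z j\<close>: orthogonal non-null vectors are independent, so their number is at most
    the dimension.\<close>
  have card: "m \<le> DIM('e)"
    if o: "\<And>i j. i < m \<Longrightarrow> j < m \<Longrightarrow> i \<noteq> j \<Longrightarrow> G (z i) (z j) = 0"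
      and n: "\<And>i. i < m \<Longrightarrow> G (z i) (z i) \<noteq> 0" for m and z :: "nat \<Rightarrow> 'e"
  proof -
    have inj: "inj_on z {..<m}" using o n by (metis inj_onI lessThan_iff)
    have "independent (z ` {..<m})"
    proof (rule independent_if_scalars_zero)
      fix c x assume s: "(\<Sum>x\<in>z ` {..<m}. c x *\<^sub>R x) = 0" and "x \<in> z ` {..<m}"
      then obtain j where j: "j < m" "x = z j" by auto
      have "0 = G (\<Sum>i<m. c (z i) *\<^sub>R z i) (z j)" using s zero by (simp add: sum.reindex[OF inj])
      also have "\<dots> = (\<Sum>i<m. if i = j then c (z j) * G (z j) (z j) else 0)"
        unfolding sum[OF finite_lessThan] by (rule sum.cong[OF refl]) (use o j in auto)
      also have "\<dots> = c (z j) * G (z j) (z j)" using j by simp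
      finally show "c x = 0" using n j by simp
    qed simp
    then show ?thesis using independent_bound card_image[OF inj] by fastforce
  qed
  define pr where "pr u = u - (\<Sum>i<k. (G u (y i) / G (y i) (y i)) *\<^sub>R y i)" for u
  have pr: "G (pr u) (y j) = 0" if "j < k" for u j
  proof -
    have "(\<Sum>i<k. G u (y i) / G (y i) (y i) * G (y i) (y j)) = (\<Sum>i<k. if i = j then G u (y j) else 0)"
      by (rule sum.cong) (auto simp: orth that nonnull)
    then show ?thesis using that unfolding pr_def by (simp add: diff sum)
  qed
  have pr0: "pr w = 0" if N: "\<And>u. (\<And>i. i < k \<Longrightarrow> G u (y i) = 0) \<Longrightarrow> G u u = 0" for w
  proof (rule nondeg)
    fix v
    have polar: "G (a + b) (a + b) = G a a + 2 * G a b + G b b" for a b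
      using sym[of _ "a + b"] sym[of b a] by (simp add: add)
    have "G (pr w + pr v) (pr w + pr v) = 0" by (rule N) (simp add: add pr)
    then have 1: "G (pr v) (pr w) = 0" using N[of "pr w"] N[of "pr v"] pr polar[of "pr w" "pr v"] sym by simp
    \<comment> \<open>v splits into \<open>pr v\<close> and a combination of the \<open>y i\<close>;
      the former pairs to zero with \<open>pr w\<close> by polarisation, the latter by
      orthogonality.\<close>
    have "G v (pr w) = G (pr v + (\<Sum>i<k. (G v (y i) / G (y i) (y i)) *\<^sub>R y i)) (pr w)"
      by (simp add: pr_def)
    also have "\<dots> = 0"
      using pr[of _ w] sym[of "y _" "pr w"] by (simp only: add sum[OF finite_lessThan] 1) simp
    finally show "G (pr w) v = 0" using sym by simp
  qed
  show "\<exists>u. (\<forall>i<k. G u (y i) = 0) \<and> G u u \<noteq> 0" if "k < DIM('e)"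
  proof (rule ccontr)
    assume "\<not> ?thesis"
    then have *: "pr w = 0" for w using pr0 by blast
    have "w \<in> span (y ` {..<k})" for w
    proof -
      have "w = (\<Sum>i<k. (G w (y i) / G (y i) (y i)) *\<^sub>R y i)" using *[of w] by (simp add: pr_def)
      moreover have "\<dots> \<in> span (y ` {..<k})" by (intro span_sum span_scale span_base) auto
      ultimately show ?thesis by simp
    qed
    then have "DIM('e) \<le> card (y ` {..<k})"
      by (metis UNIV_I dim_UNIV dim_le_card finite_imageI finite_lessThan subsetI)
    then show False using card_image_le[of "{..<k}" y] that by simp
  qed
  show "u = (\<Sum>i<k. (G u (y i) / G (y i) (y i)) *\<^sub>R y i)" if k: "k = DIM('e)"
  proof -
    \<comment> \<open>A non-null n orthogonal to a full system would give one orthogonal non-null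
      vector more than the dimension allows.\<close>
    have "G n n = 0" if n: "\<And>i. i < k \<Longrightarrow> G n (y i) = 0" for n
    proof (rule ccontr)
      assume "G n n \<noteq> 0"
      then have "Suc k \<le> DIM('e)"
        using n sym orth nonnull by (intro card[of "Suc k" "y(k := n)"]) (auto simp: less_Suc_eq)
      then show False using k by simp
    qed
    then have "pr u = 0" using pr0 by blast
    then show ?thesis by (simp add: pr_def)
  qed
qed

section \<open>Pseudo-Riemannian metrics and local orthonormal fields\<close>

locale pseudo_riemannian_manifold =
  fixes A :: "('m::{t2_space, second_countable_topology}, 'e::euclidean_space) chart set"
    and g :: "'m metric"
  assumes pseudo_riemannian: "pseudo_riemannian A g"

sublocale pseudo_riemannian_manifold \<subseteq> manifold A
  using pseudo_riemannian unfolding pseudo_riemannian_def by unfold_locales simp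

context pseudo_riemannian_manifold
begin

lemma
  assumes "p \<in> carrier A"
  shows metric_sym: "u \<in> tangent_space A p \<Longrightarrow> v \<in> tangent_space A p \<Longrightarrow> g p u v = g p v u"
    and metric_add: "u \<in> tangent_space A p \<Longrightarrow> v \<in> tangent_space A p \<Longrightarrow> w \<in> tangent_space A p \<Longrightarrow>
      g p (\<lambda>h. u h + v h) w = g p u w + g p v w"
    and metric_scale: "u \<in> tangent_space A p \<Longrightarrow> v \<in> tangent_space A p \<Longrightarrow> g p (\<lambda>h. a * u h) v = a * g p u v"
    and metric_nondeg: "u \<in> tangent_space A p \<Longrightarrow> (\<And>v. v \<in> tangent_space A p \<Longrightarrow> g p u v = 0) \<Longrightarrow> u = (\<lambda>h. 0)"
  using pseudo_riemannian assms unfolding pseudo_riemannian_def by auto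

lemma metric_smooth:
  "vector_field_on A W X \<Longrightarrow> vector_field_on A W Y \<Longrightarrow> smooth_fun A W (\<lambda>p. g p (X p) (Y p))"
  using pseudo_riemannian unfolding pseudo_riemannian_def by auto

lemma metric_zero:
  assumes "p \<in> carrier A" "v \<in> tangent_space A p"
  shows "g p (\<lambda>h. 0) v = 0"
  using metric_scale[OF assms(1) tangent_space_zero assms(2), of 0] by simp

lemma metric_diff:
  assumes p: "p \<in> carrier A" and T: "u \<in> tangent_space A p" "v \<in> tangent_space A p" "w \<in> tangent_space A p"
  shows "g p (\<lambda>h. u h - v h) w = g p u w - g p v w"
  using metric_add[OF p T(1) tangent_space_scale[OF T(2), of "-1"] T(3)] metric_scale[OF p T(2,3), of "-1"]
  by simp

lemma metric_sum:
  assumes p: "p \<in> carrier A" and "finite I" and u: "\<And>i. i \<in> I \<Longrightarrow> u i \<in> tangent_space A p"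
    and w: "w \<in> tangent_space A p"
  shows "g p (\<lambda>h. \<Sum>i\<in>I. c i * u i h) w = (\<Sum>i\<in>I. c i * g p (u i) w)"
  using assms(2) u
proof (induction I)
  case (insert i I)
  have "(\<lambda>h. \<Sum>i\<in>I. c i * u i h) \<in> tangent_space A p"
    using insert by (intro tangent_space_sum tangent_space_scale) auto
  then show ?case
    using insert w metric_add[OF p tangent_space_scale[of "u i"], of "\<lambda>h. \<Sum>i\<in>I. c i * u i h" w "c i"]
      metric_scale[OF p, of "u i" w "c i"] by simp
qed (simp add: metric_zero[OF p w])

text \<open>The tangent space is a set of functionals and not a type of its own, so the linear
  algebra is done in the model space: \<iota> turns a coefficient vector into a derivation, \<kappa>
  reads the coefficients off, and G is the metric in coordinates.\<close>

lemma
  fixes v :: "nat \<Rightarrow> 'm tvec"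
  assumes p: "p \<in> carrier A"
    and v: "\<And>i. i < k \<Longrightarrow> v i \<in> tangent_space A p"
    and orth: "\<And>i j. i < k \<Longrightarrow> j < k \<Longrightarrow> i \<noteq> j \<Longrightarrow> g p (v i) (v j) = 0"
    and nonnull: "\<And>i. i < k \<Longrightarrow> g p (v i) (v i) \<noteq> 0"
  shows tangent_orthogonal_expand: "k = DIM('e) \<Longrightarrow> u \<in> tangent_space A p \<Longrightarrow>
      u = (\<lambda>h. \<Sum>i<k. g p u (v i) / g p (v i) (v i) * v i h)"
    and tangent_orthogonal_extend: "k < DIM('e) \<Longrightarrow>
      \<exists>u\<in>tangent_space A p. (\<forall>i<k. g p u (v i) = 0) \<and> g p u u \<noteq> 0"
proof -
  obtain U \<phi> where c: "(U, \<phi>) \<in> A" and pU: "p \<in> U" using carrierE[OF p] .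
  define \<iota> where "\<iota> y = (\<lambda>h. \<Sum>b\<in>Basis. (y \<bullet> b) * coord_field U \<phi> b p h)" for y
  define \<kappa> where "\<kappa> u = (\<Sum>b\<in>Basis. u (\<lambda>q. \<phi> q \<bullet> b) *\<^sub>R b)" for u :: "'m tvec"
  have \<iota>T: "\<iota> y \<in> tangent_space A p" for y
    unfolding \<iota>_def by (intro tangent_space_sum tangent_space_scale coord_field_tangent[OF c pU]) simp
  have \<kappa>b: "\<kappa> u \<bullet> b = u (\<lambda>q. \<phi> q \<bullet> b)" if "b \<in> Basis" for u b
    using that by (simp add: \<kappa>_def inner_sum_left inner_Basis if_distrib sum.If_cases)
  have \<iota>\<kappa>: "\<iota> (\<kappa> u) = u" if "u \<in> tangent_space A p" for u
    unfolding \<iota>_def using tangent_expand[OF c pU that] \<kappa>b by simp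
  \<comment> \<open>Evaluation on the coordinate functions recovers the coefficients, so \<iota> is
    injective; through this, nondegeneracy passes from the metric to G.\<close>
  have \<iota>0: "y = 0" if "\<iota> y = (\<lambda>h. 0)" for y
  proof (rule euclidean_eqI)
    fix b :: 'e assume b: "b \<in> Basis"
    have "0 = \<iota> y (\<lambda>q. \<phi> q \<bullet> b)" using that by simp
    also have "\<dots> = y \<bullet> b" using b
      by (simp add: \<iota>_def coord_field_coordinate[OF c pU] inner_Basis if_distrib sum.If_cases)
    finally show "y \<bullet> b = 0 \<bullet> b" by simp
  qed
  define G where "G y z = g p (\<iota> y) (\<iota> z)" for y z
  have sym: "G y z = G z y" for y z unfolding G_def using metric_sym[OF p] \<iota>T by blast
  have "\<iota> (y + z) = (\<lambda>h. \<iota> y h + \<iota> z h)" for y z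
    by (simp add: \<iota>_def inner_add_left distrib_right sum.distrib)
  then have add: "G (y + z) w = G y w + G z w" for y z w
    unfolding G_def using metric_add[OF p] \<iota>T by simp
  have "\<iota> (a *\<^sub>R y) = (\<lambda>h. a * \<iota> y h)" for a y
    by (simp add: \<iota>_def sum_distrib_left mult.assoc)
  then have scale: "G (a *\<^sub>R y) z = a * G y z" for a y z
    unfolding G_def using metric_scale[OF p] \<iota>T by simp
  have nondeg: "y = 0" if "\<And>z. G y z = 0" for y
  proof (rule \<iota>0, rule metric_nondeg[OF p \<iota>T])
    fix u assume "u \<in> tangent_space A p"
    then show "g p (\<iota> y) u = 0" using that[of "\<kappa> u"] \<iota>\<kappa> by (simp add: G_def)
  qed
  have Gv: "G (\<kappa> u) (\<kappa> (v i)) = g p u (v i)" if "u \<in> tangent_space A p" "i < k" for u i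
    by (simp add: G_def \<iota>\<kappa> that v)
  have orth': "G (\<kappa> (v i)) (\<kappa> (v j)) = 0" if "i < k" "j < k" "i \<noteq> j" for i j
    using orth that v by (simp add: Gv)
  have nonnull': "G (\<kappa> (v i)) (\<kappa> (v i)) \<noteq> 0" if "i < k" for i
    using nonnull that v by (simp add: Gv)
  note * = sym add scale nondeg orth' nonnull'
  show "u = (\<lambda>h. \<Sum>i<k. g p u (v i) / g p (v i) (v i) * v i h)" if k: "k = DIM('e)" and u: "u \<in> tangent_space A p"
  proof -
    have "\<kappa> u = (\<Sum>i<k. (G (\<kappa> u) (\<kappa> (v i)) / G (\<kappa> (v i)) (\<kappa> (v i))) *\<^sub>R \<kappa> (v i))"
      by (rule bilinear_orthogonal_expand[of G k "\<lambda>i. \<kappa> (v i)", OF * k])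
    then have e: "\<kappa> u = (\<Sum>i<k. (g p u (v i) / g p (v i) (v i)) *\<^sub>R \<kappa> (v i))"
      using u v by (simp add: Gv)
    have "u h = (\<Sum>i<k. g p u (v i) / g p (v i) (v i) * v i h)" for h
    proof -
      have "u h = \<iota> (\<kappa> u) h" using \<iota>\<kappa>[OF u] by simp
      also have "\<dots> = (\<Sum>b\<in>Basis. \<Sum>i<k. g p u (v i) / g p (v i) (v i) * ((\<kappa> (v i) \<bullet> b) * coord_field U \<phi> b p h))"
        unfolding \<iota>_def e by (simp add: inner_sum_left sum_distrib_right mult.assoc)
      also have "\<dots> = (\<Sum>i<k. \<Sum>b\<in>Basis. g p u (v i) / g p (v i) (v i) * ((\<kappa> (v i) \<bullet> b) * coord_field U \<phi> b p h))"
        by (rule sum.swap)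
      also have "\<dots> = (\<Sum>i<k. g p u (v i) / g p (v i) (v i) * \<iota> (\<kappa> (v i)) h)"
        unfolding \<iota>_def by (simp only: sum_distrib_left)
      finally show ?thesis using \<iota>\<kappa> v by simp
    qed
    then show ?thesis by blast
  qed
  show "\<exists>u\<in>tangent_space A p. (\<forall>i<k. g p u (v i) = 0) \<and> g p u u \<noteq> 0" if k: "k < DIM('e)"
  proof -
    obtain y where y: "\<forall>i<k. G y (\<kappa> (v i)) = 0" "G y y \<noteq> 0"
      using bilinear_orthogonal_extend[of G k "\<lambda>i. \<kappa> (v i)", OF * k] by blast
    then show ?thesis
      using \<iota>T v by (intro bexI[of _ "\<iota> y"]) (auto simp: G_def \<iota>\<kappa>)
  qed
qed

text \<open>The coefficients of u in a chart are frozen, and the coordinate fields carry them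
  along.\<close>

lemma tangent_extend:
  assumes p: "p \<in> carrier A" and u: "u \<in> tangent_space A p"
  obtains W X where "p \<in> W" "vector_field_on A W X" "X p = u"
proof -
  obtain U \<phi> where c: "(U, \<phi>) \<in> A" and pU: "p \<in> U" using carrierE[OF p] .
  have "vector_field_on A U (\<lambda>q h. \<Sum>b\<in>Basis. u (\<lambda>q. \<phi> q \<bullet> b) * coord_field U \<phi> b q h)"
    by (intro vector_field_sum vector_field_scale vector_field_coord[OF c] smooth_fun_const finite_Basis
        chart_open[OF c] chart_subset_carrier[OF c])
  then show thesis by (rule that[OF pU]) (rule tangent_expand[OF c pU u, symmetric])
qed

lemma smooth_fun_nonzero_neighbourhood:
  assumes "open W" "W \<subseteq> carrier A" "smooth_fun A W h" "p \<in> W" "h p \<noteq> 0"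
  obtains V where "open V" "p \<in> V" "V \<subseteq> W" "\<And>q. q \<in> V \<Longrightarrow> h q \<noteq> 0"
proof -
  have "open (W \<inter> h -` (- {0}))"
    by (rule continuous_open_preimage[OF smooth_fun_continuous_on[OF assms(1-3)] assms(1)])
      (simp add: open_Compl)
  then show thesis using that[of "W \<inter> h -` (- {0})"] assms(4,5) by auto
qed

text \<open>Gram-Schmidt; since the metric is indefinite, the next vector is chosen non-null and
  orthogonal to the previous ones at \<open>p\<close> before it is extended to a neighbourhood.\<close>

lemma orthonormal_fields_exist:
  assumes p: "p \<in> carrier A" and "k \<le> DIM('e)"
  shows "\<exists>W E. p \<in> W \<and> open W \<and> W \<subseteq> carrier A \<and> (\<forall>i<k. vector_field_on A W (E i)) \<and>
    (\<forall>q\<in>W. \<forall>i<k. \<forall>j<k. if i = j then g q (E i q) (E j q) \<in> {1, -1} else g q (E i q) (E j q) = 0)"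
  using assms(2)
proof (induction k)
  case 0
  show ?case by (rule exI[of _ "carrier A"]) (use p open_carrier in auto)
next
  case (Suc k)
  then obtain W E where WE: "p \<in> W \<and> open W \<and> W \<subseteq> carrier A \<and> (\<forall>i<k. vector_field_on A W (E i)) \<and>
    (\<forall>q\<in>W. \<forall>i<k. \<forall>j<k. if i = j then g q (E i q) (E j q) \<in> {1, -1} else g q (E i q) (E j q) = 0)"
    by (metis Suc_leD)
  then have W: "p \<in> W" "open W" "W \<subseteq> carrier A"
    and E: "\<And>i. i < k \<Longrightarrow> vector_field_on A W (E i)"
    by auto
  from WE have on: "if i = j then g q (E i q) (E j q) \<in> {1, -1} else g q (E i q) (E j q) = 0"
    if "q \<in> W" "i < k" "j < k" for q i j
    using that by blast
  have one: "g q (E i q) (E i q) \<noteq> 0" if "q \<in> W" "i < k" for q i using on[OF that that(2)] by auto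
  have orth: "g q (E i q) (E j q) = 0" if "q \<in> W" "i < k" "j < k" "i \<noteq> j" for q i j
    using on[OF that(1-3)] that(4) by auto
  obtain u where u: "u \<in> tangent_space A p" "\<And>i. i < k \<Longrightarrow> g p u (E i p) = 0" "g p u u \<noteq> 0"
    using tangent_orthogonal_extend[OF p, of k "\<lambda>i. E i p"] Suc.prems vector_field_tangent[OF E W(1)]
      orth one W(1) by auto
  obtain V X where V: "p \<in> V" "vector_field_on A V X" "X p = u" using tangent_extend[OF p u(1)] .
  let ?N = "V \<inter> W"
  have N: "open ?N" "?N \<subseteq> carrier A" "p \<in> ?N" using V W vector_field_open[OF V(2)] by auto
  have XN: "vector_field_on A ?N X" using vector_field_subset[OF V(2) N(1)] by auto
  have EN: "vector_field_on A ?N (E i)" if "i < k" for i using vector_field_subset[OF E[OF that] N(1)] by auto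
  \<comment> \<open>Away from p the extension X need not be orthogonal to the earlier fields.
    Subtracting its components corrects this and leaves the value at p unchanged.\<close>
  define Y where "Y = (\<lambda>q h. X q h - (\<Sum>i<k. (g q (X q) (E i q) / g q (E i q) (E i q)) * E i q h))"
  have YN: "vector_field_on A ?N Y" unfolding Y_def
    by (intro vector_field_diff XN vector_field_sum vector_field_scale EN smooth_fun_divide N(1,2) metric_smooth)
      (auto simp: one)
  have YE: "g q (Y q) (E j q) = 0" if q: "q \<in> ?N" and j: "j < k" for q j
  proof -
    have qc: "q \<in> carrier A" using q N by auto
    note T = vector_field_tangent[OF XN q] vector_field_tangent[OF EN q]
    have "g q (Y q) (E j q) = g q (X q) (E j q)
        - (\<Sum>i<k. g q (X q) (E i q) / g q (E i q) (E i q) * g q (E i q) (E j q))"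
      unfolding Y_def
      by (subst metric_diff[OF qc T(1) tangent_space_sum[OF finite_lessThan tangent_space_scale[OF T(2)]] T(2)[OF j]],
          simp, subst metric_sum[OF qc finite_lessThan T(2) T(2)[OF j]]) simp_all
    also have "(\<Sum>i<k. g q (X q) (E i q) / g q (E i q) (E i q) * g q (E i q) (E j q))
        = (\<Sum>i<k. if i = j then g q (X q) (E j q) else 0)"
      by (rule sum.cong) (use q j in \<open>auto simp: orth one\<close>)
    finally show ?thesis using j by simp
  qed
  have "Y p = u" using u(2) V(3) by (simp add: Y_def)
  then obtain V' where V': "open V'" "p \<in> V'" "V' \<subseteq> ?N" "\<And>q. q \<in> V' \<Longrightarrow> g q (Y q) (Y q) \<noteq> 0"
    using smooth_fun_nonzero_neighbourhood[OF N(1,2) metric_smooth[OF YN YN] N(3)] u(3) by metis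
  \<comment> \<open>For a = \<open>g q (Y q) (Y q)\<close> of either sign,
    \<open>(a * a) powr (- 1 / 4)\<close> is |a| to the power -1/2, and it depends smoothly on
    q.\<close>
  define Z where "Z = (\<lambda>q h. (g q (Y q) (Y q) * g q (Y q) (Y q)) powr (- 1 / 4) * Y q h)"
  have YV: "vector_field_on A V' Y" using vector_field_subset[OF YN V'(1,3)] .
  have ZV: "vector_field_on A V' Z"
    unfolding Z_def by (intro vector_field_scale YV smooth_fun_powr V'(1,4) metric_smooth)
  have ZZ: "g q (Z q) (Z q) \<in> {1, -1}" and ZE: "\<And>j. j < k \<Longrightarrow> g q (Z q) (E j q) = 0 \<and> g q (E j q) (Z q) = 0"
    if q: "q \<in> V'" for q
  proof -
    have qN: "q \<in> ?N" and qc: "q \<in> carrier A" using q V'(3) N(2) by auto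
    note Yq = vector_field_tangent[OF YV q] and Zq = vector_field_tangent[OF ZV q]
    let ?a = "g q (Y q) (Y q)" let ?r = "(?a * ?a) powr (- 1 / 4)"
    have "g q (Z q) (Y q) = ?r * ?a" unfolding Z_def using metric_scale[OF qc Yq Yq] by simp
    moreover have "g q (Z q) (Z q) = ?r * g q (Y q) (Z q)"
      using metric_scale[OF qc Yq Zq, of ?r] by (simp add: Z_def)
    ultimately have "g q (Z q) (Z q) = ?r * ?r * ?a" using metric_sym[OF qc Yq Zq] by simp
    also have "?r * ?r = (?a * ?a) powr (- 1 / 2)" by (simp flip: powr_add)
    also have "\<dots> = 1 / \<bar>?a\<bar>"
      by (simp add: powr_minus_divide powr_half_sqrt real_sqrt_mult_self flip: power2_eq_square)
    finally show "g q (Z q) (Z q) \<in> {1, -1}" using V'(4)[OF q] by (auto simp: abs_if)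
    fix j assume j: "j < k"
    have Ej: "E j q \<in> tangent_space A q" using vector_field_tangent[OF EN[OF j] qN] .
    show "g q (Z q) (E j q) = 0 \<and> g q (E j q) (Z q) = 0"
      using metric_scale[OF qc Yq Ej, of ?r] YE[OF qN j] metric_sym[OF qc Ej Zq] by (simp add: Z_def)
  qed
  have "\<forall>i<Suc k. vector_field_on A V' ((E(k := Z)) i)"
    using ZV vector_field_subset[OF EN V'(1,3)] by (auto simp: less_Suc_eq)
  moreover have "\<forall>q\<in>V'. \<forall>i<Suc k. \<forall>j<Suc k. if i = j then g q ((E(k := Z)) i q) ((E(k := Z)) j q) \<in> {1, -1}
      else g q ((E(k := Z)) i q) ((E(k := Z)) j q) = 0"
  proof (intro ballI allI impI)
    fix q i j assume q: "q \<in> V'" and ij: "i < Suc k" "j < Suc k"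
    then have qW: "q \<in> W" using V'(3) by auto
    show "if i = j then g q ((E(k := Z)) i q) ((E(k := Z)) j q) \<in> {1, -1}
      else g q ((E(k := Z)) i q) ((E(k := Z)) j q) = 0"
      using on[OF qW, of i j] ZZ[OF q] ZE[OF q] ij by (cases "i = k"; cases "j = k") (auto simp: less_Suc_eq)
  qed
  moreover have "p \<in> V'" "open V'" "V' \<subseteq> carrier A" using V'(1-3) N(2) by auto
  ultimately show ?case by (intro exI[of _ V'] exI[of _ "E(k := Z)"] conjI)
qed

section \<open>Orthogonal frames and traces\<close>

definition orthogonal_frame :: "'m set \<Rightarrow> (nat \<Rightarrow> 'm vfield) \<Rightarrow> bool" where
  "orthogonal_frame W e \<longleftrightarrow> (\<forall>i<mdim A. vector_field_on A W (e i)) \<and>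
    (\<forall>p\<in>W. \<forall>i<mdim A. \<forall>j<mdim A. i \<noteq> j \<longrightarrow> g p (e i p) (e j p) = 0) \<and>
    (\<forall>p\<in>W. \<forall>i<mdim A. g p (e i p) (e i p) \<noteq> 0)"

lemma frame_at_orthonormal:
  assumes p: "p \<in> carrier A"
  obtains W where "open W" "p \<in> W" "orthonormal_frame A g W (frame_at A g p)"
proof -
  have "\<exists>E W. open W \<and> p \<in> W \<and> orthonormal_frame A g W E"
    using orthonormal_fields_exist[OF p order_refl] unfolding orthonormal_frame_def mdim_def by metis
  from someI_ex[OF this] show thesis using that unfolding frame_at_def by blast
qed

lemma orthonormal_imp_orthogonal: "orthonormal_frame A g W E \<Longrightarrow> orthogonal_frame W E"
  unfolding orthonormal_frame_def orthogonal_frame_def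
  by (metis (mono_tags) empty_iff insert_iff neg_equal_0_iff_equal zero_neq_one)

text \<open>A sign is its own inverse. This is the bridge from the sign-weighted sums of the
  definitions to the quotients used for orthogonal frames.\<close>

lemma orthonormal_frame_mult:
  assumes "orthonormal_frame A g W E" "p \<in> W" "i < mdim A"
  shows "g p (E i p) (E i p) * x = x / g p (E i p) (E i p)"
proof -
  have "g p (E i p) (E i p) \<in> {1, -1}"
    using assms unfolding orthonormal_frame_def by presburger
  then show ?thesis by auto
qed

lemma
  assumes "orthogonal_frame W e"
  shows orthogonal_frame_field: "i < mdim A \<Longrightarrow> vector_field_on A W (e i)"
    and orthogonal_frame_orthogonal: "p \<in> W \<Longrightarrow> i < mdim A \<Longrightarrow> j < mdim A \<Longrightarrow> i \<noteq> j \<Longrightarrow> g p (e i p) (e j p) = 0"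
    and orthogonal_frame_nonnull: "p \<in> W \<Longrightarrow> i < mdim A \<Longrightarrow> g p (e i p) (e i p) \<noteq> 0"
  using assms unfolding orthogonal_frame_def by blast+

lemma orthogonal_frame_subset: "orthogonal_frame W e \<Longrightarrow> open V \<Longrightarrow> V \<subseteq> W \<Longrightarrow> orthogonal_frame V e"
  unfolding orthogonal_frame_def using vector_field_subset by (meson subsetD)

text \<open>Both facts are read off from the field \<open>e 0\<close>, which belongs to the frame
  because a Euclidean space has positive dimension.\<close>

lemma orthogonal_frame_open: "orthogonal_frame W e \<Longrightarrow> open W"
  and orthogonal_frame_carrier: "orthogonal_frame W e \<Longrightarrow> W \<subseteq> carrier A"
  using orthogonal_frame_field[of W e 0] vector_field_open vector_field_carrier by (auto simp: mdim_def)

lemma orthogonal_frame_expand: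
  assumes e: "orthogonal_frame W e" and p: "p \<in> W" and u: "u \<in> tangent_space A p"
  shows "u = (\<lambda>h. \<Sum>i<mdim A. g p u (e i p) / g p (e i p) (e i p) * e i p h)"
proof -
  have pc: "p \<in> carrier A" using orthogonal_frame_carrier[OF e] p by blast
  show ?thesis unfolding mdim_def
    by (rule tangent_orthogonal_expand[OF pc _ _ _ refl u])
      (use vector_field_tangent[OF orthogonal_frame_field[OF e] p] orthogonal_frame_orthogonal[OF e p]
        orthogonal_frame_nonnull[OF e p] in \<open>auto simp: mdim_def\<close>)
qed

lemma orthogonal_frame_parseval:
  assumes e: "orthogonal_frame W e" and p: "p \<in> W" and u: "u \<in> tangent_space A p" and v: "v \<in> tangent_space A p"
  shows "g p u v = (\<Sum>i<mdim A. g p u (e i p) * g p v (e i p) / g p (e i p) (e i p))"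
proof -
  have pc: "p \<in> carrier A" using orthogonal_frame_carrier[OF e] p by blast
  note T = vector_field_tangent[OF orthogonal_frame_field[OF e] p]
  have "g p u v = g p (\<lambda>h. \<Sum>i<mdim A. g p u (e i p) / g p (e i p) (e i p) * e i p h) v"
    using orthogonal_frame_expand[OF e p u] by simp
  also have "\<dots> = (\<Sum>i<mdim A. g p u (e i p) / g p (e i p) (e i p) * g p (e i p) v)"
    by (rule metric_sum[OF pc _ _ v]) (use T in auto)
  finally show ?thesis using metric_sym[OF pc T v] by simp
qed

text \<open>Linearity over the smooth functions on W, evaluated at p. The last clause is there
  because fields are total functions: their values outside W are arbitrary and must not influence
  \<Phi>.\<close>

definition tensorial :: "'m set \<Rightarrow> 'm \<Rightarrow> ('m vfield \<Rightarrow> real) \<Rightarrow> bool" where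
  "tensorial W p \<Phi> \<longleftrightarrow>
    (\<forall>X Y. vector_field_on A W X \<longrightarrow> vector_field_on A W Y \<longrightarrow> \<Phi> (\<lambda>q h. X q h + Y q h) = \<Phi> X + \<Phi> Y) \<and>
    (\<forall>a X. smooth_fun A W a \<longrightarrow> vector_field_on A W X \<longrightarrow> \<Phi> (\<lambda>q h. a q * X q h) = a p * \<Phi> X) \<and>
    (\<forall>X Y. vector_field_on A W X \<longrightarrow> (\<forall>q\<in>W. X q = Y q) \<longrightarrow> \<Phi> X = \<Phi> Y)"

lemma
  assumes "tensorial W p \<Phi>" "vector_field_on A W X"
  shows tensorial_add: "vector_field_on A W Y \<Longrightarrow> \<Phi> (\<lambda>q h. X q h + Y q h) = \<Phi> X + \<Phi> Y"
    and tensorial_scale: "smooth_fun A W a \<Longrightarrow> \<Phi> (\<lambda>q h. a q * X q h) = a p * \<Phi> X"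
    and tensorial_cong: "(\<And>q. q \<in> W \<Longrightarrow> X q = Y q) \<Longrightarrow> \<Phi> X = \<Phi> Y"
  using assms unfolding tensorial_def by blast+

lemma tensorial_sum:
  assumes t: "tensorial W p \<Phi>" and W: "open W" "W \<subseteq> carrier A" and "finite I"
    and X: "\<And>i. i \<in> I \<Longrightarrow> vector_field_on A W (X i)" and a: "\<And>i. i \<in> I \<Longrightarrow> smooth_fun A W (a i)"
  shows "\<Phi> (\<lambda>q h. \<Sum>i\<in>I. a i q * X i q h) = (\<Sum>i\<in>I. a i p * \<Phi> (X i))"
  using assms(4) X a
proof (induction I)
  case empty
  have "\<Phi> (\<lambda>q h. 0 * 0) = 0 * \<Phi> (\<lambda>q h. 0)"
    by (rule tensorial_scale[OF t vector_field_zero[OF W] smooth_fun_const])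
  then show ?case by simp
next
  case (insert i I)
  have "vector_field_on A W (\<lambda>q h. a i q * X i q h)" "vector_field_on A W (\<lambda>q h. \<Sum>i\<in>I. a i q * X i q h)"
    using insert W by (auto intro!: vector_field_sum vector_field_scale)
  then have "\<Phi> (\<lambda>q h. a i q * X i q h + (\<Sum>i\<in>I. a i q * X i q h))
      = \<Phi> (\<lambda>q h. a i q * X i q h) + \<Phi> (\<lambda>q h. \<Sum>i\<in>I. a i q * X i q h)"
    by (rule tensorial_add[OF t])
  moreover have "\<Phi> (\<lambda>q h. a i q * X i q h) = a i p * \<Phi> (X i)"
    using insert.prems by (intro tensorial_scale[OF t]) auto
  ultimately show ?case using insert by simp
qed

text \<open>The frame expansion of X holds on all of W with smooth coefficients, and these leave
  \<Phi> with their values at p. Hence \<open>\<Phi> X\<close> depends on \<open>X p\<close>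
  alone.\<close>

lemma tensorial_expand:
  assumes t: "tensorial W p \<Phi>" and e: "orthogonal_frame W e" and X: "vector_field_on A W X"
  shows "\<Phi> X = (\<Sum>i<mdim A. g p (X p) (e i p) / g p (e i p) (e i p) * \<Phi> (e i))"
proof -
  have "\<Phi> X = \<Phi> (\<lambda>q h. \<Sum>i<mdim A. (g q (X q) (e i q) / g q (e i q) (e i q)) * e i q h)"
    by (rule tensorial_cong[OF t X orthogonal_frame_expand[OF e _ vector_field_tangent[OF X]]])
  also have "\<dots> = (\<Sum>i<mdim A. g p (X p) (e i p) / g p (e i p) (e i p) * \<Phi> (e i))"
    by (rule tensorial_sum[OF t vector_field_open[OF X] vector_field_carrier[OF X]])
      (auto intro!: smooth_fun_divide metric_smooth
        simp: vector_field_open[OF X] X orthogonal_frame_field[OF e] orthogonal_frame_nonnull[OF e])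
  finally show ?thesis .
qed

text \<open>The first argument is expanded in e, the sums are exchanged, and the second argument is
  reassembled: by symmetry of g the products of \<open>E k\<close> with \<open>e i\<close> are also
  the expansion coefficients of \<open>e i\<close> in E. No change-of-frame matrix has to be
  inverted.\<close>

lemma trace_independent_of_frame:
  assumes t1: "\<And>Y. vector_field_on A W Y \<Longrightarrow> tensorial W p (\<lambda>X. B X Y)"
    and t2: "\<And>X. vector_field_on A W X \<Longrightarrow> tensorial W p (\<lambda>Y. B X Y)"
    and E: "orthogonal_frame W E" and e: "orthogonal_frame W e" and p: "p \<in> W"
  shows "(\<Sum>k<mdim A. B (E k) (E k) / g p (E k p) (E k p)) = (\<Sum>i<mdim A. B (e i) (e i) / g p (e i p) (e i p))"
proof -
  have pc: "p \<in> carrier A" using orthogonal_frame_carrier[OF e] p by blast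
  let ?n = "mdim A"
  note Ef = orthogonal_frame_field[OF E] and ef = orthogonal_frame_field[OF e]
  have "(\<Sum>k<?n. B (E k) (E k) / g p (E k p) (E k p))
      = (\<Sum>k<?n. \<Sum>i<?n. g p (E k p) (e i p) * B (e i) (E k) / (g p (e i p) (e i p) * g p (E k p) (E k p)))"
  proof (rule sum.cong[OF refl])
    fix k assume "k \<in> {..<?n}"
    then have "vector_field_on A W (E k)" using Ef by simp
    then have "B (E k) (E k) = (\<Sum>i<?n. g p (E k p) (e i p) / g p (e i p) (e i p) * B (e i) (E k))"
      by (intro tensorial_expand[OF t1 e])
    then show "B (E k) (E k) / g p (E k p) (E k p)
        = (\<Sum>i<?n. g p (E k p) (e i p) * B (e i) (E k) / (g p (e i p) (e i p) * g p (E k p) (E k p)))"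
      by (simp only: sum_divide_distrib) simp
  qed
  also have "\<dots> = (\<Sum>i<?n. \<Sum>k<?n. g p (E k p) (e i p) * B (e i) (E k) / (g p (e i p) (e i p) * g p (E k p) (E k p)))"
    by (rule sum.swap)
  also have "\<dots> = (\<Sum>i<?n. \<Sum>k<?n. g p (e i p) (E k p) * B (e i) (E k) / (g p (E k p) (E k p) * g p (e i p) (e i p)))"
    using metric_sym[OF pc vector_field_tangent[OF Ef p] vector_field_tangent[OF ef p]]
    by (intro sum.cong refl) (simp add: mult.commute)
  also have "\<dots> = (\<Sum>i<?n. B (e i) (e i) / g p (e i p) (e i p))"
  proof (rule sum.cong[OF refl])
    fix i assume "i \<in> {..<?n}"
    then have "vector_field_on A W (e i)" using ef by simp
    then have "B (e i) (e i) = (\<Sum>k<?n. g p (e i p) (E k p) / g p (E k p) (E k p) * B (e i) (E k))"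
      by (intro tensorial_expand[OF t2 E])
    then show "(\<Sum>k<?n. g p (e i p) (E k p) * B (e i) (E k) / (g p (E k p) (E k p) * g p (e i p) (e i p)))
        = B (e i) (e i) / g p (e i p) (e i p)"
      by (simp only: sum_divide_distrib) simp
  qed
  finally show ?thesis .
qed

end

section \<open>The Levi-Civita connection and its curvature\<close>

locale levi_civita_manifold = pseudo_riemannian_manifold A g
  for A :: "('m::{t2_space, second_countable_topology}, 'e::euclidean_space) chart set" and g +
  fixes D :: "'m vfield \<Rightarrow> 'm vfield \<Rightarrow> 'm vfield"
  assumes levi_civita: "levi_civita A g D"
begin

lemma
  assumes X: "vector_field_on A W X" and Y: "vector_field_on A W Y"
  shows conn_vector_field: "vector_field_on A W (D X Y)"
    and conn_cong: "p \<in> W \<Longrightarrow> (\<And>q. q \<in> W \<Longrightarrow> X q = X' q) \<Longrightarrow> (\<And>q. q \<in> W \<Longrightarrow> Y q = Y' q) \<Longrightarrow> D X Y p = D X' Y' p"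
    and conn_add_left: "p \<in> W \<Longrightarrow> vector_field_on A W Z \<Longrightarrow> D (\<lambda>q k. X q k + Y q k) Z p h = D X Z p h + D Y Z p h"
    and conn_add_right: "p \<in> W \<Longrightarrow> vector_field_on A W Z \<Longrightarrow> D Z (\<lambda>q k. X q k + Y q k) p h = D Z X p h + D Z Y p h"
    and conn_scale_left: "p \<in> W \<Longrightarrow> smooth_fun A W a \<Longrightarrow> D (\<lambda>q k. a q * X q k) Y p h = a p * D X Y p h"
    and conn_scale_right: "p \<in> W \<Longrightarrow> smooth_fun A W a \<Longrightarrow> D X (\<lambda>q k. a q * Y q k) p h = X p a * Y p h + a p * D X Y p h"
    and torsion_free: "p \<in> W \<Longrightarrow> lie_bracket A X Y p = (\<lambda>h. D X Y p h - D Y X p h)"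
    and metric_compat: "p \<in> W \<Longrightarrow> vector_field_on A W Z \<Longrightarrow>
      X p (\<lambda>q. g q (Y q) (Z q)) = g p (D X Y p) (Z p) + g p (Y p) (D X Z p)"
proof -
  note L = levi_civita[unfolded levi_civita_def]
  note C = conjunct1[OF L, unfolded affine_connection_def]
  show "vector_field_on A W (D X Y)" using conjunct1[OF C] X Y by blast
  show "D X Y p = D X' Y' p"
    if "p \<in> W" "\<And>q. q \<in> W \<Longrightarrow> X q = X' q" "\<And>q. q \<in> W \<Longrightarrow> Y q = Y' q"
    using conjunct1[OF conjunct2[OF C]] X Y that by blast
  note C3 = conjunct1[OF conjunct2[OF conjunct2[OF C]], rule_format]
  note C4 = conjunct2[OF conjunct2[OF conjunct2[OF C]], rule_format]
  show "D (\<lambda>q k. X q k + Y q k) Z p h = D X Z p h + D Y Z p h" if "p \<in> W" "vector_field_on A W Z"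
    using C3[of W X Y Z p h] X Y that by blast
  show "D Z (\<lambda>q k. X q k + Y q k) p h = D Z X p h + D Z Y p h" if "p \<in> W" "vector_field_on A W Z"
    using C3[of W Z X Y p h] X Y that by blast
  show "D (\<lambda>q k. a q * X q k) Y p h = a p * D X Y p h" if "p \<in> W" "smooth_fun A W a"
    using C4[of W X Y a p h] X Y that by blast
  show "D X (\<lambda>q k. a q * Y q k) p h = X p a * Y p h + a p * D X Y p h" if "p \<in> W" "smooth_fun A W a"
    using C4[of W X Y a p h] X Y that by blast
  have "D X Y p h - D Y X p h = lie_bracket A X Y p h" if "p \<in> W" for h
    using conjunct1[OF conjunct2[OF L]] X Y that by blast
  then show "lie_bracket A X Y p = (\<lambda>h. D X Y p h - D Y X p h)" if "p \<in> W" using that by auto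
  show "X p (\<lambda>q. g q (Y q) (Z q)) = g p (D X Y p) (Z p) + g p (Y p) (D X Z p)"
    if "p \<in> W" "vector_field_on A W Z"
    using conjunct2[OF conjunct2[OF L]] X Y that by blast
qed

text \<open>Z is described on W only up to pointwise equality, which is how covariant derivatives
  become known below. Two terms cover all uses; a missing one is supplied with coefficient
  0.\<close>

lemma conn_lincomb_right:
  assumes X: "vector_field_on A W X" and Y: "vector_field_on A W Y1" "vector_field_on A W Y2"
    and a: "smooth_fun A W a" "smooth_fun A W b"
    and Z: "\<And>q k. q \<in> W \<Longrightarrow> Z q k = a q * Y1 q k + b q * Y2 q k" and p: "p \<in> W"
  shows "D X Z p h = X p a * Y1 p h + a p * D X Y1 p h + (X p b * Y2 p h + b p * D X Y2 p h)"
proof -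
  note Y' = vector_field_scale[OF Y(1) a(1)] vector_field_scale[OF Y(2) a(2)]
  have "D X Z p = D X (\<lambda>q k. a q * Y1 q k + b q * Y2 q k) p"
    by (rule conn_cong[OF X vector_field_add[OF Y'] p, symmetric]) (auto simp: Z)
  then show ?thesis
    using conn_add_right[OF Y' p X] conn_scale_right[OF X Y(1) p a(1)] conn_scale_right[OF X Y(2) p a(2)] by simp
qed

lemma conn_lincomb_left:
  assumes X: "vector_field_on A W X" and Y: "vector_field_on A W Y1" "vector_field_on A W Y2"
    and a: "smooth_fun A W a" "smooth_fun A W b"
    and Z: "\<And>q k. q \<in> W \<Longrightarrow> Z q k = a q * Y1 q k + b q * Y2 q k" and p: "p \<in> W"
  shows "D Z X p h = a p * D Y1 X p h + b p * D Y2 X p h"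
proof -
  note Y' = vector_field_scale[OF Y(1) a(1)] vector_field_scale[OF Y(2) a(2)]
  have "D Z X p = D (\<lambda>q k. a q * Y1 q k + b q * Y2 q k) X p"
    by (rule conn_cong[OF vector_field_add[OF Y'] X p, symmetric]) (auto simp: Z)
  then show ?thesis
    using conn_add_left[OF Y' p X] conn_scale_left[OF Y(1) X p a(1)] conn_scale_left[OF Y(2) X p a(2)] by simp
qed

lemma conn_zero_right:
  assumes X: "vector_field_on A W X" and Z: "\<And>q. q \<in> W \<Longrightarrow> Z q = (\<lambda>k. 0)" and p: "p \<in> W"
  shows "D X Z p h = 0"
  using conn_lincomb_right[OF X X X smooth_fun_const[of _ 0] smooth_fun_const[of _ 0] _ p, of Z h] Z
    tangent_const[OF vector_field_tangent[OF X p]] by simp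

lemma conn_zero_left:
  assumes X: "vector_field_on A W X" and Z: "\<And>q. q \<in> W \<Longrightarrow> Z q = (\<lambda>k. 0)" and p: "p \<in> W"
  shows "D Z X p h = 0"
  using conn_lincomb_left[OF X X X smooth_fun_const[of _ 0] smooth_fun_const[of _ 0] _ p, of Z h] Z by simp

text \<open>Metric compatibility is used for the three cyclic choices with signs +, +, -, and
  differences of covariant derivatives become brackets. The right side is free of the connection, so
  it determines \<open>D X Y\<close> through its pairings.\<close>

lemma koszul:
  assumes X: "vector_field_on A W X" and Y: "vector_field_on A W Y" and Z: "vector_field_on A W Z" and p: "p \<in> W"
  shows "2 * g p (D X Y p) (Z p) = X p (\<lambda>q. g q (Y q) (Z q)) + Y p (\<lambda>q. g q (X q) (Z q)) - Z p (\<lambda>q. g q (X q) (Y q))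
    + g p (lie_bracket A X Y p) (Z p) - g p (lie_bracket A X Z p) (Y p) - g p (lie_bracket A Y Z p) (X p)"
proof -
  have pc: "p \<in> carrier A" using vector_field_carrier[OF X] p by blast
  have T: "U p \<in> tangent_space A p" if "vector_field_on A W U" for U using vector_field_tangent[OF that p] .
  note c = conn_vector_field
  have b: "g p (lie_bracket A U V p) (R p) = g p (D U V p) (R p) - g p (D V U p) (R p)"
    if "vector_field_on A W U" "vector_field_on A W V" "vector_field_on A W R" for U V R
    unfolding torsion_free[OF that(1,2) p] by (intro metric_diff[OF pc] T c that)
  have s: "g p (U p) (D V R p) = g p (D V R p) (U p)"
    if "vector_field_on A W U" "vector_field_on A W V" "vector_field_on A W R" for U V R
    by (intro metric_sym[OF pc] T c that)
  show ?thesis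
    using metric_compat[OF X Y p Z] metric_compat[OF Y X p Z] metric_compat[OF Z X p Y]
      b[OF X Y Z] b[OF X Z Y] b[OF Y Z X] s[OF Y X Z] s[OF X Y Z] s[OF X Z Y]
    by simp
qed

section \<open>Tensoriality of the curvature\<close>

lemma curvature_vector_field:
  assumes "vector_field_on A W X" "vector_field_on A W Y" "vector_field_on A W Z"
  shows "vector_field_on A W (curvature A D X Y Z)"
  unfolding curvature_def by (intro vector_field_diff conn_vector_field vector_field_bracket assms)

lemma bracket_antisym:
  assumes X: "vector_field_on A W X" and Y: "vector_field_on A W Y" and p: "p \<in> W"
  shows "lie_bracket A Y X p h = - lie_bracket A X Y p h"
  using torsion_free[OF X Y p] torsion_free[OF Y X p] by simp

lemma curvature_antisym:
  assumes X: "vector_field_on A W X" and Y: "vector_field_on A W Y" and Z: "vector_field_on A W Z" and p: "p \<in> W"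
  shows "curvature A D Y X Z p h = - curvature A D X Y Z p h"
proof -
  note b = vector_field_bracket[OF X Y]
  have "D (lie_bracket A Y X) Z p h = - D (lie_bracket A X Y) Z p h"
    using conn_lincomb_left[OF Z b b smooth_fun_const[of _ "-1"] smooth_fun_const[of _ 0] _ p]
      bracket_antisym[OF X Y] by simp
  then show ?thesis unfolding curvature_def by simp
qed

lemma curvature_cong_left:
  assumes X: "vector_field_on A W X" and Y: "vector_field_on A W Y" and Z: "vector_field_on A W Z" and p: "p \<in> W"
    and eq: "\<And>q. q \<in> W \<Longrightarrow> X q = X' q"
  shows "curvature A D X Y Z p = curvature A D X' Y Z p"
proof -
  have X': "vector_field_on A W X'" by (rule vector_field_cong[OF X eq])
  note c = conn_vector_field
  have "lie_bracket A X Y q = lie_bracket A X' Y q" if q: "q \<in> W" for q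
  proof -
    have "D X Y q = D X' Y q" "D Y X q = D Y X' q"
      by (rule conn_cong[OF X Y q eq refl] conn_cong[OF Y X q refl eq]; assumption)+
    then show ?thesis unfolding torsion_free[OF X Y q] torsion_free[OF X' Y q] by simp
  qed
  then have "D (lie_bracket A X Y) Z p = D (lie_bracket A X' Y) Z p"
    by (rule conn_cong[OF vector_field_bracket[OF X Y] Z p _ refl])
  moreover have "D X (D Y Z) p = D X' (D Y Z) p"
    by (rule conn_cong[OF X c[OF Y Z] p eq refl])
  moreover have "D Y (D X Z) p = D Y (D X' Z) p"
    by (rule conn_cong[OF Y c[OF X Z] p refl conn_cong[OF X Z _ eq refl]])
  ultimately show ?thesis unfolding curvature_def by simp
qed

lemma curvature_add_left:
  assumes X: "vector_field_on A W X" and X': "vector_field_on A W X'"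
    and Y: "vector_field_on A W Y" and Z: "vector_field_on A W Z" and p: "p \<in> W"
  shows "curvature A D (\<lambda>q k. X q k + X' q k) Y Z p h = curvature A D X Y Z p h + curvature A D X' Y Z p h"
proof -
  let ?S = "\<lambda>q k. X q k + X' q k"
  note S = vector_field_add[OF X X'] and c = conn_vector_field and one = smooth_fun_const[of _ 1]
  note t = tangent_const[OF vector_field_tangent[OF Y p]]
  have "lie_bracket A ?S Y q k = lie_bracket A X Y q k + lie_bracket A X' Y q k" if q: "q \<in> W" for q k
    unfolding torsion_free[OF S Y q] torsion_free[OF X Y q] torsion_free[OF X' Y q]
      conn_add_left[OF X X' q Y] conn_add_right[OF X X' q Y] by simp
  then have "D (lie_bracket A ?S Y) Z p h = D (lie_bracket A X Y) Z p h + D (lie_bracket A X' Y) Z p h"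
    using conn_lincomb_left[OF Z vector_field_bracket[OF X Y] vector_field_bracket[OF X' Y] one one _ p] by simp
  moreover have "D Y (D ?S Z) p h = D Y (D X Z) p h + D Y (D X' Z) p h"
    using conn_lincomb_right[OF Y c[OF X Z] c[OF X' Z] one one _ p] conn_add_left[OF X X' _ Z] t by simp
  ultimately show ?thesis
    unfolding curvature_def using conn_add_left[OF X X' p c[OF Y Z]] by simp
qed

text \<open>The derivative of a enters twice: differentiating \<open>a q * D X Z q\<close> along Y
  produces Y(a) times \<open>D X Z\<close>, and the bracket of aX with Y contains - Y(a) X. The two
  contributions cancel.\<close>

lemma curvature_scale_left:
  assumes X: "vector_field_on A W X" and a: "smooth_fun A W a"
    and Y: "vector_field_on A W Y" and Z: "vector_field_on A W Z" and p: "p \<in> W"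
  shows "curvature A D (\<lambda>q k. a q * X q k) Y Z p h = a p * curvature A D X Y Z p h"
proof -
  let ?S = "\<lambda>q k. a q * X q k"
  note S = vector_field_scale[OF X a] and c = conn_vector_field and zero = smooth_fun_const[of _ 0]
  note t = tangent_const[OF vector_field_tangent[OF Y p]]
  have Ya: "smooth_fun A W (\<lambda>q. - Y q a)"
    using smooth_fun_diff[OF _ zero vector_field_smooth[OF Y _ subset_refl a]] vector_field_open[OF X] by simp
  have "lie_bracket A ?S Y q k = a q * lie_bracket A X Y q k + (- Y q a) * X q k" if q: "q \<in> W" for q k
    unfolding torsion_free[OF S Y q] torsion_free[OF X Y q]
      conn_scale_left[OF X Y q a] conn_scale_right[OF Y X q a] by (simp add: algebra_simps)
  then have "D (lie_bracket A ?S Y) Z p h = a p * D (lie_bracket A X Y) Z p h + (- Y p a) * D X Z p h"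
    by (rule conn_lincomb_left[OF Z vector_field_bracket[OF X Y] X a Ya _ p])
  moreover have "D Y (D ?S Z) p h = Y p a * D X Z p h + a p * D Y (D X Z) p h"
    using conn_lincomb_right[OF Y c[OF X Z] c[OF X Z] a zero _ p] conn_scale_left[OF X Z _ a] t by simp
  ultimately show ?thesis
    unfolding curvature_def using conn_scale_left[OF X c[OF Y Z] p a] by (simp add: algebra_simps)
qed

lemma curvature_cong_right:
  assumes X: "vector_field_on A W X" and Y: "vector_field_on A W Y" and Z: "vector_field_on A W Z" and p: "p \<in> W"
    and eq: "\<And>q. q \<in> W \<Longrightarrow> Z q = Z' q"
  shows "curvature A D X Y Z p = curvature A D X Y Z' p"
proof -
  note c = conn_vector_field
  have "D X (D Y Z) p = D X (D Y Z') p"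
    by (rule conn_cong[OF X c[OF Y Z] p refl conn_cong[OF Y Z _ refl eq]])
  moreover have "D Y (D X Z) p = D Y (D X Z') p"
    by (rule conn_cong[OF Y c[OF X Z] p refl conn_cong[OF X Z _ refl eq]])
  moreover have "D (lie_bracket A X Y) Z p = D (lie_bracket A X Y) Z' p"
    by (rule conn_cong[OF vector_field_bracket[OF X Y] Z p refl eq])
  ultimately show ?thesis unfolding curvature_def by simp
qed

lemma curvature_add_right:
  assumes X: "vector_field_on A W X" and Y: "vector_field_on A W Y"
    and Z: "vector_field_on A W Z" and Z': "vector_field_on A W Z'" and p: "p \<in> W"
  shows "curvature A D X Y (\<lambda>q k. Z q k + Z' q k) p h = curvature A D X Y Z p h + curvature A D X Y Z' p h"
proof -
  let ?S = "\<lambda>q k. Z q k + Z' q k"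
  note c = conn_vector_field and one = smooth_fun_const[of _ 1]
  have "D U (D V ?S) p h = D U (D V Z) p h + D U (D V Z') p h"
    if U: "vector_field_on A W U" and V: "vector_field_on A W V" for U V
    using conn_lincomb_right[OF U c[OF V Z] c[OF V Z'] one one _ p] conn_add_right[OF Z Z' _ V]
      tangent_const[OF vector_field_tangent[OF U p]] by simp
  then show ?thesis
    unfolding curvature_def using conn_add_right[OF Z Z' p vector_field_bracket[OF X Y]] X Y by simp
qed

text \<open>Terms with first derivatives of a are symmetric in X and Y; the second derivatives
  combine to \<open>lie_bracket A X Y p a\<close>, which the bracket term of the curvature
  removes.\<close>

lemma curvature_scale_right:
  assumes X: "vector_field_on A W X" and Y: "vector_field_on A W Y"
    and Z: "vector_field_on A W Z" and a: "smooth_fun A W a" and p: "p \<in> W"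
  shows "curvature A D X Y (\<lambda>q k. a q * Z q k) p h = a p * curvature A D X Y Z p h"
proof -
  let ?S = "\<lambda>q k. a q * Z q k"
  note c = conn_vector_field
  have oW: "open W" using vector_field_open[OF X] .
  have "D U (D V ?S) p h = U p (\<lambda>q. V q a) * Z p h + V p a * D U Z p h + (U p a * D V Z p h + a p * D U (D V Z) p h)"
    if U: "vector_field_on A W U" and V: "vector_field_on A W V" for U V
    by (rule conn_lincomb_right[OF U Z c[OF V Z] vector_field_smooth[OF V oW subset_refl a] a _ p])
      (rule conn_scale_right[OF V Z _ a])
  note D2 = this
  have br: "X p (\<lambda>q. Y q a) = lie_bracket A X Y p a + Y p (\<lambda>q. X q a)"
    using smooth_nearI[OF oW vector_field_carrier[OF X] a p] by (simp add: lie_bracket_def)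
  show ?thesis
    unfolding curvature_def conn_scale_right[OF vector_field_bracket[OF X Y] Z p a] D2[OF X Y] D2[OF Y X] br
    by (simp add: algebra_simps)
qed

lemma tensorialI:
  assumes "\<And>X Y. vector_field_on A W X \<Longrightarrow> vector_field_on A W Y \<Longrightarrow> \<Phi> (\<lambda>q h. X q h + Y q h) = \<Phi> X + \<Phi> Y"
    "\<And>a X. vector_field_on A W X \<Longrightarrow> smooth_fun A W a \<Longrightarrow> \<Phi> (\<lambda>q h. a q * X q h) = a p * \<Phi> X"
    "\<And>X Y. vector_field_on A W X \<Longrightarrow> (\<And>q. q \<in> W \<Longrightarrow> X q = Y q) \<Longrightarrow> \<Phi> X = \<Phi> Y"
  shows "tensorial W p \<Phi>"
  unfolding tensorial_def by (intro conjI allI impI assms) auto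

lemma tensorial_metric:
  assumes "p \<in> W" "W \<subseteq> carrier A" "u \<in> tangent_space A p"
  shows "tensorial W p (\<lambda>V. g p u (V p))"
proof -
  have pc: "p \<in> carrier A" using assms by blast
  have s: "g p u v = g p v u" if "v \<in> tangent_space A p" for v using metric_sym[OF pc assms(3) that] .
  note T = vector_field_tangent[OF _ assms(1)]
  show ?thesis
  proof (rule tensorialI)
    fix X Y and a :: "'m \<Rightarrow> real" assume X: "vector_field_on A W X"
    show "g p u (\<lambda>h. a p * X p h) = a p * g p u (X p)"
      using metric_scale[OF pc T[OF X] assms(3)] by (simp add: s tangent_space_scale T[OF X])
    show "g p u (X p) = g p u (Y p)" if "\<And>q. q \<in> W \<Longrightarrow> X q = Y q" using that[OF assms(1)] by simp
    assume Y: "vector_field_on A W Y"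
    show "g p u (\<lambda>h. X p h + Y p h) = g p u (X p) + g p u (Y p)"
      using metric_add[OF pc T[OF X] T[OF Y] assms(3)] by (simp add: s tangent_space_add T[OF X] T[OF Y])
  qed
qed

text \<open>Reduces tensoriality of a scalar expression to pointwise identities between the vectors
  \<open>\<Phi> X\<close>, the form in which the curvature and connection rules are
  available.\<close>

lemma tensorial_via_metric:
  assumes p: "p \<in> W" "W \<subseteq> carrier A" and V: "v \<in> tangent_space A p"
    and T: "\<And>X. vector_field_on A W X \<Longrightarrow> \<Phi> X \<in> tangent_space A p"
    and add: "\<And>X Y h. vector_field_on A W X \<Longrightarrow> vector_field_on A W Y \<Longrightarrow> \<Phi> (\<lambda>q k. X q k + Y q k) h = \<Phi> X h + \<Phi> Y h"
    and scale: "\<And>a X h. vector_field_on A W X \<Longrightarrow> smooth_fun A W a \<Longrightarrow> \<Phi> (\<lambda>q k. a q * X q k) h = a p * \<Phi> X h"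
    and cong: "\<And>X Y. vector_field_on A W X \<Longrightarrow> (\<And>q. q \<in> W \<Longrightarrow> X q = Y q) \<Longrightarrow> \<Phi> X = \<Phi> Y"
  shows "tensorial W p (\<lambda>X. g p (\<Phi> X) v)"
proof -
  have pc: "p \<in> carrier A" using p by blast
  show ?thesis
  proof (rule tensorialI)
    fix X Y and a :: "'m \<Rightarrow> real" assume X: "vector_field_on A W X"
    show "g p (\<Phi> X) v = g p (\<Phi> Y) v" if "\<And>q. q \<in> W \<Longrightarrow> X q = Y q" using cong[OF X that] by simp
    show "g p (\<Phi> (\<lambda>q h. a q * X q h)) v = a p * g p (\<Phi> X) v" if "smooth_fun A W a"
      unfolding ext[of "\<Phi> (\<lambda>q h. a q * X q h)", OF scale[OF X that]] by (rule metric_scale[OF pc T[OF X] V])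
    assume Y: "vector_field_on A W Y"
    show "g p (\<Phi> (\<lambda>q h. X q h + Y q h)) v = g p (\<Phi> X) v + g p (\<Phi> Y) v"
      unfolding ext[of "\<Phi> (\<lambda>q h. X q h + Y q h)", OF add[OF X Y]] by (rule metric_add[OF pc T[OF X] T[OF Y] V])
  qed
qed

lemma
  assumes X: "vector_field_on A W X" and Y: "vector_field_on A W Y" and p: "p \<in> W" and v: "v \<in> tangent_space A p"
  shows tensorial_curvature_left: "tensorial W p (\<lambda>Z. g p (curvature A D Z X Y p) v)"
    and tensorial_curvature_mid: "tensorial W p (\<lambda>Z. g p (curvature A D X Z Y p) v)"
    and tensorial_curvature_right: "tensorial W p (\<lambda>Z. g p (curvature A D X Y Z p) v)"
proof -
  note W = vector_field_carrier[OF X]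
  show "tensorial W p (\<lambda>Z. g p (curvature A D Z X Y p) v)"
    by (rule tensorial_via_metric[OF p W v])
      (rule vector_field_tangent[OF curvature_vector_field[OF _ X Y] p] curvature_add_left[OF _ _ X Y p]
        curvature_scale_left[OF _ _ X Y p] curvature_cong_left[OF _ X Y p]; assumption)+
  show "tensorial W p (\<lambda>Z. g p (curvature A D X Y Z p) v)"
    by (rule tensorial_via_metric[OF p W v])
      (rule vector_field_tangent[OF curvature_vector_field[OF X Y] p] curvature_add_right[OF X Y _ _ p]
        curvature_scale_right[OF X Y _ _ p] curvature_cong_right[OF X Y _ p]; assumption)+
  \<comment> \<open>Antisymmetry carries the second slot back to the first.\<close>
  have a: "curvature A D X Z Y p = (\<lambda>h. - curvature A D Z X Y p h)" if "vector_field_on A W Z" for Z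
    using curvature_antisym[OF that X Y p] by auto
  show "tensorial W p (\<lambda>Z. g p (curvature A D X Z Y p) v)"
  proof (rule tensorial_via_metric[OF p W v])
    fix Z Z' assume Z: "vector_field_on A W Z"
    show "curvature A D X Z Y p \<in> tangent_space A p"
      by (rule vector_field_tangent[OF curvature_vector_field[OF X Z Y] p])
    show "curvature A D X (\<lambda>q k. b q * Z q k) Y p h = b p * curvature A D X Z Y p h" if "smooth_fun A W b" for b h
      by (simp add: a vector_field_scale Z that curvature_scale_left[OF Z that X Y p])
    show "curvature A D X Z Y p = curvature A D X Z' Y p" if "\<And>q. q \<in> W \<Longrightarrow> Z q = Z' q"
      using a[OF Z] a[OF vector_field_cong[OF Z that]] curvature_cong_left[OF Z X Y p that] by simp
    assume Z': "vector_field_on A W Z'"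
    show "curvature A D X (\<lambda>q k. Z q k + Z' q k) Y p h = curvature A D X Z Y p h + curvature A D X Z' Y p h" for h
      by (simp add: a vector_field_add Z Z' curvature_add_left[OF Z Z' X Y p])
  qed
qed

section \<open>Frame independence of scalar curvature and divergence\<close>

lemma tensorial_sum_functionals:
  assumes "\<And>i. i \<in> I \<Longrightarrow> tensorial W p (\<Phi> i)"
  shows "tensorial W p (\<lambda>X. \<Sum>i\<in>I. \<Phi> i X / c i)"
proof (rule tensorialI)
  fix X Y and a :: "'m \<Rightarrow> real" assume X: "vector_field_on A W X"
  show "(\<Sum>i\<in>I. \<Phi> i X / c i) = (\<Sum>i\<in>I. \<Phi> i Y / c i)" if "\<And>q. q \<in> W \<Longrightarrow> X q = Y q"
    by (intro sum.cong refl arg_cong2[of _ _ _ _ "(/)"] tensorial_cong[OF assms X that])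
  show "(\<Sum>i\<in>I. \<Phi> i (\<lambda>q h. a q * X q h) / c i) = a p * (\<Sum>i\<in>I. \<Phi> i X / c i)" if "smooth_fun A W a"
    using tensorial_scale[OF assms X that] by (simp add: sum_distrib_left)
  assume Y: "vector_field_on A W Y"
  show "(\<Sum>i\<in>I. \<Phi> i (\<lambda>q h. X q h + Y q h) / c i) = (\<Sum>i\<in>I. \<Phi> i X / c i) + (\<Sum>i\<in>I. \<Phi> i Y / c i)"
    using tensorial_add[OF assms X Y] by (simp add: add_divide_distrib sum.distrib)
qed

text \<open>Trace independence is used twice. The inner trace changes frames while the outer fields
  are fixed; the outer form is then \<open>B'\<close>, the inner trace already written in e, which
  is tensorial as a sum of tensorial functionals.\<close>

lemma scalar_curvature_frame:
  assumes e: "orthogonal_frame W e" and p: "p \<in> W"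
  shows "scalar_curvature A g D p = (\<Sum>i<mdim A. \<Sum>j<mdim A.
    g p (curvature A D (e i) (e j) (e i) p) (e j p) / g p (e j p) (e j p) / g p (e i p) (e i p))"
proof -
  have pc: "p \<in> carrier A" using orthogonal_frame_carrier[OF e] p by blast
  let ?E = "frame_at A g p" and ?n = "mdim A"
  obtain V where V: "open V" "p \<in> V" and onV: "orthonormal_frame A g V ?E" using frame_at_orthonormal[OF pc] .
  let ?N = "V \<inter> W"
  have N: "open ?N" "p \<in> ?N" using V p orthogonal_frame_open[OF e] by auto
  have E: "orthogonal_frame ?N ?E" and e': "orthogonal_frame ?N e"
    using orthogonal_frame_subset[OF orthonormal_imp_orthogonal[OF onV] N(1)] orthogonal_frame_subset[OF e N(1)] by auto
  note Ef = orthogonal_frame_field[OF E] and ef = orthogonal_frame_field[OF e']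
  note sq = orthonormal_frame_mult[OF onV V(2)]
  \<comment> \<open>The curvature slots of the outer trace come first, so that \<open>B X Z\<close>
    is the bilinear form whose trace is taken inside.\<close>
  define B where "B X Z Y Y' = g p (curvature A D X Y Z p) (Y' p)" for X Y Z Y'
  define B' where "B' X Z = (\<Sum>j<?n. B X Z (e j) (e j) / g p (e j p) (e j p))" for X Z
  have B': "(\<Sum>k<?n. B X Z (?E k) (?E k) / g p (?E k p) (?E k p)) = B' X Z"
    if X: "vector_field_on A ?N X" and Z: "vector_field_on A ?N Z" for X Z
    unfolding B'_def
  proof (rule trace_independent_of_frame[where B = "B X Z", OF _ _ E e' N(2)])
    fix Y assume Y: "vector_field_on A ?N Y"
    show "tensorial ?N p (\<lambda>X'. B X Z X' Y)" "tensorial ?N p (B X Z Y)"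
      unfolding B_def
      by (rule tensorial_curvature_mid[OF X Z N(2) vector_field_tangent[OF Y N(2)]])
        (rule tensorial_metric[OF N(2) vector_field_carrier[OF X] vector_field_tangent[OF curvature_vector_field[OF X Y Z] N(2)]])
  qed
  have tr: "(\<Sum>k<?n. B' (?E k) (?E k) / g p (?E k p) (?E k p)) = (\<Sum>i<?n. B' (e i) (e i) / g p (e i p) (e i p))"
  proof (rule trace_independent_of_frame[where B = "B'", OF _ _ E e' N(2)])
    fix Y assume Y: "vector_field_on A ?N Y"
    show "tensorial ?N p (\<lambda>X. B' X Y)" unfolding B'_def B_def
      by (intro tensorial_sum_functionals tensorial_curvature_left Y N(2) vector_field_tangent[OF _ N(2)] ef) auto
    show "tensorial ?N p (B' Y)" unfolding B'_def B_def
      by (intro tensorial_sum_functionals tensorial_curvature_right Y N(2) vector_field_tangent[OF _ N(2)] ef) auto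
  qed
  have "scalar_curvature A g D p = (\<Sum>j<?n. g p (?E j p) (?E j p) * (\<Sum>k<?n. g p (?E k p) (?E k p) * B (?E j) (?E j) (?E k) (?E k)))"
    by (simp add: scalar_curvature_def ricci_def Let_def B_def)
  also have "\<dots> = (\<Sum>j<?n. (\<Sum>k<?n. B (?E j) (?E j) (?E k) (?E k) / g p (?E k p) (?E k p)) / g p (?E j p) (?E j p))"
  proof (rule sum.cong[OF refl])
    fix j assume "j \<in> {..<?n}"
    then have j: "g p (?E j p) (?E j p) * x = x / g p (?E j p) (?E j p)" for x using sq by simp
    have k: "g p (?E k p) (?E k p) * x = x / g p (?E k p) (?E k p)" if "k \<in> {..<?n}" for x k using sq that by simp
    show "g p (?E j p) (?E j p) * (\<Sum>k<?n. g p (?E k p) (?E k p) * B (?E j) (?E j) (?E k) (?E k))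
      = (\<Sum>k<?n. B (?E j) (?E j) (?E k) (?E k) / g p (?E k p) (?E k p)) / g p (?E j p) (?E j p)"
      unfolding j by (intro arg_cong2[of _ _ _ _ "(/)"] sum.cong refl k)
  qed
  also have "\<dots> = (\<Sum>j<?n. B' (?E j) (?E j) / g p (?E j p) (?E j p))"
    using B' Ef by simp
  finally show ?thesis using tr by (simp add: B'_def B_def sum_divide_distrib)
qed

lemma divergence_frame:
  assumes e: "orthogonal_frame W e" and p: "p \<in> W" and P: "vector_field_on A W P"
  shows "divergence A g D P p = (\<Sum>i<mdim A. g p (D (e i) P p) (e i p) / g p (e i p) (e i p))"
proof -
  have pc: "p \<in> carrier A" using orthogonal_frame_carrier[OF e] p by blast
  let ?E = "frame_at A g p" and ?n = "mdim A"
  obtain V where V: "open V" "p \<in> V" and onV: "orthonormal_frame A g V ?E" using frame_at_orthonormal[OF pc] .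
  let ?N = "V \<inter> W"
  have N: "open ?N" "p \<in> ?N" using V p orthogonal_frame_open[OF e] by auto
  have E: "orthogonal_frame ?N ?E" and e': "orthogonal_frame ?N e"
    using orthogonal_frame_subset[OF orthonormal_imp_orthogonal[OF onV] N(1)] orthogonal_frame_subset[OF e N(1)] by auto
  note sq = orthonormal_frame_mult[OF onV V(2)]
  have PN: "vector_field_on A ?N P" using vector_field_subset[OF P N(1)] by auto
  note NC = vector_field_carrier[OF PN]
  have "divergence A g D P p = (\<Sum>k<?n. g p (D (?E k) P p) (?E k p) / g p (?E k p) (?E k p))"
    unfolding divergence_def Let_def
  proof (rule sum.cong[OF refl])
    fix k assume "k \<in> {..<?n}"
    then show "g p (?E k p) (?E k p) * g p (D (?E k) P p) (?E k p) = g p (D (?E k) P p) (?E k p) / g p (?E k p) (?E k p)"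
      using sq by simp
  qed
  also have "\<dots> = (\<Sum>i<mdim A. g p (D (e i) P p) (e i p) / g p (e i p) (e i p))"
  proof (rule trace_independent_of_frame[where B = "\<lambda>X V. g p (D X P p) (V p)", OF _ _ E e' N(2)])
    fix Y assume Y: "vector_field_on A ?N Y"
    note Yp = vector_field_tangent[OF Y N(2)]
    show "tensorial ?N p (\<lambda>X. g p (D X P p) (Y p))"
      by (rule tensorial_via_metric[OF N(2) NC Yp])
        (rule vector_field_tangent[OF conn_vector_field[OF _ PN] N(2)] conn_add_left[OF _ _ N(2) PN]
          conn_scale_left[OF _ PN N(2)] conn_cong[OF _ PN N(2) _ refl]; assumption)+
    show "tensorial ?N p (\<lambda>V. g p (D Y P p) (V p))"
      by (rule tensorial_metric[OF N(2) NC vector_field_tangent[OF conn_vector_field[OF Y PN] N(2)]])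
  qed
  finally show ?thesis .
qed

section \<open>Quarter-symmetric connections\<close>

lemma quarter_symmetric_vector_field:
  assumes X: "vector_field_on A W X" and Y: "vector_field_on A W Y" and P: "vector_field_on A W P"
  shows "vector_field_on A W (quarter_symmetric g D P a b X Y)"
proof -
  note o = vector_field_open[OF X]
  show ?thesis unfolding quarter_symmetric_def
    by (intro vector_field_add vector_field_diff vector_field_scale conn_vector_field X Y P
        smooth_fun_mult[OF o] smooth_fun_const metric_smooth)
qed

lemma metric_lincomb:
  assumes pc: "p \<in> carrier A" and T: "u \<in> tangent_space A p" "x \<in> tangent_space A p" "y \<in> tangent_space A p"
      "v \<in> tangent_space A p"
  shows "g p (\<lambda>h. u h + a * x h - b * y h) v = g p u v + a * g p x v - b * g p y v"
  using metric_diff[OF pc tangent_space_add[OF T(1) tangent_space_scale[OF T(2)]] tangent_space_scale[OF T(3)] T(4)]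
    metric_add[OF pc T(1) tangent_space_scale[OF T(2)] T(4)] metric_scale[OF pc T(2,4)] metric_scale[OF pc T(3,4)]
  by simp

text \<open>Among the corrections to the Levi-Civita curvature, those with derivatives of Z are
  symmetric in X and Y and cancel, and those with \<open>D X Y\<close> and \<open>D Y X\<close> are
  absorbed by the bracket because D is torsion-free. Derivatives of P and terms quadratic in a and b
  remain.\<close>

lemma curvature_quarter_symmetric:
  assumes X: "vector_field_on A W X" and Y: "vector_field_on A W Y" and Z: "vector_field_on A W Z"
    and P: "vector_field_on A W P" and p: "p \<in> W"
  shows "curvature A (quarter_symmetric g D P a b) X Y Z p h = curvature A D X Y Z p h
      + a * (g p (D X P p) (Z p) * Y p h - g p (D Y P p) (Z p) * X p h)
      + b * (g p (X p) (Z p) * D Y P p h - g p (Y p) (Z p) * D X P p h)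
      + a * b * g p (P p) (P p) * (g p (X p) (Z p) * Y p h - g p (Y p) (Z p) * X p h)
      + b\<^sup>2 * (g p (Y p) (Z p) * g p (X p) (P p) - g p (X p) (Z p) * g p (Y p) (P p)) * P p h
      + a\<^sup>2 * g p (Z p) (P p) * (g p (Y p) (P p) * X p h - g p (X p) (P p) * Y p h)"
proof -
  let ?D = "quarter_symmetric g D P a b"
  have pc: "p \<in> carrier A" using vector_field_carrier[OF X] p by blast
  have T: "U p \<in> tangent_space A p" if "vector_field_on A W U" for U using vector_field_tangent[OF that p] .
  note c = conn_vector_field
  note o = vector_field_open[OF X]
  \<comment> \<open>The inner corrections are differentiated by the product rule and metric
    compatibility; \<open>DD\<close> then adds the outer corrections, in which \<open>?D V Z\<close>
    is paired with P and with U.\<close>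
  have D2: "D U (?D V Z) p h = D U (D V Z) p h
      + a * (g p (D U Z p) (P p) + g p (Z p) (D U P p)) * V p h + a * g p (Z p) (P p) * D U V p h
      - b * (g p (D U V p) (Z p) + g p (V p) (D U Z p)) * P p h - b * g p (V p) (Z p) * D U P p h"
    if U: "vector_field_on A W U" and V: "vector_field_on A W V" for U V
  proof -
    let ?Q = "\<lambda>q k. a * g q (Z q) (P q) * V q k + (- b * g q (V q) (Z q)) * P q k"
    have s: "smooth_fun A W (\<lambda>q. a * g q (Z q) (P q))" "smooth_fun A W (\<lambda>q. - b * g q (V q) (Z q))"
      by (intro smooth_fun_mult[OF o] smooth_fun_const metric_smooth Z P V)+
    have Q: "vector_field_on A W ?Q" by (intro vector_field_add vector_field_scale V P s)
    have m: "U p (\<lambda>q. r * g q (S q) (R q)) = r * (g p (D U S p) (R p) + g p (S p) (D U R p))"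
      if "vector_field_on A W S" "vector_field_on A W R" for r S R
      using tangent_cmult[OF T[OF U] smooth_nearI[OF o vector_field_carrier[OF U] metric_smooth[OF that] p]]
        metric_compat[OF U that(1) p that(2)] by simp
    have "D U (?D V Z) p h = D U (D V Z) p h + D U ?Q p h"
      using conn_lincomb_right[OF U c[OF V Z] Q smooth_fun_const[of _ 1] smooth_fun_const[of _ 1] _ p, of "?D V Z" h]
        tangent_const[OF T[OF U]] by (simp add: quarter_symmetric_def)
    also have "D U ?Q p h = U p (\<lambda>q. a * g q (Z q) (P q)) * V p h + a * g p (Z p) (P p) * D U V p h
        + (U p (\<lambda>q. - b * g q (V q) (Z q)) * P p h + (- b * g p (V p) (Z p)) * D U P p h)"
      by (rule conn_lincomb_right[OF U V P s _ p]) simp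
    finally show ?thesis unfolding m[OF Z P] m[OF V Z] by (simp add: algebra_simps)
  qed
  have DD: "?D U (?D V Z) p h = D U (?D V Z) p h
      + a * (g p (D V Z p) (P p) + a * g p (Z p) (P p) * g p (V p) (P p) - b * g p (V p) (Z p) * g p (P p) (P p)) * U p h
      - b * (g p (D V Z p) (U p) + a * g p (Z p) (P p) * g p (V p) (U p) - b * g p (V p) (Z p) * g p (P p) (U p)) * P p h"
    if U: "vector_field_on A W U" and V: "vector_field_on A W V" for U V
  proof -
    have Dp: "?D V Z p = (\<lambda>h. D V Z p h + a * g p (Z p) (P p) * V p h - b * g p (V p) (Z p) * P p h)"
      by (simp add: quarter_symmetric_def)
    have "?D V Z p \<in> tangent_space A p" by (rule T[OF quarter_symmetric_vector_field[OF V Z P]])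
    note s = metric_sym[OF pc T[OF U] this]
    have "?D U (?D V Z) p h = D U (?D V Z) p h + a * g p (?D V Z p) (P p) * U p h - b * g p (?D V Z p) (U p) * P p h"
      unfolding s[symmetric] by (simp add: quarter_symmetric_def)
    then show ?thesis
      unfolding Dp metric_lincomb[OF pc T[OF c[OF V Z]] T[OF V] T[OF P] T[OF P]]
        metric_lincomb[OF pc T[OF c[OF V Z]] T[OF V] T[OF P] T[OF U]] .
  qed
  have br: "lie_bracket A X Y p h = D X Y p h - D Y X p h" by (simp add: torsion_free[OF X Y p])
  have gbr: "g p (lie_bracket A X Y p) (Z p) = g p (D X Y p) (Z p) - g p (D Y X p) (Z p)"
    unfolding torsion_free[OF X Y p] by (intro metric_diff[OF pc] T c X Y Z)
  have S: "g p (V p) (D U R p) = g p (D U R p) (V p)"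
    if "vector_field_on A W U" "vector_field_on A W V" "vector_field_on A W R" for U V R
    by (intro metric_sym[OF pc] T c that)
  have S': "g p (U p) (V p) = g p (V p) (U p)" if "vector_field_on A W U" "vector_field_on A W V" for U V
    by (intro metric_sym[OF pc] T that)
  have "curvature A ?D X Y Z p h = ?D X (?D Y Z) p h - ?D Y (?D X Z) p h
     - (D (lie_bracket A X Y) Z p h + a * g p (Z p) (P p) * (D X Y p h - D Y X p h)
        - b * (g p (D X Y p) (Z p) - g p (D Y X p) (Z p)) * P p h)"
  proof -
    have "?D (lie_bracket A X Y) Z p h = D (lie_bracket A X Y) Z p h + a * g p (Z p) (P p) * lie_bracket A X Y p h
        - b * g p (lie_bracket A X Y p) (Z p) * P p h"
      by (simp add: quarter_symmetric_def)
    then show ?thesis unfolding curvature_def br gbr by simp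
  qed
  then show ?thesis
    unfolding DD[OF X Y] DD[OF Y X] D2[OF X Y] D2[OF Y X] curvature_def
      S[OF X Z P] S[OF Y Z P] S[OF X Y Z] S[OF Y X Z] S'[OF Y X] S'[OF P X] S'[OF P Y]
    by (simp add: algebra_simps power2_eq_square)
qed

text \<open>A pair of distinct frame indices j, k contributes a \<alpha>_j + b \<alpha>_k + a b
  \<pi> - b^2 \<beta>_k - a^2 \<beta>_j beyond the Levi-Civita curvature, a diagonal pair nothing.
  Each index has n - 1 partners; the \<alpha>_k add up to the divergence and, by Parseval's
  identity, the \<beta>_k to \<pi>.\<close>

lemma scalar_curvature_quarter_symmetric:
  assumes P: "vector_field_on A (carrier A) P" and pc: "p \<in> carrier A"
  defines "n \<equiv> real (mdim A)"
  shows "scalar_curvature A g (quarter_symmetric g D P a b) p = scalar_curvature A g D p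
    + (n - 1) * (a + b) * divergence A g D P p + (n - 1) * (n * a * b - a\<^sup>2 - b\<^sup>2) * g p (P p) (P p)"
proof -
  let ?E = "frame_at A g p" and ?n = "mdim A" and ?D = "quarter_symmetric g D P a b"
  obtain W where W: "open W" "p \<in> W" and on: "orthonormal_frame A g W ?E" using frame_at_orthonormal[OF pc] .
  note E = orthonormal_imp_orthogonal[OF on]
  note Ef = orthogonal_frame_field[OF E]
  have PW: "vector_field_on A W P" using vector_field_subset[OF P W(1) orthogonal_frame_carrier[OF E]] .
  have T: "U p \<in> tangent_space A p" if "vector_field_on A W U" for U using vector_field_tangent[OF that W(2)] .
  define \<epsilon> where "\<epsilon> k = g p (?E k p) (?E k p)" for k
  define \<alpha> where "\<alpha> k = \<epsilon> k * g p (D (?E k) P p) (?E k p)" for k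
  define \<beta> where "\<beta> k = \<epsilon> k * (g p (?E k p) (P p))\<^sup>2" for k
  define \<pi> where "\<pi> = g p (P p) (P p)"
  define \<delta> where "\<delta> j k = (if j = k then 1 else 0 :: real)" for j k :: nat
  have \<epsilon>: "\<epsilon> k * \<epsilon> k = 1" if "k < ?n" for k
    using orthonormal_frame_mult[OF on W(2) that, of "\<epsilon> k"] orthogonal_frame_nonnull[OF E W(2) that]
    by (simp add: \<epsilon>_def)
  have div: "(\<Sum>k<?n. \<alpha> k) = divergence A g D P p"
    by (simp add: divergence_def Let_def \<alpha>_def \<epsilon>_def)
  have \<beta>: "(\<Sum>k<?n. \<beta> k) = \<pi>"
    unfolding \<pi>_def orthogonal_frame_parseval[OF E W(2) T[OF PW] T[OF PW]]
  proof (rule sum.cong[OF refl])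
    fix k assume "k \<in> {..<?n}"
    then show "\<beta> k = g p (P p) (?E k p) * g p (P p) (?E k p) / g p (?E k p) (?E k p)"
      using orthonormal_frame_mult[OF on W(2), of k] metric_sym[OF pc T[OF PW] T[OF Ef], of k]
      by (simp add: \<beta>_def \<epsilon>_def power2_eq_square)
  qed
  have entry: "\<epsilon> j * \<epsilon> k * g p (curvature A ?D (?E j) (?E k) (?E j) p) (?E k p)
      = \<epsilon> j * \<epsilon> k * g p (curvature A D (?E j) (?E k) (?E j) p) (?E k p)
        + a * (\<alpha> j - \<delta> j k * \<alpha> j) + b * (\<alpha> k - \<delta> j k * \<alpha> k) + a * b * \<pi> * (1 - \<delta> j k)
        + b\<^sup>2 * (\<delta> j k * \<beta> j - \<beta> k) + a\<^sup>2 * (\<delta> j k * \<beta> j - \<beta> j)"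
    if j: "j < ?n" and k: "k < ?n" for j k
  proof -
    note Ej = Ef[OF j] and Ek = Ef[OF k]
    let ?r = "curvature A D (?E j) (?E k) (?E j) p" and ?G = "g p (?E j p) (?E k p)"
    \<comment> \<open>\<open>?x\<close>, \<open>?y\<close> and \<open>?z\<close> collect the
      coefficients of \<open>?E k\<close>, \<open>?E j\<close> and P, so that the pairing with
      \<open>?E k\<close> is read off by linearity.\<close>
    let ?x = "a * g p (D (?E j) P p) (?E j p) + a * b * \<pi> * \<epsilon> j - a\<^sup>2 * g p (?E j p) (P p) * g p (?E j p) (P p)"
    let ?y = "- a * g p (D (?E k) P p) (?E j p) - a * b * \<pi> * g p (?E k p) (?E j p)
        + a\<^sup>2 * g p (?E j p) (P p) * g p (?E k p) (P p)"
    let ?z = "b\<^sup>2 * (g p (?E k p) (?E j p) * g p (?E j p) (P p) - \<epsilon> j * g p (?E k p) (P p))"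
    have "curvature A ?D (?E j) (?E k) (?E j) p = (\<lambda>h. ((?r h + ?x * ?E k p h) + ?y * ?E j p h)
        + ((b * \<epsilon> j * D (?E k) P p h + (- b * g p (?E k p) (?E j p)) * D (?E j) P p h) + ?z * P p h))"
      by (rule ext, subst curvature_quarter_symmetric[OF Ej Ek Ej PW W(2)])
        (simp add: \<pi>_def \<epsilon>_def algebra_simps)
    moreover have "?r \<in> tangent_space A p" by (intro T curvature_vector_field Ej Ek)
    moreover note T[OF Ej] T[OF Ek] T[OF PW] T[OF conn_vector_field[OF Ej PW]] T[OF conn_vector_field[OF Ek PW]]
    ultimately have "g p (curvature A ?D (?E j) (?E k) (?E j) p) (?E k p)
      = ((g p ?r (?E k p) + ?x * \<epsilon> k) + ?y * ?G)
        + ((b * \<epsilon> j * g p (D (?E k) P p) (?E k p) + (- b * g p (?E k p) (?E j p)) * g p (D (?E j) P p) (?E k p))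
          + ?z * g p (P p) (?E k p))"
      by (simp only: metric_add[OF pc] metric_scale[OF pc] tangent_space_add tangent_space_scale \<epsilon>_def)
    moreover have "g p (P p) (?E k p) = g p (?E k p) (P p)" by (rule metric_sym[OF pc T[OF PW] T[OF Ek]])
    moreover have "?G = \<delta> j k * \<epsilon> j" "g p (?E k p) (?E j p) = \<delta> j k * \<epsilon> j"
      using orthogonal_frame_orthogonal[OF E W(2)] j k by (auto simp: \<delta>_def \<epsilon>_def)
    ultimately have eq: "g p (curvature A ?D (?E j) (?E k) (?E j) p) (?E k p)
      = g p ?r (?E k p) + (a * g p (D (?E j) P p) (?E j p) + a * b * \<pi> * \<epsilon> j
          - a\<^sup>2 * (g p (?E j p) (P p))\<^sup>2) * \<epsilon> k
        + \<epsilon> j * (b * g p (D (?E k) P p) (?E k p) - b\<^sup>2 * (g p (?E k p) (P p))\<^sup>2)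
        + \<delta> j k * \<epsilon> j * (b\<^sup>2 * (g p (?E j p) (P p)) * (g p (?E k p) (P p))
          + a\<^sup>2 * g p (?E j p) (P p) * g p (?E k p) (P p) - a * g p (D (?E k) P p) (?E j p)
          - a * b * \<pi> * \<delta> j k * \<epsilon> j - b * g p (D (?E j) P p) (?E k p))"
      by (simp add: power2_eq_square algebra_simps)
    show ?thesis
    proof (cases "j = k")
      case True
      then show ?thesis using eq by (simp add: \<delta>_def \<alpha>_def \<beta>_def algebra_simps power2_eq_square)
    next
      case False
      \<comment> \<open>The squares of \<open>\<epsilon> j\<close> and \<open>\<epsilon> k\<close>
        are kept as separate factors so that they can be rewritten to 1 afterwards. On the diagonal
        the corrections cancelled identically.\<close>
      have "\<epsilon> j * \<epsilon> k * g p (curvature A ?D (?E j) (?E k) (?E j) p) (?E k p)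
        = \<epsilon> j * \<epsilon> k * g p ?r (?E k p)
          + (\<epsilon> k * \<epsilon> k) * (\<epsilon> j * (a * g p (D (?E j) P p) (?E j p) - a\<^sup>2 * (g p (?E j p) (P p))\<^sup>2))
          + (\<epsilon> j * \<epsilon> j) * (\<epsilon> k * \<epsilon> k) * (a * b * \<pi>)
          + (\<epsilon> j * \<epsilon> j) * (\<epsilon> k * (b * g p (D (?E k) P p) (?E k p) - b\<^sup>2 * (g p (?E k p) (P p))\<^sup>2))"
        unfolding eq using False by (simp add: \<delta>_def algebra_simps)
      then show ?thesis
        unfolding \<epsilon>[OF j] \<epsilon>[OF k] using False by (simp add: \<delta>_def \<alpha>_def \<beta>_def algebra_simps)
    qed
  qed
  have "scalar_curvature A g ?D p = (\<Sum>j<?n. \<Sum>k<?n. \<epsilon> j * \<epsilon> k * g p (curvature A ?D (?E j) (?E k) (?E j) p) (?E k p))"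
    by (simp add: scalar_curvature_def ricci_def Let_def \<epsilon>_def sum_distrib_left mult.assoc)
  also have "\<dots> = (\<Sum>j<?n. \<Sum>k<?n. \<epsilon> j * \<epsilon> k * g p (curvature A D (?E j) (?E k) (?E j) p) (?E k p)
        + a * (\<alpha> j - \<delta> j k * \<alpha> j) + b * (\<alpha> k - \<delta> j k * \<alpha> k) + a * b * \<pi> * (1 - \<delta> j k)
        + b\<^sup>2 * (\<delta> j k * \<beta> j - \<beta> k) + a\<^sup>2 * (\<delta> j k * \<beta> j - \<beta> j))"
    using entry by simp
  also have "\<dots> = scalar_curvature A g D p + (\<Sum>j<?n. \<Sum>k<?n.
        a * (\<alpha> j - \<delta> j k * \<alpha> j) + b * (\<alpha> k - \<delta> j k * \<alpha> k) + a * b * \<pi> * (1 - \<delta> j k)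
        + b\<^sup>2 * (\<delta> j k * \<beta> j - \<beta> k) + a\<^sup>2 * (\<delta> j k * \<beta> j - \<beta> j))"
    by (simp add: scalar_curvature_def ricci_def Let_def \<epsilon>_def sum_distrib_left mult.assoc sum.distrib)
  also have "(\<Sum>j<?n. \<Sum>k<?n.
        a * (\<alpha> j - \<delta> j k * \<alpha> j) + b * (\<alpha> k - \<delta> j k * \<alpha> k) + a * b * \<pi> * (1 - \<delta> j k)
        + b\<^sup>2 * (\<delta> j k * \<beta> j - \<beta> k) + a\<^sup>2 * (\<delta> j k * \<beta> j - \<beta> j))
      = (\<Sum>j<?n. a * (n - 1) * \<alpha> j + b * ((\<Sum>k<?n. \<alpha> k) - \<alpha> j) + a * b * \<pi> * (n - 1)
        + b\<^sup>2 * (\<beta> j - (\<Sum>k<?n. \<beta> k)) + a\<^sup>2 * (1 - n) * \<beta> j)"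
  proof (rule sum.cong[OF refl])
    fix j assume "j \<in> {..<?n}"
    then have d: "(\<Sum>k<?n. \<delta> j k * f k) = f j" for f by (simp add: \<delta>_def if_distrib[of "\<lambda>x. x * _"] cong: if_cong)
    show "(\<Sum>k<?n. a * (\<alpha> j - \<delta> j k * \<alpha> j) + b * (\<alpha> k - \<delta> j k * \<alpha> k) + a * b * \<pi> * (1 - \<delta> j k)
        + b\<^sup>2 * (\<delta> j k * \<beta> j - \<beta> k) + a\<^sup>2 * (\<delta> j k * \<beta> j - \<beta> j))
      = a * (n - 1) * \<alpha> j + b * ((\<Sum>k<?n. \<alpha> k) - \<alpha> j) + a * b * \<pi> * (n - 1)
        + b\<^sup>2 * (\<beta> j - (\<Sum>k<?n. \<beta> k)) + a\<^sup>2 * (1 - n) * \<beta> j"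
      using d[of "\<lambda>_. 1"] d[of "\<lambda>_. \<alpha> j"] d[of \<alpha>] d[of "\<lambda>_. \<beta> j"]
      by (simp add: sum.distrib sum_subtractf flip: sum_distrib_left) (simp add: n_def algebra_simps)
  qed
  also have "\<dots> = a * (n - 1) * (\<Sum>k<?n. \<alpha> k) + b * (n - 1) * (\<Sum>k<?n. \<alpha> k) + a * b * \<pi> * (n - 1) * n
        + b\<^sup>2 * (1 - n) * (\<Sum>k<?n. \<beta> k) + a\<^sup>2 * (1 - n) * (\<Sum>k<?n. \<beta> k)"
    by (simp add: sum.distrib sum_subtractf flip: sum_distrib_left) (simp add: n_def algebra_simps)
  finally show ?thesis unfolding div \<beta> by (simp add: \<pi>_def algebra_simps)
qed

end

section \<open>The product of an interval and a manifold\<close>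

lemma sum_Basis_real_prod:
  fixes f :: "real \<times> 'e::euclidean_space \<Rightarrow> real"
  shows "sum f Basis = f (1, 0) + (\<Sum>b\<in>Basis. f (0, b))"
proof -
  have B: "Basis = insert (1 :: real, 0) (Pair 0 ` (Basis :: 'e set))" by (auto simp: Basis_prod_def)
  have "inj_on (Pair (0::real)) (Basis :: 'e set)" by (auto simp: inj_on_def)
  then have "sum f (Pair 0 ` Basis) = (\<Sum>b\<in>Basis. f (0, b))" by (simp add: sum.reindex)
  then show ?thesis unfolding B by (subst sum.insert) auto
qed

locale interval_product = F: manifold F
  for F :: "('m::{t2_space, second_countable_topology}, 'e::euclidean_space) chart set" +
  fixes I :: "real set"
  assumes open_I: "open I"
begin

abbreviation "M \<equiv> interval_prod I F"

lemma interval_prod_iff: "c \<in> M \<longleftrightarrow> (\<exists>U \<psi>. (U, \<psi>) \<in> F \<and> c = (I \<times> U, map_prod (\<lambda>t. t) \<psi>))"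
  unfolding interval_prod_def prod_atlas_def by auto

lemma interval_prod_chart: "(U, \<psi>) \<in> F \<Longrightarrow> (I \<times> U, map_prod (\<lambda>t. t) \<psi>) \<in> M"
  unfolding interval_prod_iff by blast

lemma carrier_interval_prod: "carrier M = I \<times> carrier F"
proof (intro equalityI subsetI)
  fix p assume "p \<in> carrier M"
  then obtain C \<rho> where "(C, \<rho>) \<in> M" "p \<in> C" unfolding carrier_def by auto
  then obtain U \<psi> where "(U, \<psi>) \<in> F" "p \<in> I \<times> U" unfolding interval_prod_iff by blast
  then show "p \<in> I \<times> carrier F" unfolding carrier_def by auto
next
  fix p assume "p \<in> I \<times> carrier F"
  then obtain U \<psi> where "(U, \<psi>) \<in> F" "p \<in> I \<times> U" unfolding carrier_def by auto
  then show "p \<in> carrier M" using interval_prod_chart unfolding carrier_def by fast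
qed

lemma mdim_interval_prod: "mdim M = Suc (mdim F)"
  by (simp add: mdim_def)

lemma interval_prod_inv:
  assumes "(U, \<psi>) \<in> F" "t \<in> I" "x \<in> U"
  shows "inv_into (I \<times> U) (map_prod (\<lambda>t. t) \<psi>) (t, \<psi> x) = (t, x)"
proof -
  have "inj_on \<psi> U" using F.chart_inv[OF assms(1)] by (metis inj_onI)
  then have "inj_on (map_prod (\<lambda>t. t) \<psi>) (I \<times> U)" by (auto simp: inj_on_def)
  then show ?thesis using inv_into_f_f[of "map_prod (\<lambda>t. t) \<psi>" "I \<times> U" "(t, x)"] assms by simp
qed

lemma interval_prod_inv':
  assumes "(U, \<psi>) \<in> F" "t \<in> I" "y \<in> \<psi> ` U"
  shows "inv_into (I \<times> U) (map_prod (\<lambda>t. t) \<psi>) (t, y) = (t, inv_into U \<psi> y)"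
  using assms interval_prod_inv[OF assms(1,2)] F.chart_inv[OF assms(1)] by auto

lemma image_interval_prod: "map_prod (\<lambda>t. t) \<psi> ` ((I \<times> U) \<inter> (I \<times> V)) = I \<times> \<psi> ` (U \<inter> V)"
  by force

lemma smooth_on_snd:
  fixes h :: "'e \<Rightarrow> 'c::real_normed_vector"
  assumes "open T" "smooth_on T h"
  shows "smooth_on (I \<times> T) (\<lambda>z. h (snd z))"
  by (rule smooth_on_compose[OF _ assms(1) _ smooth_on_bounded_linear[OF bounded_linear_snd] assms(2)])
    (auto intro: open_Times open_I assms(1))

lemma smooth_manifold_interval_prod: "smooth_manifold M"
  unfolding smooth_manifold_def
proof (intro conjI ballI; clarify)
  fix C \<rho> assume "(C, \<rho>) \<in> M"
  then obtain U \<psi> where c: "(U, \<psi>) \<in> F" and C: "C = I \<times> U" "\<rho> = map_prod (\<lambda>t. t) \<psi>"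
    unfolding interval_prod_iff by blast
  have o: "open U" "open (\<psi> ` U)" using F.chart_open[OF c] F.chart_image_open[OF c open_UNIV] by auto
  have im: "\<rho> ` C = I \<times> \<psi> ` U" unfolding C by force
  note hom = F.chart_homeomorphism[OF c, unfolded homeomorphism_def]
  have "continuous_on (I \<times> \<psi> ` U) (\<lambda>z. (fst z, inv_into U \<psi> (snd z)))"
    by (rule continuous_on_Pair[OF continuous_on_fst[OF continuous_on_id]
          continuous_on_compose2[OF _ continuous_on_snd[OF continuous_on_id], of "\<psi> ` U"]]) (use hom in auto)
  then have c1: "continuous_on (I \<times> \<psi> ` U) (inv_into C \<rho>)"
    by (rule continuous_on_eq) (use interval_prod_inv'[OF c] in \<open>auto simp: C\<close>)
  have "continuous_on C (\<lambda>z. (fst z, \<psi> (snd z)))"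
    unfolding C
    by (rule continuous_on_Pair[OF continuous_on_fst[OF continuous_on_id]
          continuous_on_compose2[OF _ continuous_on_snd[OF continuous_on_id], of U]]) (use hom in auto)
  then have c2: "continuous_on C \<rho>" by (rule continuous_on_eq) (auto simp: C)
  have inv: "inv_into C \<rho> (\<rho> z) = z" if "z \<in> C" for z
    using that interval_prod_inv[OF c] unfolding C by auto
  then have "homeomorphism C (\<rho> ` C) \<rho> (inv_into C \<rho>)"
    unfolding homeomorphism_def
  proof (intro conjI ballI)
    show "inv_into C \<rho> ` \<rho> ` C = C" unfolding image_image using inv by auto
    show "continuous_on (\<rho> ` C) (inv_into C \<rho>)" unfolding im by (rule c1)
    fix y assume "y \<in> \<rho> ` C"
    then show "\<rho> (inv_into C \<rho> y) = y" by (rule f_inv_into_f)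
  qed (simp_all add: inv c2)
  then show "open C \<and> open (\<rho> ` C) \<and> homeomorphism C (\<rho> ` C) \<rho> (inv_into C \<rho>)"
    unfolding im using o open_I by (auto simp: C intro: open_Times)
  fix C' \<rho>' assume "(C', \<rho>') \<in> M"
  then obtain V \<phi> where d: "(V, \<phi>) \<in> F" and C': "C' = I \<times> V" "\<rho>' = map_prod (\<lambda>t. t) \<phi>"
    unfolding interval_prod_iff by blast
  have oU: "open (\<psi> ` (U \<inter> V))" by (rule F.chart_image_open[OF c F.chart_open[OF d]])
  have oI: "open (I \<times> \<psi> ` (U \<inter> V))" by (intro open_Times open_I oU)
  have "smooth_on (I \<times> \<psi> ` (U \<inter> V)) (\<lambda>z. (fst z, \<phi> (inv_into U \<psi> (snd z))))"
    by (intro smooth_on_Pair smooth_on_bounded_linear[OF bounded_linear_fst] oI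
        smooth_on_snd[OF oU, of "\<lambda>y. \<phi> (inv_into U \<psi> y)"] F.chart_transition c d)
  then show "smooth_on (\<rho> ` (C \<inter> C')) (\<rho>' \<circ> inv_into C \<rho>)"
    unfolding C C' image_interval_prod
    by (rule smooth_on_cong[OF oI, rotated]) (use interval_prod_inv'[OF c] in auto)
qed

end

sublocale interval_product \<subseteq> M: manifold "interval_prod I F"
  by unfold_locales (rule smooth_manifold_interval_prod)

context interval_product
begin

lemma smooth_fun_snd:
  assumes "open W" "smooth_fun F W u"
  shows "smooth_fun M (I \<times> W) (\<lambda>p. u (snd p))"
proof (rule M.smooth_funI)
  fix C \<rho> assume "(C, \<rho>) \<in> M"
  then obtain U \<psi> where c: "(U, \<psi>) \<in> F" and C: "C = I \<times> U" "\<rho> = map_prod (\<lambda>t. t) \<psi>"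
    unfolding interval_prod_iff by blast
  have o: "open (\<psi> ` (U \<inter> W))" by (rule F.chart_image_open[OF c assms(1)])
  show "smooth_on (\<rho> ` (C \<inter> (I \<times> W))) (\<lambda>z. u (snd (inv_into C \<rho> z)))"
    unfolding C image_interval_prod
    by (rule smooth_on_cong[OF open_Times[OF open_I o] _ smooth_on_snd[OF o F.smooth_funD[OF assms(2) c]]])
      (use interval_prod_inv'[OF c] in auto)
qed

lemma smooth_fun_fst:
  assumes "open W" "smooth_on I k"
  shows "smooth_fun M (I \<times> W) (\<lambda>p. k (fst p))"
proof (rule M.smooth_funI)
  fix C \<rho> assume "(C, \<rho>) \<in> M"
  then obtain U \<psi> where c: "(U, \<psi>) \<in> F" and C: "C = I \<times> U" "\<rho> = map_prod (\<lambda>t. t) \<psi>"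
    unfolding interval_prod_iff by blast
  have o: "open (I \<times> \<psi> ` (U \<inter> W))" by (intro open_Times open_I F.chart_image_open[OF c assms(1)])
  have "smooth_on (I \<times> \<psi> ` (U \<inter> W)) (\<lambda>z. k (fst z))"
    by (rule smooth_on_compose[OF o open_I _ smooth_on_bounded_linear[OF bounded_linear_fst o] assms(2)]) auto
  then show "smooth_on (\<rho> ` (C \<inter> (I \<times> W))) (\<lambda>z. k (fst (inv_into C \<rho> z)))"
    unfolding C image_interval_prod
    by (rule smooth_on_cong[OF o, rotated]) (use interval_prod_inv'[OF c] in auto)
qed

lemma smooth_fun_slice:
  assumes "open V" "smooth_fun M V h" "t \<in> I"
  shows "smooth_fun F {x. (t, x) \<in> V} (\<lambda>x. h (t, x))"
proof (rule F.smooth_funI)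
  fix U \<psi> assume c: "(U, \<psi>) \<in> F"
  let ?C = "I \<times> U" and ?\<rho> = "map_prod (\<lambda>t. t) \<psi>"
  have oV: "open {x. (t, x) \<in> V}"
    using open_vimage[OF assms(1), of "Pair t"] by (simp add: vimage_def continuous_on_Pair)
  note o = F.chart_image_open[OF c oV] and o' = M.chart_image_open[OF interval_prod_chart[OF c] assms(1)]
  have "smooth_on (\<psi> ` (U \<inter> {x. (t, x) \<in> V})) (\<lambda>y. h (inv_into ?C ?\<rho> (t, y)))"
  proof (rule smooth_on_compose[OF o o' _ _ M.smooth_funD[OF assms(2) interval_prod_chart[OF c]]])
    show "smooth_on (\<psi> ` (U \<inter> {x. (t, x) \<in> V})) (Pair t)"
      by (intro smooth_on_Pair[OF o] smooth_on_const smooth_on_bounded_linear[OF bounded_linear_ident o])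
    show "Pair t ` \<psi> ` (U \<inter> {x. (t, x) \<in> V}) \<subseteq> ?\<rho> ` (?C \<inter> V)" using assms(3) by force
  qed
  then show "smooth_on (\<psi> ` (U \<inter> {x. (t, x) \<in> V})) (\<lambda>y. h (t, inv_into U \<psi> y))"
    by (rule smooth_on_cong[OF o, rotated]) (use interval_prod_inv'[OF c assms(3)] in auto)
qed

lemma smooth_near_slice:
  assumes "smooth_near M (t, x) h"
  shows "smooth_near F x (\<lambda>y. h (t, y))"
proof -
  obtain V where V: "open V" "(t, x) \<in> V" "V \<subseteq> carrier M" "smooth_fun M V h"
    using assms unfolding smooth_near_def by auto
  have t: "t \<in> I" using V carrier_interval_prod by auto
  have oV: "open {x. (t, x) \<in> V}"
    using open_vimage[OF V(1), of "Pair t"] by (simp add: vimage_def continuous_on_Pair)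
  show ?thesis
    by (rule F.smooth_nearI[OF oV _ smooth_fun_slice[OF V(1,4) t]]) (use V carrier_interval_prod in auto)
qed

lemma smooth_near_snd:
  assumes "t \<in> I" "smooth_near F x u"
  shows "smooth_near M (t, x) (\<lambda>p. u (snd p))"
proof -
  obtain W where W: "open W" "x \<in> W" "W \<subseteq> carrier F" "smooth_fun F W u"
    using assms(2) unfolding smooth_near_def by auto
  show ?thesis
    by (rule M.smooth_nearI[OF open_Times[OF open_I W(1)] _ smooth_fun_snd[OF W(1,4)]])
      (use W(2,3) assms(1) carrier_interval_prod in auto)
qed

text \<open>The converse matters because tangent vectors must vanish on functions that are not
  smooth near the point: a projected vector inherits this only if pulling back creates no
  smoothness.\<close>

lemma smooth_near_snd_iff: "t \<in> I \<Longrightarrow> smooth_near M (t, x) (\<lambda>p. u (snd p)) \<longleftrightarrow> smooth_near F x u"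
  using smooth_near_snd smooth_near_slice[of t x "\<lambda>p. u (snd p)"] by auto

lemma smooth_near_fst:
  assumes "t \<in> I" "x \<in> carrier F" "smooth_on I k"
  shows "smooth_near M (t, x) (\<lambda>p. k (fst p))"
  by (rule M.smooth_nearI[OF M.open_carrier subset_refl])
    (use smooth_fun_fst[OF F.open_carrier assms(3)] assms(1,2) carrier_interval_prod in auto)

lemma smooth_near_fst_id: "t \<in> I \<Longrightarrow> x \<in> carrier F \<Longrightarrow> smooth_near M (t, x) fst"
  using smooth_near_fst[of t x "\<lambda>s. s"] smooth_on_bounded_linear[OF bounded_linear_ident open_I] by simp

section \<open>Tangent vectors of the product\<close>

definition dproj :: "(real \<times> 'm) tvec \<Rightarrow> 'm tvec" where
  "dproj u = (\<lambda>h. u (h \<circ> snd))"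

text \<open>The differential of the inclusion of the fibre over t; \<open>lift_field\<close> applies
  it point by point.\<close>

definition lift_vec :: "real \<Rightarrow> 'm \<Rightarrow> 'm tvec \<Rightarrow> (real \<times> 'm) tvec" where
  "lift_vec t x u = (\<lambda>h. if smooth_near M (t, x) h then u (\<lambda>y. h (t, y)) else 0)"

text \<open>The field of the interval coordinate, defined without charts and hence globally. In
  every product chart it is the coordinate field of (1, 0), whence its smoothness.\<close>

definition dt_field :: "(real \<times> 'm) vfield" where
  "dt_field = (\<lambda>(t, x) h. if smooth_near M (t, x) h then deriv (\<lambda>s. h (s, x)) t else 0)"

abbreviation lift where "lift \<equiv> lift_field I F"

lemma lift_eq: "lift X (t, x) = lift_vec t x (X x)"
  by (simp add: lift_field_def lift_vec_def)

lemma dproj_tangent: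
  assumes t: "t \<in> I" and u: "u \<in> tangent_space M (t, x)"
  shows "dproj u \<in> tangent_space F x"
  unfolding dproj_def comp_def
proof (rule F.tangent_spaceI)
  note near = smooth_near_snd[OF t]
  fix h k
  show "u (\<lambda>p. h (snd p)) = 0" if "\<not> smooth_near F x h"
    using M.tangent_not_near[OF u] that smooth_near_snd_iff[OF t] by blast
  assume h: "smooth_near F x h"
  show "u (\<lambda>p. h (snd p)) = u (\<lambda>p. k (snd p))" if "open W" "x \<in> W" "\<And>q. q \<in> W \<Longrightarrow> h q = k q" for W
    by (rule M.tangent_germ[OF u near[OF h] open_Times[OF open_I that(1)]]) (use t that in auto)
  show "u (\<lambda>p. a * h (snd p)) = a * u (\<lambda>p. h (snd p))" for a
    by (rule M.tangent_cmult[OF u near[OF h]])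
  assume k: "smooth_near F x k"
  show "u (\<lambda>p. h (snd p) + k (snd p)) = u (\<lambda>p. h (snd p)) + u (\<lambda>p. k (snd p))"
    by (rule M.tangent_add[OF u near[OF h] near[OF k]])
  show "u (\<lambda>p. h (snd p) * k (snd p)) = u (\<lambda>p. h (snd p)) * k x + h x * u (\<lambda>p. k (snd p))"
    using M.tangent_mult[OF u near[OF h] near[OF k]] by simp
qed

context
  fixes U \<psi> t x
  assumes c: "(U, \<psi>) \<in> F" and t: "t \<in> I" and x: "x \<in> U"
begin

private abbreviation "prod_coord \<equiv> M.coord_field (I \<times> U) (map_prod (\<lambda>t. t) \<psi>)"

lemma dt_field_coord: "dt_field (t, x) = prod_coord (1, 0) (t, x)"
proof
  fix h
  show "dt_field (t, x) h = prod_coord (1, 0) (t, x) h"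
  proof (cases "smooth_near M (t, x) h")
    case True
    let ?G = "\<lambda>z. h (inv_into (I \<times> U) (map_prod (\<lambda>t. t) \<psi>) z)"
    have D: "(?G has_derivative frechet_derivative ?G (at (t, \<psi> x))) (at (t, \<psi> x))"
      using M.chart_has_derivative[OF interval_prod_chart[OF c] _ True] t x by auto
    have "((\<lambda>s. ?G (s, \<psi> x)) has_derivative (\<lambda>r. frechet_derivative ?G (at (t, \<psi> x)) (r, 0))) (at t)"
      by (rule has_derivative_compose[where g = ?G and f = "\<lambda>s. (s, \<psi> x)", OF _ D]) (auto intro!: derivative_eq_intros)
    then have 1: "((\<lambda>s. h (s, x)) has_derivative (\<lambda>r. frechet_derivative ?G (at (t, \<psi> x)) (r, 0))) (at t)"
      by (rule has_derivative_transform_within_open[OF _ open_I t]) (use interval_prod_inv[OF c _ x] in auto)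
    have 2: "(\<lambda>r. frechet_derivative ?G (at (t, \<psi> x)) (r, 0)) = (*) (frechet_derivative ?G (at (t, \<psi> x)) (1, 0))"
    proof
      fix r show "frechet_derivative ?G (at (t, \<psi> x)) (r, 0) = frechet_derivative ?G (at (t, \<psi> x)) (1, 0) * r"
        using linear_scale[OF has_derivative_linear[OF D], of r "(1, 0)"] by (simp add: mult.commute[of r])
    qed
    have "((\<lambda>s. h (s, x)) has_real_derivative frechet_derivative ?G (at (t, \<psi> x)) (1, 0)) (at t)"
      using 1 unfolding 2 has_field_derivative_def .
    then show ?thesis using True by (simp add: dt_field_def M.coord_field_def DERIV_imp_deriv)
  qed (simp add: dt_field_def M.coord_field_def)
qed

text \<open>The slice of h over t is expanded in a chart of F, and the chain rule identifies each
  coordinate derivative of the slice with a derivative of h in a fibre direction of the product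
  chart.\<close>

lemma lift_vec_coord:
  assumes u: "u \<in> tangent_space F x"
  shows "lift_vec t x u = (\<lambda>h. \<Sum>b\<in>Basis. u (\<lambda>q. \<psi> q \<bullet> b) * prod_coord (0, b) (t, x) h)"
proof
  fix h
  show "lift_vec t x u h = (\<Sum>b\<in>Basis. u (\<lambda>q. \<psi> q \<bullet> b) * prod_coord (0, b) (t, x) h)"
  proof (cases "smooth_near M (t, x) h")
    case True
    let ?G = "\<lambda>z. h (inv_into (I \<times> U) (map_prod (\<lambda>t. t) \<psi>) z)"
    have D: "(?G has_derivative frechet_derivative ?G (at (t, \<psi> x))) (at (t, \<psi> x))"
      using M.chart_has_derivative[OF interval_prod_chart[OF c] _ True] t x by auto
    have o: "open (\<psi> ` U)" using F.chart_image_open[OF c open_UNIV] by simp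
    have "((\<lambda>y. ?G (t, y)) has_derivative (\<lambda>r. frechet_derivative ?G (at (t, \<psi> x)) (0, r))) (at (\<psi> x))"
      by (rule has_derivative_compose[where g = ?G and f = "\<lambda>y. (t, y)", OF _ D]) (auto intro!: derivative_eq_intros)
    then have "((\<lambda>y. h (t, inv_into U \<psi> y)) has_derivative (\<lambda>r. frechet_derivative ?G (at (t, \<psi> x)) (0, r))) (at (\<psi> x))"
      by (rule has_derivative_transform_within_open[OF _ o]) (use x interval_prod_inv'[OF c t] in auto)
    from frechet_derivative_at[OF this] have "F.coord_field U \<psi> b x (\<lambda>y. h (t, y)) = prod_coord (0, b) (t, x) h" for b
      using True smooth_near_slice[OF True] by (simp add: F.coord_field_def M.coord_field_def fun_eq_iff)
    then show ?thesis
      using True fun_cong[OF F.tangent_expand[OF c x u], of "\<lambda>y. h (t, y)"] by (simp add: lift_vec_def)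
  qed (simp add: lift_vec_def M.coord_field_def)
qed

lemma dt_field_tangent: "dt_field (t, x) \<in> tangent_space M (t, x)"
  unfolding dt_field_coord by (rule M.coord_field_tangent[OF interval_prod_chart[OF c]]) (use t x in auto)

lemma lift_vec_tangent:
  assumes u: "u \<in> tangent_space F x"
  shows "lift_vec t x u \<in> tangent_space M (t, x)"
  unfolding lift_vec_coord[OF u]
  by (intro M.tangent_space_sum M.tangent_space_scale M.coord_field_tangent[OF interval_prod_chart[OF c]])
    (use t x in auto)

lemma tangent_decompose:
  assumes v: "v \<in> tangent_space M (t, x)"
  shows "v = (\<lambda>h. v fst * dt_field (t, x) h + lift_vec t x (dproj v) h)"
proof
  fix h
  note T = dproj_tangent[OF t v]
  have "v h = (\<Sum>b\<in>Basis. v (\<lambda>q. map_prod (\<lambda>t. t) \<psi> q \<bullet> b) * prod_coord b (t, x) h)"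
    by (rule fun_cong[OF M.tangent_expand[OF interval_prod_chart[OF c] _ v]]) (use t x in auto)
  also have "\<dots> = v fst * prod_coord (1, 0) (t, x) h + (\<Sum>b\<in>Basis. v (\<lambda>q. \<psi> (snd q) \<bullet> b) * prod_coord (0, b) (t, x) h)"
    by (subst sum_Basis_real_prod) (simp add: inner_prod_def)
  also have "\<dots> = v fst * dt_field (t, x) h + lift_vec t x (dproj v) h"
    unfolding dt_field_coord lift_vec_coord[OF T] by (simp add: dproj_def comp_def)
  finally show "v h = v fst * dt_field (t, x) h + lift_vec t x (dproj v) h" .
qed

end

lemma
  assumes t: "t \<in> I" and x: "x \<in> carrier F"
  shows dt_tangent: "dt_field (t, x) \<in> tangent_space M (t, x)"
    and lift_tangent: "u \<in> tangent_space F x \<Longrightarrow> lift_vec t x u \<in> tangent_space M (t, x)"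
    and decompose: "v \<in> tangent_space M (t, x) \<Longrightarrow> v = (\<lambda>h. v fst * dt_field (t, x) h + lift_vec t x (dproj v) h)"
proof -
  obtain U \<psi> where c: "(U, \<psi>) \<in> F" "x \<in> U" using F.carrierE[OF x] .
  show "dt_field (t, x) \<in> tangent_space M (t, x)" by (rule dt_field_tangent[OF c(1) t c(2)])
  show "lift_vec t x u \<in> tangent_space M (t, x)" if "u \<in> tangent_space F x" by (rule lift_vec_tangent[OF c(1) t c(2) that])
  show "v = (\<lambda>h. v fst * dt_field (t, x) h + lift_vec t x (dproj v) h)" if "v \<in> tangent_space M (t, x)"
    by (rule tangent_decompose[OF c(1) t c(2) that])
qed

text \<open>The decomposition shows that \<open>fst\<close> and the functions pulled back from the
  fibre separate tangent vectors; brackets and covariant derivatives are compared on these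
  alone.\<close>

lemma tangent_product_eqI:
  assumes t: "t \<in> I" and x: "x \<in> carrier F"
    and v: "v \<in> tangent_space M (t, x)" and w: "w \<in> tangent_space M (t, x)"
    and "v fst = w fst" "dproj v = dproj w"
  shows "v = w"
  by (subst decompose[OF t x v], subst decompose[OF t x w]) (simp add: assms(5,6))

lemma lift_vec_fst: "v \<in> tangent_space F x \<Longrightarrow> lift_vec t x v (\<lambda>p. k (fst p)) = 0"
  unfolding lift_vec_def using F.tangent_const by simp

lemma lift_vec_fst_id: "v \<in> tangent_space F x \<Longrightarrow> lift_vec t x v fst = 0"
  unfolding lift_vec_def using F.tangent_const by simp

lemma lift_vec_snd:
  assumes "t \<in> I" "v \<in> tangent_space F x"
  shows "lift_vec t x v (\<lambda>p. u (snd p)) = v u"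
  unfolding lift_vec_def smooth_near_snd_iff[OF assms(1)] using F.tangent_not_near[OF assms(2)] by simp

lemma dproj_lift: "t \<in> I \<Longrightarrow> v \<in> tangent_space F x \<Longrightarrow> dproj (lift_vec t x v) = v"
  unfolding dproj_def comp_def using lift_vec_snd by blast

lemma dt_field_fst:
  assumes "t \<in> I" "x \<in> carrier F" "smooth_on I k"
  shows "dt_field (t, x) (\<lambda>p. k (fst p)) = deriv k t"
  using smooth_near_fst[OF assms] by (simp add: dt_field_def)

lemma dt_field_fst_id: "t \<in> I \<Longrightarrow> x \<in> carrier F \<Longrightarrow> dt_field (t, x) fst = 1"
  using smooth_near_fst_id by (simp add: dt_field_def)

lemma dt_field_snd: "dt_field (t, x) (\<lambda>p. u (snd p)) = 0"
  by (simp add: dt_field_def)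

lemma dproj_dt: "dproj (dt_field (t, x)) = (\<lambda>h. 0)"
  unfolding dproj_def comp_def using dt_field_snd by blast

section \<open>Lifted fields, separated functions and brackets\<close>

lemma vector_field_dt: "vector_field_on M (carrier M) dt_field"
proof (rule M.vector_field_local)
  fix p assume "p \<in> carrier M"
  then obtain t x where p: "p = (t, x)" "t \<in> I" "x \<in> carrier F" unfolding carrier_interval_prod by auto
  then obtain U \<psi> where c: "(U, \<psi>) \<in> F" "x \<in> U" using F.carrierE by blast
  have "vector_field_on M (I \<times> U) dt_field"
    by (rule M.vector_field_cong[OF M.vector_field_coord[OF interval_prod_chart[OF c(1)], of "(1, 0)"]])
      (use dt_field_coord[OF c(1)] in auto)
  from this M.vector_field_carrier[OF this] show "\<exists>V. p \<in> V \<and> V \<subseteq> carrier M \<and> vector_field_on M V dt_field"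
    using p c(2) by (intro exI[of _ "I \<times> U"]) auto
qed

text \<open>Locally a lift is a combination of product coordinate fields whose coefficients are
  pulled back from the fibre, and pullbacks are smooth.\<close>

lemma vector_field_lift:
  assumes X: "vector_field_on F W X"
  shows "vector_field_on M (I \<times> W) (lift X)"
proof (rule M.vector_field_local)
  note oW = F.vector_field_open[OF X]
  fix p assume "p \<in> I \<times> W"
  then obtain t x where p: "p = (t, x)" "t \<in> I" "x \<in> W" by auto
  then obtain U \<psi> where c: "(U, \<psi>) \<in> F" "x \<in> U" using F.carrierE F.vector_field_carrier[OF X] by blast
  let ?N = "I \<times> (W \<inter> U)"
  have oN: "open ?N" "open (W \<inter> U)" using oW F.chart_open[OF c(1)] open_I by (auto intro: open_Times)
  have "vector_field_on M ?N (\<lambda>p h. \<Sum>b\<in>Basis. X (snd p) (\<lambda>q. \<psi> q \<bullet> b) * M.coord_field (I \<times> U) (map_prod (\<lambda>t. t) \<psi>) (0, b) p h)"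
  proof (rule M.vector_field_sum[OF finite_Basis oN(1)], goal_cases)
    case 1
    show ?case using F.chart_subset_carrier[OF c(1)] carrier_interval_prod by auto
  next
    case (2 b)
    have "smooth_fun F (W \<inter> U) (\<lambda>x. X x (\<lambda>q. \<psi> q \<bullet> b))"
      by (rule F.vector_field_smooth[OF X oN(2) _ F.smooth_fun_coordinate[OF c(1) _ oN(2)]]) auto
    from smooth_fun_snd[OF oN(2) this] show ?case
      by (rule M.vector_field_scale[OF M.vector_field_subset[OF M.vector_field_coord[OF interval_prod_chart[OF c(1)]] oN(1)], rotated]) auto
  qed
  then have "vector_field_on M ?N (lift X)"
    by (rule M.vector_field_cong)
      (auto simp: lift_eq lift_vec_coord[OF c(1)] F.vector_field_tangent[OF X])
  then show "\<exists>V. p \<in> V \<and> V \<subseteq> I \<times> W \<and> vector_field_on M V (lift X)"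
    using p c(2) by (intro exI[of _ ?N]) auto
qed

lemma vector_field_dt_on: "open W \<Longrightarrow> W \<subseteq> carrier F \<Longrightarrow> vector_field_on M (I \<times> W) dt_field"
  by (rule M.vector_field_subset[OF vector_field_dt]) (auto intro: open_Times open_I simp: carrier_interval_prod)

text \<open>Lifted vectors annihilate functions of t and the interval field annihilates functions of
  x, so Leibniz' rule touches one factor only. The metric products of lifted fields are of this
  separated form.\<close>

lemma
  assumes t: "t \<in> I" and x: "x \<in> W" and W: "open W" "W \<subseteq> carrier F" and k: "smooth_on I k"
    and u: "smooth_fun F W u" and h: "\<And>s y. s \<in> I \<Longrightarrow> y \<in> W \<Longrightarrow> h (s, y) = k s * u y"
  shows lift_separated: "v \<in> tangent_space F x \<Longrightarrow> lift_vec t x v h = k t * v u"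
    and dt_separated: "dt_field (t, x) h = deriv k t * u x"
proof -
  have xc: "x \<in> carrier F" using x W by auto
  note nk = smooth_near_fst[OF t xc k] and nu = smooth_near_snd[OF t F.smooth_nearI[OF W u x]]
  note n = M.smooth_near_mult[OF nk nu]
  have o: "open (I \<times> W)" "(t, x) \<in> I \<times> W" using open_I W t x by (auto intro: open_Times)
  have g: "v h = v (\<lambda>p. k (fst p) * u (snd p))" if "v \<in> tangent_space M (t, x)" for v
    by (rule M.tangent_germ[OF that n o, symmetric]) (use h in auto)
  show "lift_vec t x v h = k t * v u" if v: "v \<in> tangent_space F x"
    unfolding g[OF lift_tangent[OF t xc v]] M.tangent_mult[OF lift_tangent[OF t xc v] nk nu]
    by (simp add: lift_vec_fst[OF v] lift_vec_snd[OF t v])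
  show "dt_field (t, x) h = deriv k t * u x"
    unfolding g[OF dt_tangent[OF t xc]] M.tangent_mult[OF dt_tangent[OF t xc] nk nu]
    by (simp add: dt_field_fst[OF t xc k] dt_field_snd)
qed

text \<open>Tests on \<open>fst\<close> and on pulled-back functions suffice. The fields have
  constant values on \<open>fst\<close>, and a pulled-back function is differentiated within the
  fibre alone.\<close>

lemma
  assumes X: "vector_field_on F W X" and t: "t \<in> I" and x: "x \<in> W"
  shows bracket_dt_lift: "lie_bracket M dt_field (lift X) (t, x) = (\<lambda>h. 0)"
    and bracket_lift_dt: "lie_bracket M (lift X) dt_field (t, x) = (\<lambda>h. 0)"
    and bracket_lift_lift: "vector_field_on F W Y \<Longrightarrow>
      lie_bracket M (lift X) (lift Y) (t, x) = lift (lie_bracket F X Y) (t, x)"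
proof -
  note W = F.vector_field_open[OF X] F.vector_field_carrier[OF X]
  have xc: "x \<in> carrier F" and p: "(t, x) \<in> I \<times> W" using x W t by auto
  note dtv = vector_field_dt_on[OF W] and lv = vector_field_lift
  note Xx = F.vector_field_tangent[OF X]
  have oN: "open (I \<times> W)" by (intro open_Times open_I W)
  have T: "u \<in> tangent_space M (t, x) \<Longrightarrow> u h = 0"
    if "\<And>q. q \<in> I \<times> W \<Longrightarrow> h q = c" for u h and c :: real
  proof -
    assume u: "u \<in> tangent_space M (t, x)"
    have "u (\<lambda>q. c) = u h"
      by (rule M.tangent_germ[OF u M.smooth_near_const oN p]) (use that t xc carrier_interval_prod in auto)
    then show "u h = 0" using M.tangent_const[OF u] by simp
  qed
  note dT = dt_tangent[OF t xc] and lT = lift_tangent[OF t xc]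
  have lie: "lie_bracket M Y Z (t, x) h = Y (t, x) (\<lambda>q. Z q h) - Z (t, x) (\<lambda>q. Y q h)"
    if "smooth_near M (t, x) h" for Y Z h using that by (simp add: lie_bracket_def)
  have nf: "smooth_near M (t, x) fst" by (rule smooth_near_fst_id[OF t xc])
  have lf: "lift Y q fst = 0" if "vector_field_on F W Y" "q \<in> I \<times> W" for Y q
    using that by (auto simp: lift_eq lift_vec_fst_id F.vector_field_tangent)
  have df: "dt_field q fst = 1" if "q \<in> I \<times> W" for q
    using that W(2) by (auto simp: dt_field_fst_id)
  have ds: "dt_field q (\<lambda>p. u (snd p)) = 0" for q u by (cases q) (simp add: dt_field_snd)
  have z: "v = (\<lambda>h. 0)" if v: "v \<in> tangent_space M (t, x)" and "v fst = 0" "\<And>u. smooth_near F x u \<Longrightarrow> v (\<lambda>p. u (snd p)) = 0" for v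
  proof (rule tangent_product_eqI[OF t xc v M.tangent_space_zero that(2)])
    show "dproj v = dproj (\<lambda>h. 0)"
    proof
      fix u show "dproj v u = dproj (\<lambda>h. 0) u"
        using that(3) F.tangent_not_near[OF dproj_tangent[OF t v], of u] unfolding dproj_def comp_def by blast
    qed
  qed
  show *: "lie_bracket M dt_field (lift X) (t, x) = (\<lambda>h. 0)"
  proof (rule z[OF M.vector_field_tangent[OF M.vector_field_bracket[OF dtv lv[OF X]] p]])
    show "lie_bracket M dt_field (lift X) (t, x) fst = 0"
      using lie[OF nf, of dt_field "lift X"] T[OF lf[OF X] dT] T[OF df lT[OF Xx[OF x]]] by (simp add: lift_eq)
    fix u assume u: "smooth_near F x u"
    note nu = smooth_near_snd[OF t u]
    obtain V where V: "open V" "x \<in> V" "V \<subseteq> W" "smooth_fun F V u" using F.smooth_nearE[OF u W(1) x] by metis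
    \<comment> \<open>The derivative of a pulled-back function along a lift is again pulled back,
      that is, separated with the constant factor 1 in t, whose derivative is zero.\<close>
    have "dt_field (t, x) (\<lambda>q. lift X q (\<lambda>p. u (snd p))) = deriv (\<lambda>s. 1) t * X x u"
      by (rule dt_separated[OF t V(2,1) _ smooth_on_const F.vector_field_smooth[OF X V(1,3,4)]])
        (use V(3) W(2) in \<open>auto simp: lift_eq intro!: lift_vec_snd Xx\<close>)
    then show "lie_bracket M dt_field (lift X) (t, x) (\<lambda>p. u (snd p)) = 0"
      using lie[OF nu, of dt_field "lift X"] T[OF ds lT[OF Xx[OF x]]] by (simp add: lift_eq)
  qed
  show "lie_bracket M (lift X) dt_field (t, x) = (\<lambda>h. 0)"
  proof
    fix h show "lie_bracket M (lift X) dt_field (t, x) h = 0"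
      using fun_cong[OF *, of h] by (simp add: lie_bracket_def split: if_splits)
  qed
  assume Y: "vector_field_on F W Y"
  note Yx = F.vector_field_tangent[OF Y]
  note B = F.vector_field_bracket[OF X Y]
  show "lie_bracket M (lift X) (lift Y) (t, x) = lift (lie_bracket F X Y) (t, x)"
  proof (rule tangent_product_eqI[OF t xc])
    show v: "lie_bracket M (lift X) (lift Y) (t, x) \<in> tangent_space M (t, x)"
      by (rule M.vector_field_tangent[OF M.vector_field_bracket[OF lv[OF X] lv[OF Y]] p])
    show w: "lift (lie_bracket F X Y) (t, x) \<in> tangent_space M (t, x)"
      by (rule M.vector_field_tangent[OF lv[OF B] p])
    show "lie_bracket M (lift X) (lift Y) (t, x) fst = lift (lie_bracket F X Y) (t, x) fst"
      using lie[OF nf, of "lift X" "lift Y"] T[OF lf[OF Y] lT[OF Xx[OF x]]] T[OF lf[OF X] lT[OF Yx[OF x]]] lf[OF B p]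
      by (simp add: lift_eq)
    show "dproj (lie_bracket M (lift X) (lift Y) (t, x)) = dproj (lift (lie_bracket F X Y) (t, x))"
    proof
      fix u
      show "dproj (lie_bracket M (lift X) (lift Y) (t, x)) u = dproj (lift (lie_bracket F X Y) (t, x)) u"
      proof (cases "smooth_near F x u")
        case u: True
        note nu = smooth_near_snd[OF t u]
        obtain V where V: "open V" "x \<in> V" "V \<subseteq> W" "smooth_fun F V u" using F.smooth_nearE[OF u W(1) x] by metis
        have l: "lift_vec t x (R x) (\<lambda>q. lift S q (\<lambda>p. u (snd p))) = 1 * R x (\<lambda>y. S y u)"
          if R: "vector_field_on F W R" and S: "vector_field_on F W S" for R S
          by (rule lift_separated[OF t V(2,1) _ smooth_on_const[of _ 1] F.vector_field_smooth[OF S V(1,3,4)] _ F.vector_field_tangent[OF R x]])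
            (use V(3) W(2) in \<open>auto simp: lift_eq intro!: lift_vec_snd F.vector_field_tangent[OF S]\<close>)
        have "dproj (lie_bracket M (lift X) (lift Y) (t, x)) u = X x (\<lambda>y. Y y u) - Y x (\<lambda>y. X y u)"
          unfolding dproj_def comp_def lie[OF nu] using l[OF X Y] l[OF Y X] by (simp add: lift_eq)
        also have "\<dots> = lie_bracket F X Y x u" using u by (simp add: lie_bracket_def)
        also have "\<dots> = dproj (lift (lie_bracket F X Y) (t, x)) u"
          unfolding lift_eq dproj_lift[OF t F.vector_field_tangent[OF B x]] ..
        finally show ?thesis .
      next
        case False
        then show ?thesis
          using F.tangent_not_near[OF dproj_tangent[OF t v]] F.tangent_not_near[OF dproj_tangent[OF t w]] by simp
      qed
    qed
  qed
qed

end

section \<open>Warped products over an interval\<close>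

lemma smooth_on_real_has_derivative:
  fixes k :: "real \<Rightarrow> real"
  assumes "smooth_on S k" "open S" "t \<in> S"
  shows "(k has_real_derivative deriv k t) (at t)"
proof -
  have "k differentiable (at t)" using smooth_on_has_derivative[OF assms] differentiableI by blast
  then show ?thesis
    using DERIV_deriv_iff_real_differentiable by blast
qed

lemma smooth_on_deriv:
  fixes k :: "real \<Rightarrow> real"
  assumes "smooth_on S k" "open S"
  shows "smooth_on S (deriv k)"
proof (rule smooth_on_cong[OF assms(2) _ smooth_on_frechet_derivative[OF assms(1), of 1]])
  fix t assume "t \<in> S"
  from smooth_on_real_has_derivative[OF assms this]
  show "frechet_derivative k (at t) 1 = deriv k t"
    unfolding has_field_derivative_def by (simp add: frechet_derivative_at[symmetric])
qed

locale warped_product = F: pseudo_riemannian_manifold F gF + interval_product F I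
  for F :: "('m::{t2_space, second_countable_topology}, 'e::euclidean_space) chart set"
    and gF :: "'m metric" and I :: "real set" +
  fixes f :: "real \<Rightarrow> real"
  assumes smooth_f: "smooth_on I f" and pos_f: "\<And>t. t \<in> I \<Longrightarrow> f t > 0"
begin

abbreviation "g \<equiv> warped_metric f gF"

lemma warped_metric_eq: "g (t, x) u v = - (u fst * v fst) + (f t)\<^sup>2 * gF x (dproj u) (dproj v)"
  by (simp add: warped_metric_def dproj_def)

lemma dproj_add: "dproj (\<lambda>h. u h + v h) = (\<lambda>h. dproj u h + dproj v h)"
  and dproj_scale: "dproj (\<lambda>h. a * u h) = (\<lambda>h. a * dproj u h)"
  and dproj_zero: "dproj (\<lambda>h. 0) = (\<lambda>h. 0)"
  by (simp_all add: dproj_def)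

lemma metric_zero_right: "x \<in> carrier F \<Longrightarrow> u \<in> tangent_space F x \<Longrightarrow> gF x u (\<lambda>h. 0) = 0"
  using F.metric_sym[of x u "\<lambda>h. 0"] F.metric_zero F.tangent_space_zero by simp

context
  fixes t x
  assumes t: "t \<in> I" and x: "x \<in> carrier F"
begin

lemma warped_metric_lift:
  assumes "v \<in> tangent_space M (t, x)" "u \<in> tangent_space F x"
  shows "g (t, x) v (lift_vec t x u) = (f t)\<^sup>2 * gF x (dproj v) u"
    "g (t, x) (lift_vec t x u) v = (f t)\<^sup>2 * gF x u (dproj v)"
  using assms t by (simp_all add: warped_metric_eq lift_vec_fst_id dproj_lift)

lemma warped_metric_dt:
  assumes "v \<in> tangent_space M (t, x)"
  shows "g (t, x) v (dt_field (t, x)) = - v fst" "g (t, x) (dt_field (t, x)) v = - v fst"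
  using assms t x dproj_tangent[OF t assms]
  by (simp_all add: warped_metric_eq dt_field_fst_id dproj_dt metric_zero_right F.metric_zero)

text \<open>Pairing with the interval field detects the value on \<open>fst\<close>; pairing with
  lifts detects the projection, because f is positive and gF nondegenerate. Covariant derivatives
  are identified this way.\<close>

lemma warped_tangent_eqI:
  assumes v: "v \<in> tangent_space M (t, x)" and w: "w \<in> tangent_space M (t, x)"
    and "g (t, x) v (dt_field (t, x)) = g (t, x) w (dt_field (t, x))"
    and "\<And>u. u \<in> tangent_space F x \<Longrightarrow> g (t, x) v (lift_vec t x u) = g (t, x) w (lift_vec t x u)"
  shows "v = w"
proof (rule tangent_product_eqI[OF t x v w])
  show "v fst = w fst" using assms(3) warped_metric_dt v w by simp
  note T = dproj_tangent[OF t v] dproj_tangent[OF t w]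
  have "(\<lambda>h. dproj v h - dproj w h) = (\<lambda>h. 0)"
  proof (rule F.metric_nondeg[OF x F.tangent_space_diff[OF T]])
    fix u assume u: "u \<in> tangent_space F x"
    show "gF x (\<lambda>h. dproj v h - dproj w h) u = 0"
      using assms(4)[OF u] warped_metric_lift(1)[OF v u] warped_metric_lift(1)[OF w u] pos_f[OF t]
        F.metric_diff[OF x T u] by simp
  qed
  then show "dproj v = dproj w" by (simp add: fun_eq_iff)
qed

end

text \<open>Fields on the product need not be lifts, so smoothness of gF does not apply to them
  directly. Their projections are expanded in the coordinate fields \<open>d b\<close> of a fibre
  chart: the coefficients are smooth on the product, and the Gram entries of the \<open>d b\<close>
  are pulled back from the fibre.\<close>

lemma warped_metric_smooth:
  assumes X: "vector_field_on M W X" and Y: "vector_field_on M W Y"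
  shows "smooth_fun M W (\<lambda>p. g p (X p) (Y p))"
proof (rule M.smooth_fun_local)
  fix p assume p: "p \<in> W"
  then obtain t x where px: "p = (t, x)" "t \<in> I" "x \<in> carrier F"
    using M.vector_field_carrier[OF X] carrier_interval_prod by blast
  obtain U \<psi> where c: "(U, \<psi>) \<in> F" "x \<in> U" using F.carrierE[OF px(3)] .
  let ?N = "W \<inter> I \<times> U"
  note oU = F.chart_open[OF c(1)] and UC = F.chart_subset_carrier[OF c(1)]
  have oN: "open ?N" using M.vector_field_open[OF X] oU open_I by (auto intro: open_Times)
  have N: "?N \<subseteq> W" "?N \<subseteq> I \<times> U" by auto
  define d where "d b = F.coord_field U \<psi> b" for b
  have dv: "vector_field_on F U (d b)" for b unfolding d_def by (rule F.vector_field_coord[OF c(1)])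
  have co: "smooth_fun M ?N (\<lambda>q. Z q (\<lambda>p. \<psi> (snd p) \<bullet> b))" if "vector_field_on M W Z" for Z b
    by (rule M.vector_field_smooth[OF that oN N(1) M.smooth_fun_subset[OF
          smooth_fun_snd[OF oU F.smooth_fun_coordinate[OF c(1) subset_refl oU]] N(2)]])
  have fs: "smooth_fun M ?N (\<lambda>q. Z q fst)" if "vector_field_on M W Z" for Z
  proof (rule M.vector_field_smooth[OF that oN N(1)])
    show "smooth_fun M ?N fst"
      using M.smooth_fun_subset[OF smooth_fun_fst[OF oU smooth_on_bounded_linear[OF bounded_linear_ident open_I]] N(2)]
      by simp
  qed
  have ff: "smooth_fun M ?N (\<lambda>q. f (fst q))" by (rule M.smooth_fun_subset[OF smooth_fun_fst[OF oU smooth_f] N(2)])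
  have gs: "smooth_fun M ?N (\<lambda>q. gF (snd q) (d b (snd q)) (d b' (snd q)))" for b b'
    by (rule M.smooth_fun_subset[OF smooth_fun_snd[OF oU F.metric_smooth[OF dv dv]] N(2)])
  have S: "smooth_fun M ?N (\<lambda>q. (- 1) * (X q fst * Y q fst) + f (fst q) * f (fst q) *
      (\<Sum>b\<in>Basis. X q (\<lambda>p. \<psi> (snd p) \<bullet> b) * (\<Sum>b'\<in>Basis. Y q (\<lambda>p. \<psi> (snd p) \<bullet> b') *
        gF (snd q) (d b (snd q)) (d b' (snd q)))))"
    by (intro M.smooth_fun_add[OF oN] M.smooth_fun_mult[OF oN] M.smooth_fun_sum[OF oN] fs co ff gs X Y
        finite_Basis M.smooth_fun_const)
  have "smooth_fun M ?N (\<lambda>q. g q (X q) (Y q))"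
  proof (rule M.smooth_fun_cong[OF oN _ S])
    fix q assume q: "q \<in> ?N"
    obtain s y where qs: "q = (s, y)" "s \<in> I" "y \<in> U" "y \<in> carrier F" using q UC by auto
    have T: "dproj (Z q) \<in> tangent_space F y" if "vector_field_on M W Z" for Z
      using dproj_tangent[OF qs(2)] M.vector_field_tangent[OF that] q qs(1) by auto
    have dT: "d b y \<in> tangent_space F y" for b using F.vector_field_tangent[OF dv qs(3)] .
    have e: "dproj (Z q) = (\<lambda>h. \<Sum>b\<in>Basis. Z q (\<lambda>p. \<psi> (snd p) \<bullet> b) * d b y h)" if "vector_field_on M W Z" for Z
      using F.tangent_expand[OF c(1) qs(3) T[OF that]] by (simp add: dproj_def comp_def d_def)
    have 1: "gF y (dproj (X q)) (dproj (Y q)) = (\<Sum>b\<in>Basis. X q (\<lambda>p. \<psi> (snd p) \<bullet> b) * gF y (d b y) (dproj (Y q)))"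
      unfolding e[OF X] by (rule F.metric_sum[OF qs(4) finite_Basis dT T[OF Y]])
    have 2: "gF y (d b y) (dproj (Y q)) = (\<Sum>b'\<in>Basis. Y q (\<lambda>p. \<psi> (snd p) \<bullet> b') * gF y (d b y) (d b' y))" for b
    proof -
      have "gF y (d b y) (dproj (Y q)) = gF y (dproj (Y q)) (d b y)" by (rule F.metric_sym[OF qs(4) dT T[OF Y]])
      also have "\<dots> = (\<Sum>b'\<in>Basis. Y q (\<lambda>p. \<psi> (snd p) \<bullet> b') * gF y (d b' y) (d b y))"
        unfolding e[OF Y] by (rule F.metric_sum[OF qs(4) finite_Basis dT dT])
      finally show ?thesis using F.metric_sym[OF qs(4) dT dT, of b] by simp
    qed
    show "(- 1) * (X q fst * Y q fst) + f (fst q) * f (fst q) *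
      (\<Sum>b\<in>Basis. X q (\<lambda>p. \<psi> (snd p) \<bullet> b) * (\<Sum>b'\<in>Basis. Y q (\<lambda>p. \<psi> (snd p) \<bullet> b') *
        gF (snd q) (d b (snd q)) (d b' (snd q)))) = g q (X q) (Y q)"
      using 1 2 unfolding qs(1) warped_metric_eq by (simp add: power2_eq_square)
  qed
  then show "\<exists>V. open V \<and> p \<in> V \<and> smooth_fun M V (\<lambda>p. g p (X p) (Y p))"
    using oN p px c(2) by (intro exI[of _ ?N]) auto
qed

lemma pseudo_riemannian_warped: "pseudo_riemannian M g"
proof -
  have A: "(\<forall>u\<in>tangent_space M p. \<forall>v\<in>tangent_space M p. g p u v = g p v u) \<and>
        (\<forall>u\<in>tangent_space M p. \<forall>v\<in>tangent_space M p. \<forall>w\<in>tangent_space M p.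
           g p (\<lambda>h. u h + v h) w = g p u w + g p v w) \<and>
        (\<forall>a. \<forall>u\<in>tangent_space M p. \<forall>v\<in>tangent_space M p. g p (\<lambda>h. a * u h) v = a * g p u v) \<and>
        (\<forall>u\<in>tangent_space M p. (\<forall>v\<in>tangent_space M p. g p u v = 0) \<longrightarrow> u = (\<lambda>h. 0))"
    if pc: "p \<in> carrier M" for p
  proof -
    obtain t x where p: "p = (t, x)" "t \<in> I" "x \<in> carrier F" using pc carrier_interval_prod by auto
    note T = dproj_tangent[OF p(2)]
    show ?thesis unfolding p(1)
    proof (intro conjI ballI allI impI)
      fix u v assume u: "u \<in> tangent_space M (t, x)" and v: "v \<in> tangent_space M (t, x)"
      show "g (t, x) u v = g (t, x) v u"
        using F.metric_sym[OF p(3) T[OF u] T[OF v]] by (simp add: warped_metric_eq mult.commute)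
      show "g (t, x) (\<lambda>h. a * u h) v = a * g (t, x) u v" for a
        using F.metric_scale[OF p(3) T[OF u] T[OF v]] by (simp add: warped_metric_eq dproj_scale algebra_simps)
      show "g (t, x) (\<lambda>h. u h + v h) w = g (t, x) u w + g (t, x) v w" if w: "w \<in> tangent_space M (t, x)" for w
        using F.metric_add[OF p(3) T[OF u] T[OF v] T[OF w]] by (simp add: warped_metric_eq dproj_add algebra_simps)
    next
      fix u assume u: "u \<in> tangent_space M (t, x)" and z: "\<forall>v\<in>tangent_space M (t, x). g (t, x) u v = 0"
      show "u = (\<lambda>h. 0)"
      proof (rule warped_tangent_eqI[OF p(2,3) u M.tangent_space_zero])
        show "g (t, x) u (dt_field (t, x)) = g (t, x) (\<lambda>h. 0) (dt_field (t, x))"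
          using z dt_tangent[OF p(2,3)] warped_metric_dt[OF p(2,3) M.tangent_space_zero] by simp
        show "g (t, x) u (lift_vec t x w) = g (t, x) (\<lambda>h. 0) (lift_vec t x w)" if "w \<in> tangent_space F x" for w
          using z lift_tangent[OF p(2,3) that] warped_metric_lift[OF p(2,3) M.tangent_space_zero that]
            F.metric_zero[OF p(3) that] by (simp add: dproj_zero)
      qed
    qed
  qed
  show ?thesis unfolding pseudo_riemannian_def
    using smooth_manifold_interval_prod A warped_metric_smooth by (intro conjI ballI allI impI) blast+
qed

end

sublocale warped_product \<subseteq> M: pseudo_riemannian_manifold "interval_prod I F" "warped_metric f gF"
  by unfold_locales (rule pseudo_riemannian_warped)

section \<open>The Levi-Civita connection of the warped product\<close>

locale warped_levi_civita = warped_product F gF I f + F: levi_civita_manifold F gF DF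
    + M: levi_civita_manifold "interval_prod I F" "warped_metric f gF" D
  for F :: "('m::{t2_space, second_countable_topology}, 'e::euclidean_space) chart set"
    and gF I f DF D
begin

context
  fixes W :: "'m set" and t :: real and x :: 'm
  assumes W: "open W" "W \<subseteq> carrier F" and t: "t \<in> I" and x: "x \<in> W"
begin

private lemma xc: "x \<in> carrier F" using W x by blast

private lemma p: "(t, x) \<in> I \<times> W" "(t, x) \<in> carrier M"
  using t x xc carrier_interval_prod by auto

private lemma dtv: "vector_field_on M (I \<times> W) dt_field" by (rule vector_field_dt_on[OF W])

private lemmas lv = vector_field_lift[where W = W]
private lemmas Fx = F.vector_field_tangent[where W = W, OF _ x]

private lemma f_deriv: "deriv (\<lambda>s. (f s)\<^sup>2) t = 2 * f t * deriv f t"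
  using smooth_on_real_has_derivative[OF smooth_f open_I t]
  by (intro DERIV_imp_deriv) (auto intro!: derivative_eq_intros simp: field_simps)

private lemma smooth_f2: "smooth_on I (\<lambda>s. (f s)\<^sup>2)"
  unfolding power2_eq_square by (rule smooth_on_mult[OF open_I smooth_f smooth_f])

private lemma g_lift_lift:
  assumes "vector_field_on F W U" "vector_field_on F W V" "s \<in> I" "y \<in> W"
  shows "g (s, y) (lift U (s, y)) (lift V (s, y)) = (f s)\<^sup>2 * gF y (U y) (V y)"
proof -
  have "y \<in> carrier F" using W assms(4) by blast
  then show ?thesis
    using warped_metric_lift[OF assms(3) _ lift_tangent[OF assms(3)], of y "U y" "V y"] assms
    by (simp add: lift_eq dproj_lift F.vector_field_tangent)
qed

private lemma g_dt:
  assumes "s \<in> I" "y \<in> W"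
  shows "g (s, y) (dt_field (s, y)) (dt_field (s, y)) = -1"
    "vector_field_on F W U \<Longrightarrow> g (s, y) (dt_field (s, y)) (lift U (s, y)) = 0"
    "vector_field_on F W U \<Longrightarrow> g (s, y) (lift U (s, y)) (dt_field (s, y)) = 0"
proof -
  have y: "y \<in> carrier F" using W assms(2) by blast
  show "g (s, y) (dt_field (s, y)) (dt_field (s, y)) = -1"
    using warped_metric_dt[OF assms(1) y dt_tangent[OF assms(1) y]] dt_field_fst_id[OF assms(1) y] by simp
  assume U: "vector_field_on F W U"
  note Uy = F.vector_field_tangent[OF U assms(2)]
  show "g (s, y) (dt_field (s, y)) (lift U (s, y)) = 0" "g (s, y) (lift U (s, y)) (dt_field (s, y)) = 0"
    using warped_metric_dt[OF assms(1) y lift_tangent[OF assms(1) y Uy]] lift_vec_fst_id[OF Uy] by (simp_all add: lift_eq)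
qed

private lemma const_derivative:
  assumes "v \<in> tangent_space M (t, x)" "\<And>q. q \<in> I \<times> W \<Longrightarrow> h q = (c::real)"
  shows "v h = 0"
proof -
  have "v (\<lambda>q. c) = v h"
    by (rule M.tangent_germ[OF assms(1) M.smooth_near_const[OF p(2)] open_Times[OF open_I W(1)] p(1)])
      (use assms(2) in auto)
  then show ?thesis using M.tangent_const[OF assms(1)] by simp
qed

private lemma g_lift_derivative:
  assumes U: "vector_field_on F W U" and V: "vector_field_on F W V"
  shows "v \<in> tangent_space F x \<Longrightarrow>
      lift_vec t x v (\<lambda>q. g q (lift U q) (lift V q)) = (f t)\<^sup>2 * v (\<lambda>y. gF y (U y) (V y))"
    and "dt_field (t, x) (\<lambda>q. g q (lift U q) (lift V q)) = 2 * f t * deriv f t * gF x (U x) (V x)"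
  using lift_separated[OF t x W smooth_f2 F.metric_smooth[OF U V] g_lift_lift[OF U V]]
    dt_separated[OF t x W smooth_f2 F.metric_smooth[OF U V] g_lift_lift[OF U V]] f_deriv by auto

private lemma dT: "dt_field (t, x) \<in> tangent_space M (t, x)" by (rule dt_tangent[OF t xc])

private lemma lT: "u \<in> tangent_space F x \<Longrightarrow> lift_vec t x u \<in> tangent_space M (t, x)" by (rule lift_tangent[OF t xc])

private lemma g_zero: "v \<in> tangent_space M (t, x) \<Longrightarrow> g (t, x) (\<lambda>h. 0) v = 0"
  by (rule M.metric_zero[OF p(2)])

private lemma bracket_dt_dt: "lie_bracket M dt_field dt_field (t, x) = (\<lambda>h. 0)"
  by (auto simp: lie_bracket_def)

text \<open>In Koszul's formula all brackets are zero or lifted, and products with the interval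
  field are constant. The surviving derivatives are those of f^2 gF: along the fibre they rebuild
  Koszul's formula of F, along t they give 2 f f'.\<close>

lemma conn_lift_lift_metric:
  assumes U: "vector_field_on F W U" and V: "vector_field_on F W V" and Z: "vector_field_on F W Z"
  shows "g (t, x) (D (lift U) (lift V) (t, x)) (lift Z (t, x)) = (f t)\<^sup>2 * gF x (DF U V x) (Z x)"
    and "g (t, x) (D (lift U) (lift V) (t, x)) (dt_field (t, x)) = - (f t * deriv f t * gF x (U x) (V x))"
    and "g (t, x) (D dt_field (lift U) (t, x)) (lift Z (t, x)) = f t * deriv f t * gF x (U x) (Z x)"
    and "g (t, x) (D dt_field (lift U) (t, x)) (dt_field (t, x)) = 0"
    and "g (t, x) (D dt_field dt_field (t, x)) (lift Z (t, x)) = 0"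
    and "g (t, x) (D dt_field dt_field (t, x)) (dt_field (t, x)) = 0"
proof -
  have br: "g (t, x) (lie_bracket M (lift R) (lift S) (t, x)) (lift T (t, x)) = (f t)\<^sup>2 * gF x (lie_bracket F R S x) (T x)"
    "g (t, x) (lie_bracket M (lift R) (lift S) (t, x)) (dt_field (t, x)) = 0"
    if "vector_field_on F W R" "vector_field_on F W S" "vector_field_on F W T" for R S T
    unfolding bracket_lift_lift[OF that(1) t x that(2)]
    by (rule g_lift_lift[OF F.vector_field_bracket[OF that(1,2)] that(3) t x]
        g_dt(3)[OF t x F.vector_field_bracket[OF that(1,2)]])+
  note l = lv[OF U] lv[OF V] lv[OF Z]
  note T = lT[OF Fx[OF U]] lT[OF Fx[OF V]] lT[OF Fx[OF Z]]
  have c0: "v (\<lambda>q. g q (lift R q) (dt_field q)) = 0" "v (\<lambda>q. g q (dt_field q) (lift R q)) = 0"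
    "v (\<lambda>q. g q (dt_field q) (dt_field q)) = 0"
    if "v \<in> tangent_space M (t, x)" "vector_field_on F W R" for v R
    using g_dt that(2) by (auto intro!: const_derivative[OF that(1)])
  have "2 * g (t, x) (D (lift U) (lift V) (t, x)) (lift Z (t, x)) = (f t)\<^sup>2 * (2 * gF x (DF U V x) (Z x))"
    unfolding M.koszul[OF l p(1)] F.koszul[OF U V Z x] br(1)[OF U V Z] br(1)[OF U Z V] br(1)[OF V Z U]
    by (simp add: lift_eq g_lift_derivative Fx U V Z algebra_simps)
  then show "g (t, x) (D (lift U) (lift V) (t, x)) (lift Z (t, x)) = (f t)\<^sup>2 * gF x (DF U V x) (Z x)" by simp
  have "2 * g (t, x) (D (lift U) (lift V) (t, x)) (dt_field (t, x)) = - (2 * f t * deriv f t * gF x (U x) (V x))"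
    unfolding M.koszul[OF l(1,2) dtv p(1)] br(2)[OF U V V]
      bracket_lift_dt[OF U t x] bracket_lift_dt[OF V t x] g_zero[OF T(1), folded lift_eq] g_zero[OF T(2), folded lift_eq]
    by (simp add: lift_eq c0[OF T(1) V] c0[OF T(2) U] g_lift_derivative(2)[OF U V])
  then show "g (t, x) (D (lift U) (lift V) (t, x)) (dt_field (t, x)) = - (f t * deriv f t * gF x (U x) (V x))" by simp
  have "2 * g (t, x) (D dt_field (lift U) (t, x)) (lift Z (t, x)) = 2 * f t * deriv f t * gF x (U x) (Z x)"
    unfolding M.koszul[OF dtv l(1,3) p(1)] br(2)[OF U Z Z]
      bracket_dt_lift[OF U t x] bracket_dt_lift[OF Z t x] g_zero[OF T(1), folded lift_eq] g_zero[OF T(3), folded lift_eq]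
    by (simp add: lift_eq c0[OF T(1) Z] c0[OF T(3) U] g_lift_derivative(2)[OF U Z])
  then show "g (t, x) (D dt_field (lift U) (t, x)) (lift Z (t, x)) = f t * deriv f t * gF x (U x) (Z x)" by simp
  have "2 * g (t, x) (D dt_field (lift U) (t, x)) (dt_field (t, x)) = 0"
    unfolding M.koszul[OF dtv l(1) dtv p(1)]
      bracket_dt_lift[OF U t x] bracket_lift_dt[OF U t x] bracket_dt_dt g_zero[OF T(1), folded lift_eq] g_zero[OF dT]
    by (simp add: lift_eq c0[OF T(1) U] c0[OF dT U])
  then show "g (t, x) (D dt_field (lift U) (t, x)) (dt_field (t, x)) = 0" by simp
  have "2 * g (t, x) (D dt_field dt_field (t, x)) (lift Z (t, x)) = 0"
    unfolding M.koszul[OF dtv dtv l(3) p(1)]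
      bracket_dt_lift[OF Z t x] bracket_dt_dt g_zero[OF T(3), folded lift_eq] g_zero[OF dT]
    by (simp add: lift_eq c0[OF T(3) Z] c0[OF dT Z])
  then show "g (t, x) (D dt_field dt_field (t, x)) (lift Z (t, x)) = 0" by simp
  have "2 * g (t, x) (D dt_field dt_field (t, x)) (dt_field (t, x)) = 0"
    unfolding M.koszul[OF dtv dtv dtv p(1)] bracket_dt_dt g_zero[OF dT]
    by (simp add: c0[OF dT Z])
  then show "g (t, x) (D dt_field dt_field (t, x)) (dt_field (t, x)) = 0" by simp
qed

end

context
  fixes W :: "'m set" and t :: real and x :: 'm
  assumes W: "open W" "W \<subseteq> carrier F" and t: "t \<in> I" and x: "x \<in> W"
begin

text \<open>Koszul's formula pairs fields, so a fibre vector has to be the value of a field; its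
  domain is taken inside W, where the other fields live.\<close>

lemma extend_in:
  assumes "u \<in> tangent_space F x"
  obtains V Z where "open V" "V \<subseteq> W" "x \<in> V" "vector_field_on F V Z" "Z x = u"
proof -
  obtain V Z where V: "x \<in> V" "vector_field_on F V Z" "Z x = u"
    using F.tangent_extend[OF _ assms] W x by blast
  show thesis
    by (rule that[of "V \<inter> W" Z])
      (use V(1,3) W(1) x F.vector_field_open[OF V(2)] F.vector_field_subset[OF V(2), of "V \<inter> W"] in \<open>auto simp: open_Int\<close>)
qed

text \<open>The pairings are assembled into vectors. Since the interval field has square -1, the
  pairing - f f' gF(U,V) turns into the coefficient + f f' gF(U,V); in the fibre directions division
  of f f' by f^2 leaves f'/f.\<close>

lemma
  assumes U: "vector_field_on F W U"
  shows conn_lift_lift: "vector_field_on F W V \<Longrightarrow> D (lift U) (lift V) (t, x)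
      = (\<lambda>h. lift_vec t x (DF U V x) h + (f t * deriv f t * gF x (U x) (V x)) * dt_field (t, x) h)"
    and conn_dt_lift: "D dt_field (lift U) (t, x) = (\<lambda>h. (deriv f t / f t) * lift_vec t x (U x) h)"
    and conn_lift_dt: "D (lift U) dt_field (t, x) = (\<lambda>h. (deriv f t / f t) * lift_vec t x (U x) h)"
    and conn_dt_dt: "D dt_field dt_field (t, x) = (\<lambda>h. 0)"
proof -
  have xc: "x \<in> carrier F" using W x by blast
  have p: "(t, x) \<in> I \<times> W" "(t, x) \<in> carrier M" using t x xc carrier_interval_prod by auto
  note dtv = vector_field_dt_on[OF W] and lv = vector_field_lift and eqI = warped_tangent_eqI[OF t xc]
  note dT = dt_tangent[OF t xc] and lT = lift_tangent[OF t xc]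
  note Ux = F.vector_field_tangent[OF U x]
  have fp: "f t > 0" using pos_f[OF t] .
  have tan: "D X Y (t, x) \<in> tangent_space M (t, x)"
    if "vector_field_on M (I \<times> W) X" "vector_field_on M (I \<times> W) Y" for X Y
    by (rule M.vector_field_tangent[OF M.conn_vector_field[OF that] p(1)])
  have dd: "g (t, x) (dt_field (t, x)) (dt_field (t, x)) = -1"
    using warped_metric_dt[OF t xc dT] dt_field_fst_id[OF t xc] by simp
  have ld: "g (t, x) (lift_vec t x u) (dt_field (t, x)) = 0" "g (t, x) (dt_field (t, x)) (lift_vec t x u) = 0"
    if "u \<in> tangent_space F x" for u
    using warped_metric_dt[OF t xc lT[OF that]] lift_vec_fst_id[OF that] by simp_all
  have ll: "g (t, x) (lift_vec t x u) (lift_vec t x v) = (f t)\<^sup>2 * gF x u v"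
    if "u \<in> tangent_space F x" "v \<in> tangent_space F x" for u v
    using warped_metric_lift(1)[OF t xc lT[OF that(1)] that(2)] dproj_lift[OF t that(1)] by simp
  show "D (lift U) (lift V) (t, x)
      = (\<lambda>h. lift_vec t x (DF U V x) h + (f t * deriv f t * gF x (U x) (V x)) * dt_field (t, x) h)"
    if V: "vector_field_on F W V"
  proof (rule eqI[OF tan[OF lv[OF U] lv[OF V]]])
    note DT = F.vector_field_tangent[OF F.conn_vector_field[OF U V] x]
    let ?c = "f t * deriv f t * gF x (U x) (V x)"
    note sT = M.tangent_space_scale[OF dT, of ?c]
    show "(\<lambda>h. lift_vec t x (DF U V x) h + ?c * dt_field (t, x) h) \<in> tangent_space M (t, x)"
      by (intro M.tangent_space_add lT DT sT)
    show "g (t, x) (D (lift U) (lift V) (t, x)) (dt_field (t, x))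
      = g (t, x) (\<lambda>h. lift_vec t x (DF U V x) h + ?c * dt_field (t, x) h) (dt_field (t, x))"
      unfolding M.metric_add[OF p(2) lT[OF DT] sT dT] M.metric_scale[OF p(2) dT dT]
      using conn_lift_lift_metric(2)[OF W t x U V U] ld(1)[OF DT] dd by simp
    fix u assume u: "u \<in> tangent_space F x"
    obtain N Z where N: "open N" "N \<subseteq> W" "x \<in> N" and Z: "vector_field_on F N Z" "Z x = u"
      using extend_in[OF u] .
    show "g (t, x) (D (lift U) (lift V) (t, x)) (lift_vec t x u)
      = g (t, x) (\<lambda>h. lift_vec t x (DF U V x) h + ?c * dt_field (t, x) h) (lift_vec t x u)"
      unfolding M.metric_add[OF p(2) lT[OF DT] sT lT[OF u]] M.metric_scale[OF p(2) dT lT[OF u]]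
      using conn_lift_lift_metric(1)[OF N(1) _ t N(3) F.vector_field_subset[OF U N(1,2)] F.vector_field_subset[OF V N(1,2)] Z(1)]
        ld(2)[OF u] ll[OF DT u] N(2) W(2) Z(2) by (simp add: lift_eq)
  qed
  show dl: "D dt_field (lift U) (t, x) = (\<lambda>h. (deriv f t / f t) * lift_vec t x (U x) h)"
  proof (rule eqI[OF tan[OF dtv lv[OF U]] M.tangent_space_scale[OF lT[OF Ux]]])
    show "g (t, x) (D dt_field (lift U) (t, x)) (dt_field (t, x))
      = g (t, x) (\<lambda>h. deriv f t / f t * lift_vec t x (U x) h) (dt_field (t, x))"
      unfolding M.metric_scale[OF p(2) lT[OF Ux] dT]
      using conn_lift_lift_metric(4)[OF W t x U U U] ld(1)[OF Ux] by simp
    fix u assume u: "u \<in> tangent_space F x"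
    obtain N Z where N: "open N" "N \<subseteq> W" "x \<in> N" and Z: "vector_field_on F N Z" "Z x = u"
      using extend_in[OF u] .
    note UN = F.vector_field_subset[OF U N(1,2)]
    show "g (t, x) (D dt_field (lift U) (t, x)) (lift_vec t x u)
      = g (t, x) (\<lambda>h. deriv f t / f t * lift_vec t x (U x) h) (lift_vec t x u)"
      unfolding M.metric_scale[OF p(2) lT[OF Ux] lT[OF u]]
      using conn_lift_lift_metric(3)[OF N(1) _ t N(3) UN UN Z(1)] ll[OF Ux u] N(2) W(2) Z(2) fp
      by (simp add: lift_eq power2_eq_square)
  qed
  \<comment> \<open>The bracket of the interval field with a lift vanishes, so torsion-freeness lets
    the arguments be exchanged.\<close>
  have "D (lift U) dt_field (t, x) = D dt_field (lift U) (t, x)"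
    using M.torsion_free[OF dtv lv[OF U] p(1)] bracket_dt_lift[OF U t x] by (simp add: fun_eq_iff)
  then show "D (lift U) dt_field (t, x) = (\<lambda>h. (deriv f t / f t) * lift_vec t x (U x) h)" using dl by simp
  show "D dt_field dt_field (t, x) = (\<lambda>h. 0)"
  proof (rule eqI[OF tan[OF dtv dtv] M.tangent_space_zero])
    show "g (t, x) (D dt_field dt_field (t, x)) (dt_field (t, x)) = g (t, x) (\<lambda>h. 0) (dt_field (t, x))"
      using conn_lift_lift_metric(6)[OF W t x U U U] M.metric_zero[OF p(2) dT] by simp
    fix u assume u: "u \<in> tangent_space F x"
    obtain N Z where N: "open N" "N \<subseteq> W" "x \<in> N" and Z: "vector_field_on F N Z" "Z x = u"
      using extend_in[OF u] .
    show "g (t, x) (D dt_field dt_field (t, x)) (lift_vec t x u) = g (t, x) (\<lambda>h. 0) (lift_vec t x u)"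
      using conn_lift_lift_metric(5)[OF N(1) _ t N(3) Z(1) Z(1) Z(1)] M.metric_zero[OF p(2) lT[OF u]] N(2) W(2) Z(2)
      by (simp add: lift_eq)
  qed
qed

end

section \<open>Curvature of the warped product\<close>

lemma smooth_deriv_divide: "smooth_on I (\<lambda>s. deriv f s / f s)"
proof (rule smooth_on_cong[OF open_I])
  have "smooth_on {0<..} (\<lambda>x::real. x powr (- 1))" unfolding smooth_on_def by (blast intro: ck_on_powr)
  then show "smooth_on I (\<lambda>s. deriv f s * f s powr (- 1))"
    by (intro smooth_on_mult[OF open_I] smooth_on_deriv smooth_f open_I
        smooth_on_compose[OF open_I open_greaterThan _ smooth_f, of 0 "\<lambda>x. x powr (- 1)"]) (use pos_f in auto)
  show "deriv f s * f s powr (- 1) = deriv f s / f s" if "s \<in> I" for s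
    using pos_f[OF that] by (simp add: powr_minus divide_inverse)
qed

lemma smooth_mult_deriv: "smooth_on I (\<lambda>s. f s * deriv f s)"
  by (intro smooth_on_mult open_I smooth_f smooth_on_deriv)

lemma lift_vec_diff: "lift_vec t x (\<lambda>h. u h - v h) = (\<lambda>h. lift_vec t x u h - lift_vec t x v h)"
  by (auto simp: lift_vec_def)

context
  fixes W :: "'m set" and t :: real and x :: 'm
  assumes W: "open W" "W \<subseteq> carrier F" and t: "t \<in> I" and x: "x \<in> W"
begin

private lemma xF: "x \<in> carrier F" using W x by blast

private lemma pM: "(t, x) \<in> I \<times> W" "(t, x) \<in> carrier M"
  using t x xF carrier_interval_prod by auto

private lemma oN: "open (I \<times> W)" using open_I W by (intro open_Times)

private lemma dt_vf: "vector_field_on M (I \<times> W) dt_field" by (rule vector_field_dt_on[OF W])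

private lemmas lift_vf = vector_field_lift[where W = W]

private lemmas dt_T = dt_tangent[OF t xF]

private lemmas lift_T = lift_tangent[OF t xF]

private lemma smooth_second_form:
  assumes "vector_field_on F W U" "vector_field_on F W V"
  shows "smooth_fun M (I \<times> W) (\<lambda>q. f (fst q) * deriv f (fst q) * gF (snd q) (U (snd q)) (V (snd q)))"
  by (rule M.smooth_fun_mult[OF oN smooth_fun_fst[OF W(1) smooth_mult_deriv] smooth_fun_snd[OF W(1) F.metric_smooth[OF assms]]])

text \<open>The factor 1 puts the derivative into the two-term form that
  \<open>conn_lincomb_right\<close> differentiates.\<close>

private lemma conn_lift_lift_field:
  assumes "vector_field_on F W U" "vector_field_on F W V" "q \<in> I \<times> W"
  shows "D (lift U) (lift V) q k = 1 * lift (DF U V) q k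
    + f (fst q) * deriv f (fst q) * gF (snd q) (U (snd q)) (V (snd q)) * dt_field q k"
  using conn_lift_lift[OF W _ _ assms(1,2), of "fst q" "snd q"] assms(3)
  by (cases q) (simp add: lift_eq)

text \<open>The last term comes from differentiating the interval field along a lift: f f' times
  f'/f is f'^2.\<close>

private lemma conn_lift_conn:
  assumes U: "vector_field_on F W U" and V: "vector_field_on F W V" and Z: "vector_field_on F W Z"
  shows "D (lift U) (D (lift V) (lift Z)) (t, x) h = lift_vec t x (DF U (DF V Z) x) h
    + f t * deriv f t * (gF x (U x) (DF V Z x) + U x (\<lambda>y. gF y (V y) (Z y))) * dt_field (t, x) h
    + (deriv f t)\<^sup>2 * gF x (V x) (Z x) * lift_vec t x (U x) h"
proof -
  let ?b = "\<lambda>q. f (fst q) * deriv f (fst q) * gF (snd q) (V (snd q)) (Z (snd q))"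
  note VZ = F.conn_vector_field[OF V Z]
  have "lift U (t, x) ?b = f t * deriv f t * U x (\<lambda>y. gF y (V y) (Z y))"
    unfolding lift_eq
    by (rule lift_separated[OF t x W smooth_mult_deriv F.metric_smooth[OF V Z] _ F.vector_field_tangent[OF U x]]) simp
  moreover have "lift U (t, x) (\<lambda>q. 1) = 0"
    by (rule M.tangent_const[OF M.vector_field_tangent[OF lift_vf[OF U] pM(1)]])
  moreover have "D (lift U) (D (lift V) (lift Z)) (t, x) h
    = lift U (t, x) (\<lambda>q. 1) * lift (DF V Z) (t, x) h + 1 * D (lift U) (lift (DF V Z)) (t, x) h
      + (lift U (t, x) ?b * dt_field (t, x) h + ?b (t, x) * D (lift U) dt_field (t, x) h)"
    by (rule M.conn_lincomb_right[OF lift_vf[OF U] lift_vf[OF VZ] dt_vf M.smooth_fun_const smooth_second_form[OF V Z]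
          conn_lift_lift_field[OF V Z] pM(1)])
  ultimately show ?thesis
    using conn_lift_lift[OF W t x U VZ] conn_lift_dt[OF W t x U] pos_f[OF t]
    by (simp add: algebra_simps power2_eq_square)
qed

text \<open>A Gauss equation for the slices over fixed t: the quadratic term is built from two
  copies of the second fundamental form f f' gF, its sign reflecting the timelike normal.\<close>

lemma curvature_lift_lift:
  assumes U: "vector_field_on F W U" and V: "vector_field_on F W V" and Z: "vector_field_on F W Z"
    and R: "vector_field_on F W R"
  shows "g (t, x) (curvature M D (lift U) (lift V) (lift Z) (t, x)) (lift R (t, x))
    = (f t)\<^sup>2 * gF x (curvature F DF U V Z x) (R x)
      + (f t)\<^sup>2 * (deriv f t)\<^sup>2 * (gF x (V x) (Z x) * gF x (U x) (R x) - gF x (U x) (Z x) * gF x (V x) (R x))"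
proof -
  note Fx = F.vector_field_tangent[OF _ x]
  note B = F.vector_field_bracket[OF U V] and C = Fx[OF F.curvature_vector_field[OF U V Z]]
  have "D (lie_bracket M (lift U) (lift V)) (lift Z) (t, x) = D (lift (lie_bracket F U V)) (lift Z) (t, x)"
    by (rule M.conn_cong[OF M.vector_field_bracket[OF lift_vf[OF U] lift_vf[OF V]] lift_vf[OF Z] pM(1) _ refl])
      (use bracket_lift_lift[OF U _ _ V] in auto)
  then have br: "D (lie_bracket M (lift U) (lift V)) (lift Z) (t, x) h = lift_vec t x (DF (lie_bracket F U V) Z x) h
      + f t * deriv f t * gF x (lie_bracket F U V x) (Z x) * dt_field (t, x) h" for h
    using conn_lift_lift[OF W t x B Z] by simp
  have "lift_vec t x (curvature F DF U V Z x) = (\<lambda>h. lift_vec t x (DF U (DF V Z) x) h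
      - lift_vec t x (DF V (DF U Z) x) h - lift_vec t x (DF (lie_bracket F U V) Z x) h)"
    unfolding curvature_def lift_vec_diff ..
  then have c: "lift_vec t x (DF U (DF V Z) x) h = lift_vec t x (curvature F DF U V Z x) h
      + lift_vec t x (DF V (DF U Z) x) h + lift_vec t x (DF (lie_bracket F U V) Z x) h" for h by simp
  \<comment> \<open>Only the existence of the coefficient e matters: the interval component is
    orthogonal to the lift of R.\<close>
  obtain e where "curvature M D (lift U) (lift V) (lift Z) (t, x)
      = (\<lambda>h. lift_vec t x (curvature F DF U V Z x) h + (deriv f t)\<^sup>2 * gF x (V x) (Z x) * lift_vec t x (U x) h
        + (- (deriv f t)\<^sup>2 * gF x (U x) (Z x)) * lift_vec t x (V x) h + e * dt_field (t, x) h)"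
  proof
    show "curvature M D (lift U) (lift V) (lift Z) (t, x)
      = (\<lambda>h. lift_vec t x (curvature F DF U V Z x) h + (deriv f t)\<^sup>2 * gF x (V x) (Z x) * lift_vec t x (U x) h
        + (- (deriv f t)\<^sup>2 * gF x (U x) (Z x)) * lift_vec t x (V x) h
        + f t * deriv f t * (gF x (U x) (DF V Z x) + U x (\<lambda>y. gF y (V y) (Z y)) - gF x (V x) (DF U Z x)
          - V x (\<lambda>y. gF y (U y) (Z y)) - gF x (lie_bracket F U V x) (Z x)) * dt_field (t, x) h)"
      unfolding curvature_def[of M] conn_lift_conn[OF U V Z] conn_lift_conn[OF V U Z] br c
      by (rule ext) (simp add: algebra_simps)
  qed
  then have "g (t, x) (curvature M D (lift U) (lift V) (lift Z) (t, x)) (lift R (t, x))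
    = g (t, x) (lift_vec t x (curvature F DF U V Z x)) (lift_vec t x (R x))
      + (deriv f t)\<^sup>2 * gF x (V x) (Z x) * g (t, x) (lift_vec t x (U x)) (lift_vec t x (R x))
      + (- (deriv f t)\<^sup>2 * gF x (U x) (Z x)) * g (t, x) (lift_vec t x (V x)) (lift_vec t x (R x))
      + e * g (t, x) (dt_field (t, x)) (lift_vec t x (R x))"
    using lift_T[OF C] lift_T[OF Fx[OF U]] lift_T[OF Fx[OF V]] lift_T[OF Fx[OF R]] dt_T
    by (simp only: lift_eq M.metric_add[OF pM(2)] M.metric_scale[OF pM(2)] M.tangent_space_add M.tangent_space_scale)
  then show ?thesis
    using warped_metric_lift(2)[OF t xF lift_T[OF Fx[OF R]]] warped_metric_dt(2)[OF t xF lift_T[OF Fx[OF R]]]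
    by (simp add: C Fx U V R dproj_lift[OF t] lift_vec_fst_id algebra_simps)
qed

text \<open>The interval field is parallel along itself and commutes with lifts, so only its
  derivative q U along the lift, q = f'/f, is differentiated once more along t, giving (q' + q^2) U.
  The factor q' + q^2 is f''/f, left unexpanded because what counts is that it depends on t
  alone.\<close>

lemma curvature_dt_lift:
  assumes U: "vector_field_on F W U"
  shows "g (t, x) (curvature M D dt_field (lift U) dt_field (t, x)) (lift U (t, x))
    = (deriv (\<lambda>s. deriv f s / f s) t + (deriv f t / f t)\<^sup>2) * (f t)\<^sup>2 * gF x (U x) (U x)"
proof -
  let ?q = "\<lambda>s. deriv f s / f s"
  note Ux = F.vector_field_tangent[OF U x]
  have "D dt_field (D (lift U) dt_field) (t, x) h
    = dt_field (t, x) (\<lambda>p. ?q (fst p)) * lift U (t, x) h + ?q (fst (t, x)) * D dt_field (lift U) (t, x) h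
      + (dt_field (t, x) (\<lambda>p. 0) * lift U (t, x) h + 0 * D dt_field (lift U) (t, x) h)" for h
    by (rule M.conn_lincomb_right[OF dt_vf lift_vf[OF U] lift_vf[OF U] smooth_fun_fst[OF W(1) smooth_deriv_divide] M.smooth_fun_const _ pM(1)])
      (use conn_lift_dt[OF W _ _ U] in \<open>auto simp: lift_eq\<close>)
  then have 1: "D dt_field (D (lift U) dt_field) (t, x) h = (deriv ?q t + (?q t)\<^sup>2) * lift_vec t x (U x) h" for h
    using dt_field_fst[OF t xF smooth_deriv_divide] M.tangent_const[OF dt_T] conn_dt_lift[OF W t x U]
    by (simp add: lift_eq algebra_simps power2_eq_square)
  have 2: "D (lift U) (D dt_field dt_field) (t, x) h = 0" for h
    by (rule M.conn_zero_right[OF lift_vf[OF U] _ pM(1)]) (use conn_dt_dt[OF W _ _ U] in auto)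
  have 3: "D (lie_bracket M dt_field (lift U)) dt_field (t, x) h = 0" for h
    by (rule M.conn_zero_left[OF dt_vf _ pM(1)]) (use bracket_dt_lift[OF U] in auto)
  have "curvature M D dt_field (lift U) dt_field (t, x) = (\<lambda>h. (deriv ?q t + (?q t)\<^sup>2) * lift_vec t x (U x) h)"
    unfolding curvature_def[of M] 1 2 3 by simp
  then show ?thesis
    using M.metric_scale[OF pM(2) lift_T[OF Ux] lift_T[OF Ux]] warped_metric_lift(1)[OF t xF lift_T[OF Ux] Ux]
    by (simp add: lift_eq dproj_lift[OF t Ux])
qed

text \<open>The two iterated derivatives have f'^2 and (f f')' as coefficients of the interval
  field, each times gF(U,U), and their components along \<open>DF U U\<close> agree and cancel.
  Pairing with a field of square -1 reverses the sign. The bracketed factor is f f''.\<close>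

lemma curvature_lift_dt:
  assumes U: "vector_field_on F W U"
  shows "g (t, x) (curvature M D (lift U) dt_field (lift U) (t, x)) (dt_field (t, x))
    = (deriv (\<lambda>s. f s * deriv f s) t - (deriv f t)\<^sup>2) * gF x (U x) (U x)"
proof -
  let ?q = "\<lambda>s. deriv f s / f s"
  let ?b = "\<lambda>q. f (fst q) * deriv f (fst q) * gF (snd q) (U (snd q)) (U (snd q))"
  note Ux = F.vector_field_tangent[OF U x] and UU = F.conn_vector_field[OF U U]
  have "D (lift U) (D dt_field (lift U)) (t, x) h
    = lift U (t, x) (\<lambda>p. ?q (fst p)) * lift U (t, x) h + ?q (fst (t, x)) * D (lift U) (lift U) (t, x) h
      + (lift U (t, x) (\<lambda>p. 0) * lift U (t, x) h + 0 * D (lift U) (lift U) (t, x) h)" for h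
    by (rule M.conn_lincomb_right[OF lift_vf[OF U] lift_vf[OF U] lift_vf[OF U] smooth_fun_fst[OF W(1) smooth_deriv_divide] M.smooth_fun_const _ pM(1)])
      (use conn_dt_lift[OF W _ _ U] in \<open>auto simp: lift_eq\<close>)
  then have 1: "D (lift U) (D dt_field (lift U)) (t, x) h = ?q t * lift_vec t x (DF U U x) h
      + (deriv f t)\<^sup>2 * gF x (U x) (U x) * dt_field (t, x) h" for h
    using lift_vec_fst[OF Ux, of t ?q] M.tangent_const[OF lift_T[OF Ux]] conn_lift_lift[OF W t x U U] pos_f[OF t]
    by (simp add: lift_eq algebra_simps power2_eq_square)
  have "D dt_field (D (lift U) (lift U)) (t, x) h
    = dt_field (t, x) (\<lambda>q. 1) * lift (DF U U) (t, x) h + 1 * D dt_field (lift (DF U U)) (t, x) h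
      + (dt_field (t, x) ?b * dt_field (t, x) h + ?b (t, x) * D dt_field dt_field (t, x) h)" for h
    by (rule M.conn_lincomb_right[OF dt_vf lift_vf[OF UU] dt_vf M.smooth_fun_const smooth_second_form[OF U U]
          conn_lift_lift_field[OF U U] pM(1)])
  moreover have "dt_field (t, x) ?b = deriv (\<lambda>s. f s * deriv f s) t * gF x (U x) (U x)"
    by (rule dt_separated[OF t x W smooth_mult_deriv F.metric_smooth[OF U U]]) simp
  ultimately have 2: "D dt_field (D (lift U) (lift U)) (t, x) h = ?q t * lift_vec t x (DF U U x) h
      + deriv (\<lambda>s. f s * deriv f s) t * gF x (U x) (U x) * dt_field (t, x) h" for h
    using M.tangent_const[OF dt_T] conn_dt_lift[OF W t x UU] conn_dt_dt[OF W t x U] by simp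
  have 3: "D (lie_bracket M (lift U) dt_field) (lift U) (t, x) h = 0" for h
    by (rule M.conn_zero_left[OF lift_vf[OF U] _ pM(1)]) (use bracket_lift_dt[OF U] in auto)
  have "curvature M D (lift U) dt_field (lift U) (t, x) = (\<lambda>h. (((deriv f t)\<^sup>2 - deriv (\<lambda>s. f s * deriv f s) t)
      * gF x (U x) (U x)) * dt_field (t, x) h)"
    unfolding curvature_def[of M] 1 2 3 by (rule ext) (simp add: algebra_simps)
  then show ?thesis
    using warped_metric_dt(1)[OF t xF dt_T] dt_field_fst_id[OF t xF]
    by (simp only: M.metric_scale[OF pM(2) dt_T dt_T]) (simp add: algebra_simps)
qed

end

section \<open>Contraction in a frame adapted to the product\<close>

text \<open>Index 0 carries the interval field and index i + 1 the lift of \<open>E i\<close>,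
  matching \<open>mdim_interval_prod\<close> and the splitting of sums by
  \<open>sum.lessThan_Suc_shift\<close>.\<close>

definition warped_frame :: "(nat \<Rightarrow> 'm vfield) \<Rightarrow> nat \<Rightarrow> (real \<times> 'm) vfield" where
  "warped_frame E = case_nat dt_field (\<lambda>i. lift (E i))"

context
  fixes W :: "'m set" and E :: "nat \<Rightarrow> 'm vfield" and t :: real and x :: 'm
  assumes E: "F.orthogonal_frame W E" and t: "t \<in> I" and x: "x \<in> W"
begin

private lemma domain: "open W" "W \<subseteq> carrier F"
  using F.orthogonal_frame_open[OF E] F.orthogonal_frame_carrier[OF E] .

private lemma x_carrier: "x \<in> carrier F" using domain x by blast

private lemmas Ef = F.orthogonal_frame_field[OF E]

lemma warped_metric_frame:
  assumes "s \<in> I" "y \<in> W"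
  shows "g (s, y) (dt_field (s, y)) (dt_field (s, y)) = - 1"
    and "i < mdim F \<Longrightarrow> g (s, y) (dt_field (s, y)) (lift (E i) (s, y)) = 0"
    and "i < mdim F \<Longrightarrow> g (s, y) (lift (E i) (s, y)) (dt_field (s, y)) = 0"
    and "vector_field_on F W U \<Longrightarrow> vector_field_on F W V \<Longrightarrow>
      g (s, y) (lift U (s, y)) (lift V (s, y)) = (f s)\<^sup>2 * gF y (U y) (V y)"
proof -
  have yc: "y \<in> carrier F" using domain assms(2) by blast
  note T = F.vector_field_tangent[OF _ assms(2)] and d = dt_tangent[OF assms(1) yc] and l = lift_tangent[OF assms(1) yc]
  show "g (s, y) (dt_field (s, y)) (dt_field (s, y)) = - 1"
    using warped_metric_dt(1)[OF assms(1) yc d] dt_field_fst_id[OF assms(1) yc] by simp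
  show "g (s, y) (dt_field (s, y)) (lift (E i) (s, y)) = 0" "g (s, y) (lift (E i) (s, y)) (dt_field (s, y)) = 0"
    if "i < mdim F"
    using warped_metric_dt[OF assms(1) yc l[OF T[OF Ef[OF that]]]] lift_vec_fst_id[OF T[OF Ef[OF that]]]
    by (simp_all add: lift_eq)
  show "g (s, y) (lift U (s, y)) (lift V (s, y)) = (f s)\<^sup>2 * gF y (U y) (V y)"
    if U: "vector_field_on F W U" and V: "vector_field_on F W V"
    using warped_metric_lift(1)[OF assms(1) yc l[OF T[OF U]] T[OF V]] dproj_lift[OF assms(1) T[OF U]]
    by (simp add: lift_eq)
qed

lemma warped_frame_orthogonal: "M.orthogonal_frame (I \<times> W) (warped_frame E)"
  unfolding M.orthogonal_frame_def mdim_interval_prod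
proof (intro conjI allI impI ballI)
  fix i assume i: "i < Suc (mdim F)"
  show "vector_field_on M (I \<times> W) (warped_frame E i)"
    using i by (cases i) (auto simp: warped_frame_def vector_field_dt_on domain vector_field_lift Ef)
  fix p assume "p \<in> I \<times> W"
  then obtain s y where p: "p = (s, y)" "s \<in> I" "y \<in> W" by auto
  show "g p (warped_frame E i p) (warped_frame E i p) \<noteq> 0"
    using i F.orthogonal_frame_nonnull[OF E p(3)] pos_f[OF p(2)]
    by (cases i) (auto simp: warped_frame_def p(1) warped_metric_frame[OF p(2,3)] Ef)
  fix j assume "j < Suc (mdim F)" "i \<noteq> j"
  then show "g p (warped_frame E i p) (warped_frame E j p) = 0"
    using i F.orthogonal_frame_orthogonal[OF E p(3)]
    by (cases i; cases j) (auto simp: warped_frame_def p(1) warped_metric_frame[OF p(2,3)] Ef)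
qed

text \<open>The interval direction contributes 0, as the derivative of a lift along it is again a
  lift. In the fibre directions f^2 occurs in numerator and denominator.\<close>

lemma divergence_lift:
  assumes P: "vector_field_on F W P"
  shows "divergence M g D (lift P) (t, x) = divergence F gF DF P x"
proof -
  have p: "(t, x) \<in> I \<times> W" using t x by simp
  note T = F.vector_field_tangent[OF _ x]
  have ft: "f t \<noteq> 0" using pos_f[OF t] by simp
  have 0: "g (t, x) (D dt_field (lift P) (t, x)) (dt_field (t, x)) = 0"
    by (rule conn_lift_lift_metric(4)[OF domain t x P P P])
  have i: "g (t, x) (D (lift (E i)) (lift P) (t, x)) (lift (E i) (t, x)) / g (t, x) (lift (E i) (t, x)) (lift (E i) (t, x))
      = gF x (DF (E i) P x) (E i x) / gF x (E i x) (E i x)" if "i < mdim F" for i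
    using conn_lift_lift_metric(1)[OF domain t x Ef[OF that] P Ef[OF that]] warped_metric_frame(4)[OF t x Ef[OF that] Ef[OF that]] ft
    by simp
  show ?thesis
    unfolding M.divergence_frame[OF warped_frame_orthogonal p vector_field_lift[OF P]] F.divergence_frame[OF E x P]
      mdim_interval_prod sum.lessThan_Suc_shift
    using 0 i by (simp add: warped_frame_def)
qed

text \<open>Pairs of frame indices are of four kinds. Two interval fields contribute 0, a mixed pair
  a function of t alone, and a pair i, j of fibre fields its fibre curvature over f^2 plus (f'/f)^2
  times \<delta>_ij - 1. Summed over all fibre pairs, \<delta>_ij - 1 gives l - l^2.\<close>

lemma scalar_curvature_warped:
  defines "l \<equiv> real (mdim F)"
  shows "scalar_curvature M g D (t, x) = scalar_curvature F gF DF x / (f t)\<^sup>2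
    - l * (deriv (\<lambda>s. deriv f s / f s) t + (deriv f t / f t)\<^sup>2)
    - l * (deriv (\<lambda>s. f s * deriv f s) t - (deriv f t)\<^sup>2) / (f t)\<^sup>2
    + (deriv f t / f t)\<^sup>2 * (l - l\<^sup>2)"
proof -
  have p: "(t, x) \<in> I \<times> W" using t x by simp
  have ft: "f t \<noteq> 0" using pos_f[OF t] by simp
  let ?n = "mdim F" and ?N = "\<lambda>i. gF x (E i x) (E i x)"
  note m = warped_metric_frame[OF t x]
  have N: "?N i \<noteq> 0" if "i < ?n" for i using F.orthogonal_frame_nonnull[OF E x that] .
  have 00: "g (t, x) (curvature M D dt_field dt_field dt_field (t, x)) (dt_field (t, x)) = 0"
  proof -
    note d = vector_field_dt_on[OF domain]
    \<comment> \<open>Antisymmetry in the first two arguments forces the curvature with equal ones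
      to vanish.\<close>
    have "curvature M D dt_field dt_field dt_field (t, x) = (\<lambda>h. 0)"
      using M.curvature_antisym[OF d d d p] by (simp add: fun_eq_iff)
    then show ?thesis
      using M.metric_zero[OF _ dt_tangent[OF t x_carrier]] t x_carrier carrier_interval_prod by simp
  qed
  have 01: "g (t, x) (curvature M D dt_field (lift (E j)) dt_field (t, x)) (lift (E j) (t, x))
      / g (t, x) (lift (E j) (t, x)) (lift (E j) (t, x)) / g (t, x) (dt_field (t, x)) (dt_field (t, x))
      = - (deriv (\<lambda>s. deriv f s / f s) t + (deriv f t / f t)\<^sup>2)" if j: "j < ?n" for j
    unfolding curvature_dt_lift[OF domain t x Ef[OF j]] m(1) m(4)[OF Ef[OF j] Ef[OF j]]
    using N[OF j] ft by simp
  have 10: "g (t, x) (curvature M D (lift (E i)) dt_field (lift (E i)) (t, x)) (dt_field (t, x))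
      / g (t, x) (dt_field (t, x)) (dt_field (t, x)) / g (t, x) (lift (E i) (t, x)) (lift (E i) (t, x))
      = - (deriv (\<lambda>s. f s * deriv f s) t - (deriv f t)\<^sup>2) / (f t)\<^sup>2" if i: "i < ?n" for i
    unfolding curvature_lift_dt[OF domain t x Ef[OF i]] m(1) m(4)[OF Ef[OF i] Ef[OF i]]
    using N[OF i] ft by (simp add: field_simps)
  have 11: "g (t, x) (curvature M D (lift (E i)) (lift (E j)) (lift (E i)) (t, x)) (lift (E j) (t, x))
      / g (t, x) (lift (E j) (t, x)) (lift (E j) (t, x)) / g (t, x) (lift (E i) (t, x)) (lift (E i) (t, x))
      = gF x (curvature F DF (E i) (E j) (E i) x) (E j x) / ?N j / ?N i / (f t)\<^sup>2
        + (deriv f t / f t)\<^sup>2 * ((if i = j then 1 else 0) - 1)" if i: "i < ?n" and j: "j < ?n" for i j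
  proof -
    have G: "gF x (E j x) (E i x) * gF x (E i x) (E j x) = (if i = j then 1 else 0) * ?N i * ?N j"
      using F.orthogonal_frame_orthogonal[OF E x i j] by auto
    show ?thesis
      unfolding curvature_lift_lift[OF domain t x Ef[OF i] Ef[OF j] Ef[OF i] Ef[OF j]] G
        m(4)[OF Ef[OF i] Ef[OF i]] m(4)[OF Ef[OF j] Ef[OF j]]
      using N[OF i] N[OF j] ft by (simp add: field_simps power2_eq_square)
  qed
  have "scalar_curvature M g D (t, x) = (\<Sum>j<?n. - (deriv (\<lambda>s. deriv f s / f s) t + (deriv f t / f t)\<^sup>2))
    + (\<Sum>i<?n. - (deriv (\<lambda>s. f s * deriv f s) t - (deriv f t)\<^sup>2) / (f t)\<^sup>2
      + (\<Sum>j<?n. gF x (curvature F DF (E i) (E j) (E i) x) (E j x) / ?N j / ?N i / (f t)\<^sup>2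
        + (deriv f t / f t)\<^sup>2 * ((if i = j then 1 else 0) - 1)))"
    unfolding M.scalar_curvature_frame[OF warped_frame_orthogonal p] mdim_interval_prod sum.lessThan_Suc_shift
    using 00 01 10 11 by (simp add: warped_frame_def)
  also have "(\<Sum>i<?n. - (deriv (\<lambda>s. f s * deriv f s) t - (deriv f t)\<^sup>2) / (f t)\<^sup>2
      + (\<Sum>j<?n. gF x (curvature F DF (E i) (E j) (E i) x) (E j x) / ?N j / ?N i / (f t)\<^sup>2
        + (deriv f t / f t)\<^sup>2 * ((if i = j then 1 else 0) - 1)))
    = (\<Sum>i<?n. - (deriv (\<lambda>s. f s * deriv f s) t - (deriv f t)\<^sup>2) / (f t)\<^sup>2
      + ((\<Sum>j<?n. gF x (curvature F DF (E i) (E j) (E i) x) (E j x) / ?N j / ?N i) / (f t)\<^sup>2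
        + (deriv f t / f t)\<^sup>2 * (1 - l)))"
  proof (rule sum.cong[OF refl])
    fix i assume "i \<in> {..<?n}"
    then have "(\<Sum>j<?n. (deriv f t / f t)\<^sup>2 * ((if i = j then 1 else 0) - 1)) = (deriv f t / f t)\<^sup>2 * (1 - l)"
      by (simp add: sum_subtractf l_def flip: sum_distrib_left)
    then show "- (deriv (\<lambda>s. f s * deriv f s) t - (deriv f t)\<^sup>2) / (f t)\<^sup>2
      + (\<Sum>j<?n. gF x (curvature F DF (E i) (E j) (E i) x) (E j x) / ?N j / ?N i / (f t)\<^sup>2
        + (deriv f t / f t)\<^sup>2 * ((if i = j then 1 else 0) - 1))
      = - (deriv (\<lambda>s. f s * deriv f s) t - (deriv f t)\<^sup>2) / (f t)\<^sup>2
      + ((\<Sum>j<?n. gF x (curvature F DF (E i) (E j) (E i) x) (E j x) / ?N j / ?N i) / (f t)\<^sup>2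
        + (deriv f t / f t)\<^sup>2 * (1 - l))"
      by (simp only: sum.distrib sum_divide_distrib)
  qed
  finally show ?thesis
    unfolding F.scalar_curvature_frame[OF E x] sum.distrib sum_divide_distrib[symmetric]
    by (simp add: l_def[symmetric] algebra_simps power2_eq_square add_divide_distrib diff_divide_distrib)
qed

end

text \<open>The constant c may depend on t but not on x, which is all that is retained of the
  warping terms. The coefficient n - 1 of the general formula is \<open>mdim F\<close>, and the
  squared length of the lift supplies the factor f^2.\<close>

lemma scalar_curvature_quarter_symmetric_warped:
  fixes a b :: real
  assumes P: "vector_field_on F (carrier F) P" and t: "t \<in> I"
  shows "\<exists>c. \<forall>x\<in>carrier F.
    scalar_curvature M g (quarter_symmetric g D (lift P) a b) (t, x) = scalar_curvature F gF DF x / (f t)\<^sup>2 + c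
      + mdim F * (a + b) * divergence F gF DF P x
      + mdim F * (real (mdim M) * a * b - a\<^sup>2 - b\<^sup>2) * (f t)\<^sup>2 * gF x (P x) (P x)"
proof -
  let ?l = "real (mdim F)"
  let ?c = "- ?l * (deriv (\<lambda>s. deriv f s / f s) t + (deriv f t / f t)\<^sup>2)
    - ?l * (deriv (\<lambda>s. f s * deriv f s) t - (deriv f t)\<^sup>2) / (f t)\<^sup>2
    + (deriv f t / f t)\<^sup>2 * (?l - ?l\<^sup>2)"
  have "scalar_curvature M g (quarter_symmetric g D (lift P) a b) (t, x) = scalar_curvature F gF DF x / (f t)\<^sup>2 + ?c
      + ?l * (a + b) * divergence F gF DF P x
      + ?l * (real (mdim M) * a * b - a\<^sup>2 - b\<^sup>2) * (f t)\<^sup>2 * gF x (P x) (P x)"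
    if x: "x \<in> carrier F" for x
  proof -
    obtain W where W: "open W" "x \<in> W" and E: "orthonormal_frame F gF W (frame_at F gF x)"
      using F.frame_at_orthonormal[OF x] .
    note O = F.orthonormal_imp_orthogonal[OF E]
    have PW: "vector_field_on F W P" using F.vector_field_subset[OF P W(1) F.orthogonal_frame_carrier[OF O]] .
    have lP: "vector_field_on M (carrier M) (lift P)" using vector_field_lift[OF P] carrier_interval_prod by simp
    have p: "(t, x) \<in> carrier M" using t x carrier_interval_prod by simp
    show ?thesis
      unfolding M.scalar_curvature_quarter_symmetric[OF lP p] scalar_curvature_warped[OF O t W(2)]
        divergence_lift[OF O t W(2) PW] warped_metric_frame(4)[OF O t W(2) t W(2) PW PW]
      by (simp add: mdim_interval_prod)
  qed
  then show ?thesis by (intro exI[of _ ?c] ballI)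
qed

end

theorem proposition3p18:
  fixes F :: "('m::{t2_space, second_countable_topology}, 'e::euclidean_space) chart set"
    and gF :: "'m metric" and I :: "real set" and f :: "real \<Rightarrow> real"
    and P :: "'m vfield" and l1 l2 :: real
    and nablaF :: "'m vfield \<Rightarrow> 'm vfield \<Rightarrow> 'm vfield"
    and nabla :: "(real \<times> 'm) vfield \<Rightarrow> (real \<times> 'm) vfield \<Rightarrow> (real \<times> 'm) vfield"
  defines "M \<equiv> interval_prod I F"
    and "g \<equiv> warped_metric f gF"
    and "nablabar \<equiv> quarter_symmetric (warped_metric f gF) nabla (lift_field I F P) l1 l2"
    and "n \<equiv> real (mdim (interval_prod I F))"
  assumes I: "open I" "is_interval I" "I \<noteq> {}"
    and F: "pseudo_riemannian F gF"
    and f: "smooth_on I f" "\<forall>t\<in>I. f t > 0"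
    and P: "vector_field_on F (carrier F) P"
    and l: "l1 \<noteq> 0" "l2 \<noteq> 0"
    and nablaF: "levi_civita F gF nablaF"
    and nabla: "levi_civita M g nabla"
    and S: "\<exists>c. \<forall>p\<in>carrier M. scalar_curvature M g nablabar p = c"
  shows
    "(l1 + l2 \<noteq> 0 \<and> l1\<^sup>2 + l2\<^sup>2 - n * l1 * l2 = 0 \<and>
        (\<exists>c. \<forall>x\<in>carrier F. divergence F gF nablaF P x = c) \<longrightarrow>
        (\<exists>c. \<forall>x\<in>carrier F. scalar_curvature F gF nablaF x = c)) \<and>
     (l1 = - l2 \<and> l1 \<noteq> 0 \<and>
        (\<exists>c. \<forall>x\<in>carrier F. gF x (P x) (P x) = c) \<longrightarrow>
        (\<exists>c. \<forall>x\<in>carrier F. scalar_curvature F gF nablaF x = c)) \<and>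
     (l1 + l2 \<noteq> 0 \<and> l1\<^sup>2 + l2\<^sup>2 - n * l1 * l2 \<noteq> 0 \<and>
        (\<exists>c. \<forall>x\<in>carrier F. divergence F gF nablaF P x = c) \<and>
        (\<exists>c. \<forall>x\<in>carrier F. gF x (P x) (P x) = c) \<longrightarrow>
        (\<exists>c. \<forall>x\<in>carrier F. scalar_curvature F gF nablaF x = c))"
proof -
  have mfd: "smooth_manifold F" using F unfolding pseudo_riemannian_def by blast
  interpret w: warped_product F gF I f
  proof unfold_locales
    show "0 < f t" if "t \<in> I" for t using f(2) that by blast
  qed (rule F mfd I(1) f(1))+
  interpret w: warped_levi_civita F gF I f nablaF nabla
    by unfold_locales (rule nablaF nabla[unfolded M_def g_def])+
  obtain t where t: "t \<in> I" using I(3) by blast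
  then have ft: "f t \<noteq> 0" using f(2) by fastforce
  obtain s where s: "\<forall>p\<in>carrier M. scalar_curvature M g nablabar p = s" using S by blast
  obtain c where c: "\<forall>x\<in>carrier F. scalar_curvature M g nablabar (t, x)
      = scalar_curvature F gF nablaF x / (f t)\<^sup>2 + c + mdim F * (l1 + l2) * divergence F gF nablaF P x
      + mdim F * (n * l1 * l2 - l1\<^sup>2 - l2\<^sup>2) * (f t)\<^sup>2 * gF x (P x) (P x)"
    using w.scalar_curvature_quarter_symmetric_warped[where a = l1 and b = l2, OF P t]
    unfolding M_def g_def nablabar_def n_def by (elim exE)
  \<comment> \<open>Solved for the fibre scalar curvature, which is possible as f t is nonzero;
    moved across, the last coefficient has the sign in which the case distinction states it.\<close>
  have eq: "scalar_curvature F gF nablaF x = (f t)\<^sup>2 * (s - c - mdim F * (l1 + l2) * divergence F gF nablaF P x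
      + mdim F * (l1\<^sup>2 + l2\<^sup>2 - n * l1 * l2) * (f t)\<^sup>2 * gF x (P x) (P x))" if x: "x \<in> carrier F" for x
  proof -
    have "(t, x) \<in> carrier M" using t x w.carrier_interval_prod unfolding M_def by simp
    then have "scalar_curvature F gF nablaF x / (f t)\<^sup>2 = s - c - mdim F * (l1 + l2) * divergence F gF nablaF P x
      + mdim F * (l1\<^sup>2 + l2\<^sup>2 - n * l1 * l2) * (f t)\<^sup>2 * gF x (P x) (P x)"
      using s bspec[OF c x] by (simp add: algebra_simps)
    then show ?thesis using ft by (simp add: divide_eq_eq mult.commute)
  qed
  show ?thesis
  \<comment> \<open>No witness is named in the three cases: after rewriting with \<open>eq\<close>
    the right side no longer depends on x, and the simplifier solves for the constant.\<close>
  proof (intro conjI impI; elim conjE exE)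
    fix d assume "l1\<^sup>2 + l2\<^sup>2 - n * l1 * l2 = 0" "\<forall>x\<in>carrier F. divergence F gF nablaF P x = d"
    then show "\<exists>c. \<forall>x\<in>carrier F. scalar_curvature F gF nablaF x = c" by (simp add: eq)
  next
    fix e assume "l1 = - l2" "\<forall>x\<in>carrier F. gF x (P x) (P x) = e"
    then show "\<exists>c. \<forall>x\<in>carrier F. scalar_curvature F gF nablaF x = c" by (simp add: eq)
  next
    fix d e assume "\<forall>x\<in>carrier F. divergence F gF nablaF P x = d" "\<forall>x\<in>carrier F. gF x (P x) (P x) = e"
    then show "\<exists>c. \<forall>x\<in>carrier F. scalar_curvature F gF nablaF x = c" by (simp add: eq)
  qed
qed

end
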